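(* Let $\alpha,K>0$, $\beta\in(0,1]$, $\gamma\in(0,1)$, and let $p^\star=e^{-u+a}$ be an $(\alpha,\beta,K)$-weakly log-concave probability density on $\mathbb R^d$. Let $f,g,\sigma\in C^1_{\text{a.e.}}([0,1],[0,1])$ be such that: (1) $f$ is increasing and $g$ is decreasing, with $f_0=0$, $f_1=1$, $g_0=1$, $g_1=0$; (2) $\sigma_0=\sigma_1=0$ and there exists $\delta\in(0,1)$ such that $\sigma_t'>0$ for all $t\in[0,\delta)$ and $\sigma_t'<0$ for all $t\in(\delta,1)$; (3) there exists $q\in[0,1]$ such that $|g_t'f_t-f_t'g_t|\le K\sigma_t^q$ and $\int_0^1\sigma_t^{-1+q}\,dt\le K$; (4) $g_t+f_t\ge\gamma$ for all $t\in[0,1]$, and $g_t\ge\gamma$ for all $t\in(0,\delta)$. Let $X_0\sim\mathcal N(0,I_d)$, $Y\sim p^\star$, $\xi\sim\mathcal N(0,I_d)$ be independent, set $X_t=g_tX_0+f_tY+\sigma_t\xi$ and $v_t(x)=\mathbb E[g_t'X_0+f_t'Y+\sigma_t'\xi\mid X_t=x]$. Then there is a constant $C>0$ depending only on $\alpha,\beta,K,\gamma,\sigma_\delta$, and not on the dimension $d$, such that for all $z\in[0,1]$, $$\int_z^1\sup_{x\in\mathbb R^d}\lambda_{\max}\big(\nabla v_t(x)\big)\,dt\le C.$$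
   Context: Weak log-concavity. For $\alpha,K>0$ and $\beta\in(0,1]$, a probability density $p$ on $\mathbb R^d$ is $(\alpha,\beta,K)$-weakly log-concave if $p=\exp(-u+a)$ where (1) $u:\mathbb R^d\to\mathbb R\cup\{+\infty\}$ is convex, $C^2$ on the interior of the support, with $\nabla^2u\succeq\alpha\,\mathrm{Id}$ there; (2) $|a(x)-a(y)|\le K\|x-y\|^\beta$ for all $x,y\in\mathbb R^d$. Explicitly, with $m_t(x_0,x_1)=g_tx_0+f_tx_1$ and $\pi=\mathcal N(0,I_d)\otimes p^\star$, for $\sigma_t>0$, $v_t(x)=\int\big(\frac{\sigma_t'}{\sigma_t}(x-m_t(z))+m_t'(z)\big)\pi^{t,x}(dz)$, where $\pi^{t,x}(dz)\propto\exp(-\|x-m_t(z)\|^2/(2\sigma_t^2))\,\pi(dz)$. Primes denote time derivatives (conditions on derivatives are meant where they exist). For a square matrix $A$, $\lambda_{\max}(A)$ is the largest eigenvalue of $(A+A^\top)/2$; $\nabla v_t$ is the Jacobian in $x$. $C^1_{\text{a.e.}}([0,1],[0,1])$ denotes absolutely continuous functions $[0,1]\to[0,1]$ that are continuously differentiable outside a closed Lebesgue-null set. *)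

theory Defs
  imports "HOL-Probability.Probability" "Jordan_Normal_Form.Char_Poly"
begin

section \<open>Euclidean space of variable dimension\<close>

text \<open>
  The constant in the theorem must not depend on the dimension, so \<open>d\<close> is quantified inside the
  statement and cannot be a type. A point of \<open>d\<close>-dimensional space is an extensional function on
  \<open>{..<d}\<close>, i.e. an element of the space of the product measure \<open>Rd_lborel d\<close>.
\<close>

definition Rd :: "nat \<Rightarrow> (nat \<Rightarrow> real) set" where
  "Rd d = ({..<d} \<rightarrow>\<^sub>E UNIV)"

definition Rd_top :: "nat \<Rightarrow> (nat \<Rightarrow> real) topology" where
  "Rd_top d = product_topology (\<lambda>_. euclideanreal) {..<d}"

definition Rd_lborel :: "nat \<Rightarrow> (nat \<Rightarrow> real) measure" where
  "Rd_lborel d = Pi\<^sub>M {..<d} (\<lambda>_. lborel)"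

definition Rd_norm :: "nat \<Rightarrow> (nat \<Rightarrow> real) \<Rightarrow> real" where
  "Rd_norm d x = L2_set x {..<d}"

definition lincomb :: "nat \<Rightarrow> real \<Rightarrow> (nat \<Rightarrow> real) \<Rightarrow> real \<Rightarrow> (nat \<Rightarrow> real) \<Rightarrow> (nat \<Rightarrow> real)" where
  "lincomb d r x s y = (\<lambda>i\<in>{..<d}. r * x i + s * y i)"

definition std_gaussian :: "nat \<Rightarrow> (nat \<Rightarrow> real) measure" where
  "std_gaussian d = Pi\<^sub>M {..<d} (\<lambda>_. density lborel (\<lambda>x. ennreal (std_normal_density x)))"

definition partial :: "nat \<Rightarrow> ((nat \<Rightarrow> real) \<Rightarrow> real) \<Rightarrow> (nat \<Rightarrow> real) \<Rightarrow> real" where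
  "partial i F x = deriv (\<lambda>s. F (x(i := s))) (x i)"

definition has_partials_on :: "nat \<Rightarrow> (nat \<Rightarrow> real) set \<Rightarrow> ((nat \<Rightarrow> real) \<Rightarrow> real) \<Rightarrow> bool" where
  "has_partials_on d U F \<longleftrightarrow>
     (\<forall>x\<in>U. \<forall>i<d. (\<lambda>s. F (x(i := s))) field_differentiable (at (x i)))"

definition continuous_in :: "nat \<Rightarrow> (nat \<Rightarrow> real) set \<Rightarrow> ((nat \<Rightarrow> real) \<Rightarrow> real) \<Rightarrow> bool" where
  "continuous_in d U F \<longleftrightarrow> continuous_map (subtopology (Rd_top d) U) euclideanreal F"

text \<open>Used for sets \<open>U\<close> that are open in \<open>Rd_top d\<close>.\<close>

definition C2_on :: "nat \<Rightarrow> (nat \<Rightarrow> real) set \<Rightarrow> ((nat \<Rightarrow> real) \<Rightarrow> real) \<Rightarrow> bool" where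
  "C2_on d U F \<longleftrightarrow>
     continuous_in d U F \<and> has_partials_on d U F \<and>
     (\<forall>i<d. continuous_in d U (partial i F) \<and> has_partials_on d U (partial i F) \<and>
       (\<forall>j<d. continuous_in d U (partial j (partial i F))))"


section \<open>Weak log-concavity\<close>

definition prob_density :: "nat \<Rightarrow> ((nat \<Rightarrow> real) \<Rightarrow> real) \<Rightarrow> bool" where
  "prob_density d p \<longleftrightarrow>
     p \<in> borel_measurable (Rd_lborel d) \<and> (\<forall>x\<in>Rd d. 0 \<le> p x) \<and>
     (\<integral>\<^sup>+ x. ennreal (p x) \<partial>Rd_lborel d) = 1"

definition support_interior :: "nat \<Rightarrow> ((nat \<Rightarrow> real) \<Rightarrow> real) \<Rightarrow> (nat \<Rightarrow> real) set" where
  "support_interior d p =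
     Rd_top d interior_of (Rd_top d closure_of {x \<in> Rd d. p x \<noteq> 0})"

text \<open>With the conventions of \<^typ>\<open>ereal\<close>, \<open>0 * \<infinity> = 0\<close>.\<close>

definition Rd_convex :: "nat \<Rightarrow> ((nat \<Rightarrow> real) \<Rightarrow> ereal) \<Rightarrow> bool" where
  "Rd_convex d u \<longleftrightarrow>
     (\<forall>x\<in>Rd d. \<forall>y\<in>Rd d. \<forall>r\<in>{0..1}.
        u (lincomb d r x (1 - r) y) \<le> ereal r * u x + ereal (1 - r) * u y)"

text \<open>
  The exponent \<open>-u + a\<close> is \<open>-\<infinity>\<close>, and hence the density \<open>0\<close>, where \<open>u = \<infinity>\<close>. On the interior of the
  support \<open>u\<close> is finite, so that \<open>real_of_ereal (u x)\<close> is the value of \<open>u\<close> there.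
\<close>

definition weakly_log_concave ::
  "nat \<Rightarrow> real \<Rightarrow> real \<Rightarrow> real \<Rightarrow> ((nat \<Rightarrow> real) \<Rightarrow> real) \<Rightarrow> bool" where
  "weakly_log_concave d \<alpha> \<beta> K p \<longleftrightarrow>
     prob_density d p \<and>
     (\<exists>(u :: (nat \<Rightarrow> real) \<Rightarrow> ereal) (a :: (nat \<Rightarrow> real) \<Rightarrow> real).
        (\<forall>x\<in>Rd d. u x \<noteq> -\<infinity>) \<and>
        (\<forall>x\<in>Rd d. p x = (if u x = \<infinity> then 0 else exp (- real_of_ereal (u x) + a x))) \<and>
        Rd_convex d u \<and>
        (\<forall>x\<in>support_interior d p. u x \<noteq> \<infinity>) \<and>
        C2_on d (support_interior d p) (\<lambda>x. real_of_ereal (u x)) \<and>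
        (\<forall>x\<in>support_interior d p. \<forall>w :: nat \<Rightarrow> real.
           (\<Sum>i<d. \<Sum>j<d. partial j (partial i (\<lambda>x. real_of_ereal (u x))) x * w i * w j)
             \<ge> \<alpha> * (\<Sum>i<d. (w i)\<^sup>2)) \<and>
        (\<forall>x\<in>Rd d. \<forall>y\<in>Rd d. \<bar>a x - a y\<bar> \<le> K * Rd_norm d (lincomb d 1 x (-1) y) powr \<beta>))"


section \<open>Schedules\<close>

text \<open>Time derivatives at the endpoints of \<open>[0,1]\<close> are one-sided.\<close>

definition tdifferentiable :: "(real \<Rightarrow> real) \<Rightarrow> real \<Rightarrow> bool" where
  "tdifferentiable h t \<longleftrightarrow> h differentiable (at t within {0..1})"

definition tderiv :: "(real \<Rightarrow> real) \<Rightarrow> real \<Rightarrow> real" where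
  "tderiv h t = vector_derivative h (at t within {0..1})"

definition abs_continuous01 :: "(real \<Rightarrow> real) \<Rightarrow> bool" where
  "abs_continuous01 h \<longleftrightarrow>
     (\<forall>\<epsilon>>0. \<exists>\<eta>>0. \<forall>(n::nat) (l :: nat \<Rightarrow> real) (r :: nat \<Rightarrow> real).
        (\<forall>k<n. 0 \<le> l k \<and> l k \<le> r k \<and> r k \<le> 1) \<longrightarrow>
        disjoint_family_on (\<lambda>k. {l k<..<r k}) {..<n} \<longrightarrow>
        (\<Sum>k<n. r k - l k) < \<eta> \<longrightarrow>
        (\<Sum>k<n. \<bar>h (r k) - h (l k)\<bar>) < \<epsilon>)"

definition C1_ae :: "(real \<Rightarrow> real) \<Rightarrow> bool" where
  "C1_ae h \<longleftrightarrow>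
     h ` {0..1} \<subseteq> {0..1} \<and> abs_continuous01 h \<and>
     (\<exists>N. closed N \<and> N \<in> null_sets lborel \<and>
        (\<forall>t\<in>{0..1} - N. tdifferentiable h t) \<and> continuous_on ({0..1} - N) (tderiv h))"

text \<open>Real powers with \<open>0\<^sup>0 = 1\<close>, whereas \<open>0 powr 0 = 0\<close>.\<close>

definition rpow :: "real \<Rightarrow> real \<Rightarrow> real" where
  "rpow x r = (if r = 0 then 1 else x powr r)"

definition admissible_schedule ::
  "real \<Rightarrow> real \<Rightarrow> real \<Rightarrow> (real \<Rightarrow> real) \<Rightarrow> (real \<Rightarrow> real) \<Rightarrow> (real \<Rightarrow> real) \<Rightarrow> bool" where
  "admissible_schedule K \<gamma> \<delta> f g \<sigma> \<longleftrightarrow>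
     C1_ae f \<and> C1_ae g \<and> C1_ae \<sigma> \<and>
     mono_on {0..1} f \<and> antimono_on {0..1} g \<and> f 0 = 0 \<and> f 1 = 1 \<and> g 0 = 1 \<and> g 1 = 0 \<and>
     \<sigma> 0 = 0 \<and> \<sigma> 1 = 0 \<and> 0 < \<delta> \<and> \<delta> < 1 \<and>
     (\<forall>t\<in>{0..<\<delta>}. tdifferentiable \<sigma> t \<longrightarrow> tderiv \<sigma> t > 0) \<and>
     (\<forall>t\<in>{\<delta><..<1}. tdifferentiable \<sigma> t \<longrightarrow> tderiv \<sigma> t < 0) \<and>
     (\<exists>q\<in>{0..1}.
        (\<forall>t\<in>{0..1}. tdifferentiable f t \<longrightarrow> tdifferentiable g t \<longrightarrow>
           \<bar>tderiv g t * f t - tderiv f t * g t\<bar> \<le> K * rpow (\<sigma> t) q) \<and>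
        (\<integral>\<^sup>+ t\<in>{0..1}. ennreal (rpow (\<sigma> t) (-1 + q)) \<partial>lborel) \<le> ennreal K) \<and>
     (\<forall>t\<in>{0..1}. g t + f t \<ge> \<gamma>) \<and>
     (\<forall>t\<in>{0<..<\<delta>}. g t \<ge> \<gamma>)"


section \<open>The velocity field\<close>

text \<open>
  Pairs \<open>z = (x\<^sub>0, x\<^sub>1)\<close> are distributed according to \<open>\<pi> = N(0, I) \<otimes> p\<close>, and \<open>posterior\<close> is \<open>\<pi>\<close> reweighted
  by the Gaussian likelihood of observing \<open>x\<close> at time \<open>t\<close>.
\<close>

definition coupling ::
  "nat \<Rightarrow> ((nat \<Rightarrow> real) \<Rightarrow> real) \<Rightarrow> ((nat \<Rightarrow> real) \<times> (nat \<Rightarrow> real)) measure" where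
  "coupling d p = std_gaussian d \<Otimes>\<^sub>M density (Rd_lborel d) (\<lambda>y. ennreal (p y))"

definition interpolant ::
  "nat \<Rightarrow> (real \<Rightarrow> real) \<Rightarrow> (real \<Rightarrow> real) \<Rightarrow> real \<Rightarrow> (nat \<Rightarrow> real) \<times> (nat \<Rightarrow> real) \<Rightarrow> (nat \<Rightarrow> real)" where
  "interpolant d f g t z = lincomb d (g t) (fst z) (f t) (snd z)"

definition interpolant_deriv ::
  "nat \<Rightarrow> (real \<Rightarrow> real) \<Rightarrow> (real \<Rightarrow> real) \<Rightarrow> real \<Rightarrow> (nat \<Rightarrow> real) \<times> (nat \<Rightarrow> real) \<Rightarrow> (nat \<Rightarrow> real)" where
  "interpolant_deriv d f g t z = lincomb d (tderiv g t) (fst z) (tderiv f t) (snd z)"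

definition likelihood ::
  "nat \<Rightarrow> (real \<Rightarrow> real) \<Rightarrow> (real \<Rightarrow> real) \<Rightarrow> (real \<Rightarrow> real) \<Rightarrow> real \<Rightarrow> (nat \<Rightarrow> real)
     \<Rightarrow> (nat \<Rightarrow> real) \<times> (nat \<Rightarrow> real) \<Rightarrow> real" where
  "likelihood d f g \<sigma> t x z =
     exp (- (Rd_norm d (lincomb d 1 x (-1) (interpolant d f g t z)))\<^sup>2 / (2 * (\<sigma> t)\<^sup>2))"

definition posterior ::
  "nat \<Rightarrow> ((nat \<Rightarrow> real) \<Rightarrow> real) \<Rightarrow> (real \<Rightarrow> real) \<Rightarrow> (real \<Rightarrow> real) \<Rightarrow> (real \<Rightarrow> real) \<Rightarrow> real
     \<Rightarrow> (nat \<Rightarrow> real) \<Rightarrow> ((nat \<Rightarrow> real) \<times> (nat \<Rightarrow> real)) measure" where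
  "posterior d p f g \<sigma> t x =
     density (coupling d p)
       (\<lambda>z. ennreal (likelihood d f g \<sigma> t x z / (LINT z'|coupling d p. likelihood d f g \<sigma> t x z')))"

definition velocity ::
  "nat \<Rightarrow> ((nat \<Rightarrow> real) \<Rightarrow> real) \<Rightarrow> (real \<Rightarrow> real) \<Rightarrow> (real \<Rightarrow> real) \<Rightarrow> (real \<Rightarrow> real) \<Rightarrow> real
     \<Rightarrow> (nat \<Rightarrow> real) \<Rightarrow> (nat \<Rightarrow> real)" where
  "velocity d p f g \<sigma> t x =
     (\<lambda>i\<in>{..<d}. LINT z|posterior d p f g \<sigma> t x.
        tderiv \<sigma> t / \<sigma> t * (x i - interpolant d f g t z i) + interpolant_deriv d f g t z i)"


section \<open>The velocity field as a conditional expectation\<close>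

lemma sets_Rd[simp, measurable_cong]:
  "sets (Rd_lborel d) = sets (Pi\<^sub>M {..<d} (\<lambda>_. borel :: real measure))"
  unfolding Rd_lborel_def by (intro sets_PiM_cong) auto

lemma space_Rd[simp]: "space (Rd_lborel d) = Rd d"
  unfolding Rd_lborel_def Rd_def by (simp add: space_PiM)

lemma sets_std_gaussian[simp, measurable_cong]:
  "sets (std_gaussian d) = sets (Rd_lborel d)"
  unfolding std_gaussian_def Rd_lborel_def by (intro sets_PiM_cong) auto

lemma space_std_gaussian[simp]: "space (std_gaussian d) = Rd d"
  unfolding std_gaussian_def Rd_def by (simp add: space_PiM)

lemma sigma_finite_Rd: "sigma_finite_measure (Rd_lborel d)"
  unfolding Rd_lborel_def
  by (intro product_sigma_finite.sigma_finite product_sigma_finite.intro sigma_finite_lborel) auto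

lemma prob_std_gaussian: "prob_space (std_gaussian d)"
  unfolding std_gaussian_def by (intro prob_space_PiM prob_space_normal_density) auto

lemma component_meas[measurable (raw)]:
  assumes "F \<in> M \<rightarrow>\<^sub>M Rd_lborel d" "i < d"
  shows "(\<lambda>\<omega>. F \<omega> i) \<in> borel_measurable M"
proof -
  have "F \<in> M \<rightarrow>\<^sub>M Pi\<^sub>M {..<d} (\<lambda>_. borel :: real measure)"
    using assms(1) measurable_cong_sets[OF refl sets_Rd] by blast
  from measurable_compose[OF this measurable_component_singleton[of i "{..<d}" "\<lambda>_. borel :: real measure"]] assms(2)
  show ?thesis by simp
qed

lemma measurable_lincomb[measurable (raw)]:
  assumes [measurable]: "F \<in> M \<rightarrow>\<^sub>M Rd_lborel d" "G \<in> M \<rightarrow>\<^sub>M Rd_lborel d"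
    and [measurable]: "r \<in> borel_measurable M" "s \<in> borel_measurable M"
  shows "(\<lambda>\<omega>. lincomb d (r \<omega>) (F \<omega>) (s \<omega>) (G \<omega>)) \<in> M \<rightarrow>\<^sub>M Rd_lborel d"
proof -
  have "(\<lambda>\<omega>. lincomb d (r \<omega>) (F \<omega>) (s \<omega>) (G \<omega>)) \<in> M \<rightarrow>\<^sub>M Pi\<^sub>M {..<d} (\<lambda>_. borel :: real measure)"
    unfolding lincomb_def
    by (intro measurable_restrict borel_measurable_add borel_measurable_times
          component_meas[OF assms(1)] component_meas[OF assms(2)] assms(3,4)) auto
  thus ?thesis using measurable_cong_sets[OF refl sets_Rd] by blast
qed

lemma measurable_Rd_norm[measurable]: "Rd_norm d \<in> borel_measurable (Rd_lborel d)"
  unfolding Rd_norm_def L2_set_def by measurable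

lemma shifted_gaussian:
  assumes m: "m \<in> Rd d" and s: "0 < s"
  shows "distr (std_gaussian d) (Rd_lborel d) (\<lambda>\<xi>. lincomb d 1 m s \<xi>) =
    density (Rd_lborel d) (\<lambda>x. ennreal ((1 / sqrt (2 * pi * s\<^sup>2)) ^ d *
      exp (- (Rd_norm d (lincomb d 1 x (-1) m))\<^sup>2 / (2 * s\<^sup>2))))"
    (is "?L = density _ ?c")
proof -
  let ?G = "density lborel (\<lambda>x. ennreal (std_normal_density x))"
  let ?N = "\<lambda>i. density lborel (\<lambda>x. ennreal (normal_density (m i) s x))"
  have sf: "product_sigma_finite ?N"
    by (intro product_sigma_finite.intro prob_space_imp_sigma_finite prob_space_normal_density s)
  have sfl: "product_sigma_finite (\<lambda>_::nat. lborel :: real measure)"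
    by (intro product_sigma_finite.intro sigma_finite_lborel)
  interpret G: prob_space ?G by (intro prob_space_normal_density) simp
  have sfG: "product_sigma_finite (\<lambda>_::nat. ?G)"
    by (intro product_sigma_finite.intro prob_space_imp_sigma_finite G.prob_space_axioms)
  have one: "distr ?G lborel (\<lambda>x. m i + s * x) = ?N i" for i
  proof -
    have "distributed ?G lborel (\<lambda>x. x) (\<lambda>x. ennreal (std_normal_density x))"
      unfolding distributed_def by (auto simp: distr_id2 intro!: measure_eqI simp: emeasure_distr)
    from G.normal_density_affine[OF this, of s "m i"] s
    show ?thesis by (simp add: distributed_def)
  qed
  have setsN: "sets (Pi\<^sub>M {..<d} ?N) = sets (Rd_lborel d)"
    unfolding Rd_lborel_def by (intro sets_PiM_cong) auto
  have mm: "(\<lambda>\<xi>. m) \<in> std_gaussian d \<rightarrow>\<^sub>M Rd_lborel d"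
    using m by (intro measurable_const) simp
  have idm: "(\<lambda>\<xi>. \<xi>) \<in> std_gaussian d \<rightarrow>\<^sub>M Rd_lborel d"
    by (intro measurable_ident_sets) simp
  have lm: "(\<lambda>\<xi>. lincomb d 1 m s \<xi>) \<in> std_gaussian d \<rightarrow>\<^sub>M Rd_lborel d"
    by (intro measurable_lincomb mm idm) auto
  have 1: "?L = Pi\<^sub>M {..<d} ?N"
  proof (rule product_sigma_finite.PiM_eqI[OF sf])
    show "sets ?L = sets (Pi\<^sub>M {..<d} ?N)" using setsN by simp
    fix A :: "nat \<Rightarrow> real set" assume A: "\<And>i. i \<in> {..<d} \<Longrightarrow> A i \<in> sets (?N i)"
    then have A': "\<And>i. i < d \<Longrightarrow> A i \<in> sets borel" by auto
    have PA: "Pi\<^sub>E {..<d} A \<in> sets (Rd_lborel d)"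
      unfolding setsN[symmetric] using A by (intro sets_PiM_I_finite) auto
    have "emeasure ?L (Pi\<^sub>E {..<d} A) =
        emeasure (std_gaussian d) ((\<lambda>\<xi>. lincomb d 1 m s \<xi>) -` Pi\<^sub>E {..<d} A \<inter> space (std_gaussian d))"
      by (intro emeasure_distr lm PA)
    also have "(\<lambda>\<xi>. lincomb d 1 m s \<xi>) -` Pi\<^sub>E {..<d} A \<inter> space (std_gaussian d) =
        Pi\<^sub>E {..<d} (\<lambda>i. (\<lambda>x. m i + s * x) -` A i)"
      unfolding space_std_gaussian Rd_def lincomb_def by (auto simp: PiE_iff)
    also have "emeasure (std_gaussian d) \<dots> = (\<Prod>i<d. emeasure ?G ((\<lambda>x. m i + s * x) -` A i))"
      unfolding std_gaussian_def
    proof (intro product_sigma_finite.emeasure_PiM[OF sfG])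
      fix i assume i: "i \<in> {..<d}"
      have "(\<lambda>x. m i + s * x) \<in> borel \<rightarrow>\<^sub>M borel" by measurable
      from measurable_sets[OF this A', of i] i show "(\<lambda>x. m i + s * x) -` A i \<in> sets ?G" by simp
    qed simp
    also have "\<dots> = (\<Prod>i<d. emeasure (?N i) (A i))"
      using A' by (intro prod.cong refl) (subst one[symmetric], subst emeasure_distr, auto)
    finally show "emeasure ?L (Pi\<^sub>E {..<d} A) = (\<Prod>i\<in>{..<d}. emeasure (?N i) (A i))" .
  qed simp
  have cm: "?c \<in> borel_measurable (Rd_lborel d)"
  proof -
    have "(\<lambda>x. m) \<in> Rd_lborel d \<rightarrow>\<^sub>M Rd_lborel d" using m by (intro measurable_const) simp
    note [measurable] = measurable_lincomb[OF measurable_ident this, of "\<lambda>_. 1" "\<lambda>_. -1", simplified id_def]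
    show ?thesis by measurable
  qed
  have ceq: "?c x = (\<Prod>i<d. ennreal (normal_density (m i) s (x i)))" if "x \<in> Rd d" for x
  proof -
    have nrm: "(Rd_norm d (lincomb d 1 x (-1) m))\<^sup>2 = (\<Sum>i<d. (x i - m i)\<^sup>2)"
      unfolding Rd_norm_def L2_set_def lincomb_def by (simp add: sum_nonneg)
    have "(\<Prod>i<d. normal_density (m i) s (x i)) =
      (1 / sqrt (2 * pi * s\<^sup>2)) ^ d * exp (\<Sum>i<d. - (x i - m i)\<^sup>2 / (2 * s\<^sup>2))"
      unfolding normal_density_def by (simp add: prod.distrib exp_sum prod_dividef power_one_over)
    then show ?thesis
      by (subst prod_ennreal) (simp_all add: nrm sum_negf sum_divide_distrib)
  qed
  have 2: "density (Rd_lborel d) ?c = Pi\<^sub>M {..<d} ?N"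
  proof (rule product_sigma_finite.PiM_eqI[OF sf])
    show "sets (density (Rd_lborel d) ?c) = sets (Pi\<^sub>M {..<d} ?N)" using setsN by simp
    fix A :: "nat \<Rightarrow> real set" assume A: "\<And>i. i \<in> {..<d} \<Longrightarrow> A i \<in> sets (?N i)"
    then have A': "\<And>i. i < d \<Longrightarrow> A i \<in> sets borel" by auto
    have PA: "Pi\<^sub>E {..<d} A \<in> sets (Rd_lborel d)"
      unfolding setsN[symmetric] using A by (intro sets_PiM_I_finite) auto
    have "emeasure (density (Rd_lborel d) ?c) (Pi\<^sub>E {..<d} A) =
       (\<integral>\<^sup>+ x. ?c x * indicator (Pi\<^sub>E {..<d} A) x \<partial>Rd_lborel d)"
      by (rule emeasure_density[OF cm PA])
    also have "\<dots> = (\<integral>\<^sup>+ x. (\<Prod>i<d. ennreal (normal_density (m i) s (x i)) * indicator (A i) (x i)) \<partial>Rd_lborel d)"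
    proof (rule nn_integral_cong)
      fix x assume "x \<in> space (Rd_lborel d)"
      then have x: "x \<in> Rd d" by simp
      have "indicator (Pi\<^sub>E {..<d} A) x = (\<Prod>i<d. indicator (A i) (x i) :: ennreal)"
      proof (cases "\<forall>i<d. x i \<in> A i")
        case True then show ?thesis using x by (auto simp: Rd_def PiE_iff indicator_def)
      next
        case False
        then obtain i where "i < d" "x i \<notin> A i" by auto
        then have "(\<Prod>i<d. indicator (A i) (x i) :: ennreal) = 0"
          by (intro prod_zero) (auto intro!: bexI[of _ i])
        moreover have "x \<notin> Pi\<^sub>E {..<d} A" using False by (auto simp: PiE_iff)
        ultimately show ?thesis by simp
      qed
      then show "?c x * indicator (Pi\<^sub>E {..<d} A) x =
          (\<Prod>i<d. ennreal (normal_density (m i) s (x i)) * indicator (A i) (x i))"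
        by (simp only: ceq[OF x] prod.distrib)
    qed
    also have "\<dots> = (\<Prod>i<d. \<integral>\<^sup>+ y. ennreal (normal_density (m i) s y) * indicator (A i) y \<partial>lborel)"
      unfolding Rd_lborel_def using A'
      by (intro product_sigma_finite.product_nn_integral_prod[OF sfl]) auto
    also have "\<dots> = (\<Prod>i<d. emeasure (?N i) (A i))"
      using A' by (intro prod.cong refl emeasure_density[symmetric]) auto
    finally show "emeasure (density (Rd_lborel d) ?c) (Pi\<^sub>E {..<d} A) = (\<Prod>i\<in>{..<d}. emeasure (?N i) (A i))" .
  qed simp
  show ?thesis unfolding 1 2 ..
qed

context
  fixes d :: nat and p :: "(nat \<Rightarrow> real) \<Rightarrow> real" and f g \<sigma> :: "real \<Rightarrow> real" and t :: real
  assumes p: "prob_density d p" and s: "0 < \<sigma> t"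
begin

private abbreviation "\<Lambda> \<equiv> Rd_lborel d"
private abbreviation "\<Gamma> \<equiv> std_gaussian d"
private abbreviation "\<Theta> \<equiv> coupling d p"
private abbreviation "m \<equiv> interpolant d f g t"
private abbreviation "w \<equiv> likelihood d f g \<sigma> t"
private definition "c = (1 / sqrt (2 * pi * (\<sigma> t)\<^sup>2)) ^ d"

private lemma c_pos: "0 < c"
  unfolding c_def using s by simp

private lemma p_meas[measurable]: "p \<in> borel_measurable \<Lambda>"
  using p unfolding prob_density_def by simp

private lemma prob_p: "prob_space (density \<Lambda> (\<lambda>y. ennreal (p y)))"
  proof (intro prob_spaceI)
  have "emeasure (density \<Lambda> (\<lambda>y. ennreal (p y))) (space \<Lambda>) = (\<integral>\<^sup>+ y. ennreal (p y) * indicator (space \<Lambda>) y \<partial>\<Lambda>)"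
    by (intro emeasure_density) measurable
  also have "\<dots> = (\<integral>\<^sup>+ y. ennreal (p y) \<partial>\<Lambda>)"
    by (intro nn_integral_cong) simp
  also have "\<dots> = 1" using p unfolding prob_density_def by simp
  finally show "emeasure (density \<Lambda> (\<lambda>y. ennreal (p y))) (space (density \<Lambda> (\<lambda>y. ennreal (p y)))) = 1"
    by simp
qed

private lemma sets_\<Theta>[simp, measurable_cong]: "sets \<Theta> = sets (\<Lambda> \<Otimes>\<^sub>M \<Lambda>)"
  unfolding coupling_def by (intro sets_pair_measure_cong) auto

private lemma space_\<Theta>: "space \<Theta> = Rd d \<times> Rd d"
  unfolding coupling_def by (simp add: space_pair_measure)

private lemma prob_\<Theta>: "prob_space \<Theta>"
  unfolding coupling_def by (intro prob_space_pair prob_std_gaussian prob_p)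

private lemma m_meas[measurable]: "m \<in> \<Theta> \<rightarrow>\<^sub>M \<Lambda>"
proof -
  have "(\<lambda>z. lincomb d (g t) (fst z) (f t) (snd z)) \<in> \<Lambda> \<Otimes>\<^sub>M \<Lambda> \<rightarrow>\<^sub>M \<Lambda>" by measurable
  then show ?thesis
    unfolding interpolant_def[abs_def] using measurable_cong_sets[OF sets_\<Theta> refl] by blast
qed

private lemma m_space: "m z \<in> Rd d"
  unfolding interpolant_def lincomb_def Rd_def by auto

private lemma w_meas: "(\<lambda>(x, z). w x z) \<in> borel_measurable (\<Lambda> \<Otimes>\<^sub>M \<Theta>)"
proof -
  have 1: "(\<lambda>q. lincomb d 1 (fst q) (-1) (m (snd q))) \<in> \<Lambda> \<Otimes>\<^sub>M \<Theta> \<rightarrow>\<^sub>M \<Lambda>"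
    by measurable
  note [measurable] = measurable_compose[OF 1 measurable_Rd_norm]
  show ?thesis unfolding likelihood_def split_beta' by measurable
qed

private lemma w_bounds: "0 < w x z" "w x z \<le> 1"
  unfolding likelihood_def by (auto intro!: divide_nonneg_nonneg)

private lemma w_int: "x \<in> Rd d \<Longrightarrow> integrable \<Theta> (w x)"
proof -
  assume x: "x \<in> Rd d"
  interpret prob_space \<Theta> by (rule prob_\<Theta>)
  have "(\<lambda>z. (x, z)) \<in> \<Theta> \<rightarrow>\<^sub>M \<Lambda> \<Otimes>\<^sub>M \<Theta>" using x by (intro measurable_Pair1') simp
  from measurable_compose[OF this w_meas] have "w x \<in> borel_measurable \<Theta>" by simp
  then show ?thesis
    by (intro integrable_const_bound[of _ 1]) (use w_bounds in \<open>auto simp: less_imp_le\<close>)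
qed

private definition "W x = (LINT z|\<Theta>. w x z)"

private lemma W_pos: "x \<in> Rd d \<Longrightarrow> 0 < W x"
proof -
  assume x: "x \<in> Rd d"
  interpret prob_space \<Theta> by (rule prob_\<Theta>)
  have "0 \<le> W x" unfolding W_def by (intro Bochner_Integration.integral_nonneg) (simp add: w_bounds less_imp_le)
  moreover have "W x \<noteq> 0"
  proof
    assume "W x = 0"
    then have "AE z in \<Theta>. w x z = 0"
      unfolding W_def by (subst (asm) integral_nonneg_eq_0_iff_AE[OF w_int[OF x]]) (auto simp: w_bounds less_imp_le)
    then have "AE z in \<Theta>. False" by eventually_elim (use w_bounds(1) in \<open>metis less_irrefl\<close>)
    then show False by simp
  qed
  ultimately show "0 < W x" by simp
qed

private lemma joint_density:
  "distr (\<Theta> \<Otimes>\<^sub>M \<Gamma>) (\<Lambda> \<Otimes>\<^sub>M \<Theta>) (\<lambda>(z, \<xi>). (lincomb d 1 (m z) (\<sigma> t) \<xi>, z)) =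
   density (\<Lambda> \<Otimes>\<^sub>M \<Theta>) (\<lambda>(x, z). ennreal (c * w x z))" (is "?L = ?R")
proof (rule measure_eqI)
  show "sets ?L = sets ?R" by simp
  fix A assume "A \<in> sets ?L"
  then have A[measurable]: "A \<in> sets (\<Lambda> \<Otimes>\<^sub>M \<Theta>)" by simp
  interpret \<Theta>: prob_space \<Theta> by (rule prob_\<Theta>)
  interpret \<Gamma>: prob_space \<Gamma> by (rule prob_std_gaussian)
  interpret \<Lambda>: sigma_finite_measure \<Lambda> by (rule sigma_finite_Rd)
  interpret \<Lambda>\<Theta>: pair_sigma_finite \<Lambda> \<Theta> ..
  note [measurable] = w_meas
  have [measurable]: "(\<lambda>q. snd q) \<in> \<Theta> \<Otimes>\<^sub>M \<Gamma> \<rightarrow>\<^sub>M \<Lambda>"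
    using measurable_snd[of \<Theta> \<Gamma>] measurable_cong_sets[OF refl sets_std_gaussian] by blast
  have ph: "(\<lambda>(z, \<xi>). (lincomb d 1 (m z) (\<sigma> t) \<xi>, z)) \<in> \<Theta> \<Otimes>\<^sub>M \<Gamma> \<rightarrow>\<^sub>M \<Lambda> \<Otimes>\<^sub>M \<Theta>"
    unfolding split_beta' by measurable
  have "emeasure ?L A = (\<integral>\<^sup>+ q. indicator A q \<partial>?L)"
    using A by (intro nn_integral_indicator[symmetric]) simp
  also have "\<dots> = (\<integral>\<^sup>+ q. indicator A (case q of (z, \<xi>) \<Rightarrow> (lincomb d 1 (m z) (\<sigma> t) \<xi>, z)) \<partial>(\<Theta> \<Otimes>\<^sub>M \<Gamma>))"
    by (subst nn_integral_distr[OF ph]) auto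
  also have "\<dots> = (\<integral>\<^sup>+ z. \<integral>\<^sup>+ \<xi>. indicator A (lincomb d 1 (m z) (\<sigma> t) \<xi>, z) \<partial>\<Gamma> \<partial>\<Theta>)"
    by (subst \<Gamma>.nn_integral_fst[symmetric]) (use ph in \<open>auto intro!: measurable_compose[OF ph]\<close>)
  also have "\<dots> = (\<integral>\<^sup>+ z. \<integral>\<^sup>+ x. ennreal (c * w x z) * indicator A (x, z) \<partial>\<Lambda> \<partial>\<Theta>)"
  proof (rule nn_integral_cong)
    fix z assume z: "z \<in> space \<Theta>"
    have mm: "(\<lambda>\<xi>. m z) \<in> \<Gamma> \<rightarrow>\<^sub>M \<Lambda>" using m_space by (intro measurable_const) simp
    have idm: "(\<lambda>\<xi>. \<xi>) \<in> \<Gamma> \<rightarrow>\<^sub>M \<Lambda>" by (intro measurable_ident_sets) simp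
    have lm: "(\<lambda>\<xi>. lincomb d 1 (m z) (\<sigma> t) \<xi>) \<in> \<Gamma> \<rightarrow>\<^sub>M \<Lambda>"
      by (intro measurable_lincomb mm idm) auto
    have pz: "(\<lambda>x. (x, z)) \<in> \<Lambda> \<rightarrow>\<^sub>M \<Lambda> \<Otimes>\<^sub>M \<Theta>" using z by (intro measurable_Pair2') simp
    have iA: "(\<lambda>x. indicator A (x, z) :: ennreal) \<in> borel_measurable \<Lambda>"
      by (rule measurable_compose[OF pz]) auto
    have wz: "(\<lambda>x. ennreal (c * w x z)) \<in> borel_measurable \<Lambda>"
      using measurable_compose[OF pz w_meas] by simp
    have "(\<integral>\<^sup>+ \<xi>. indicator A (lincomb d 1 (m z) (\<sigma> t) \<xi>, z) \<partial>\<Gamma>) =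
      (\<integral>\<^sup>+ x. indicator A (x, z) \<partial>distr \<Gamma> \<Lambda> (\<lambda>\<xi>. lincomb d 1 (m z) (\<sigma> t) \<xi>))"
      by (subst nn_integral_distr[OF lm]) (use iA in auto)
    also have "\<dots> = (\<integral>\<^sup>+ x. indicator A (x, z) \<partial>density \<Lambda> (\<lambda>x. ennreal (c * w x z)))"
      unfolding shifted_gaussian[OF m_space s] c_def likelihood_def ..
    also have "\<dots> = (\<integral>\<^sup>+ x. ennreal (c * w x z) * indicator A (x, z) \<partial>\<Lambda>)"
      by (rule nn_integral_density[OF wz iA])
    finally show "(\<integral>\<^sup>+ \<xi>. indicator A (lincomb d 1 (m z) (\<sigma> t) \<xi>, z) \<partial>\<Gamma>) =
       (\<integral>\<^sup>+ x. ennreal (c * w x z) * indicator A (x, z) \<partial>\<Lambda>)" .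
  qed
  also have "\<dots> = (\<integral>\<^sup>+ q. (case q of (x, z) \<Rightarrow> ennreal (c * w x z)) * indicator A q \<partial>(\<Lambda> \<Otimes>\<^sub>M \<Theta>))"
    by (subst \<Lambda>\<Theta>.nn_integral_snd[symmetric]) auto
  also have "\<dots> = emeasure ?R A"
    by (intro emeasure_density[symmetric] A) measurable
  finally show "emeasure ?L A = emeasure ?R A" .
qed

text \<open>
  The hypothesis \<open>law\<close> says that \<open>X\<^sub>0\<close>, \<open>Y\<close>, \<open>\<xi>\<close> are independent with laws \<open>N(0, I)\<close>, \<open>p\<close>, \<open>N(0, I)\<close>. For
  \<open>\<sigma> t > 0\<close> the law of \<open>X\<close> has a positive density, so the explicit formula selects a version of the
  conditional expectation that is defined at every point and not only almost everywhere.
\<close>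

lemma velocity_eq_cond_exp:
  fixes M :: "'w measure" and X\<^sub>0 Y \<xi> X :: "'w \<Rightarrow> nat \<Rightarrow> real"
  assumes M: "prob_space M" and i: "i < d"
    and rv: "X\<^sub>0 \<in> M \<rightarrow>\<^sub>M Rd_lborel d" "Y \<in> M \<rightarrow>\<^sub>M Rd_lborel d" "\<xi> \<in> M \<rightarrow>\<^sub>M Rd_lborel d"
    and law: "distr M ((Rd_lborel d \<Otimes>\<^sub>M Rd_lborel d) \<Otimes>\<^sub>M Rd_lborel d) (\<lambda>\<omega>. ((X\<^sub>0 \<omega>, Y \<omega>), \<xi> \<omega>)) =
      (std_gaussian d \<Otimes>\<^sub>M density (Rd_lborel d) (\<lambda>y. ennreal (p y))) \<Otimes>\<^sub>M std_gaussian d"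
    and Y: "integrable M (\<lambda>\<omega>. Y \<omega> i)"
    and X: "\<And>\<omega>. X \<omega> = (\<lambda>j\<in>{..<d}. g t * X\<^sub>0 \<omega> j + f t * Y \<omega> j + \<sigma> t * \<xi> \<omega> j)"
  shows "AE \<omega> in M.
    real_cond_exp M (vimage_algebra (space M) X (Rd_lborel d))
      (\<lambda>\<omega>. tderiv g t * X\<^sub>0 \<omega> i + tderiv f t * Y \<omega> i + tderiv \<sigma> t * \<xi> \<omega> i) \<omega> =
    velocity d p f g \<sigma> t (X \<omega>) i"
proof -
  interpret M: prob_space M by (rule M)
  interpret \<Theta>: prob_space \<Theta> by (rule prob_\<Theta>)
  interpret \<Gamma>: prob_space \<Gamma> by (rule prob_std_gaussian)
  interpret p: prob_space "density \<Lambda> (\<lambda>y. ennreal (p y))" by (rule prob_p)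
  interpret \<Lambda>: sigma_finite_measure \<Lambda> by (rule sigma_finite_Rd)
  interpret P: pair_sigma_finite \<Lambda> \<Theta> ..
  note [measurable] = rv w_meas
  define Z where "Z = (\<lambda>\<omega>. (X\<^sub>0 \<omega>, Y \<omega>))"
  define G where "G = (\<lambda>\<omega>. tderiv g t * X\<^sub>0 \<omega> i + tderiv f t * Y \<omega> i + tderiv \<sigma> t * \<xi> \<omega> i)"
  define H where "H = (\<lambda>x z. tderiv \<sigma> t / \<sigma> t * (x i - m z i) + interpolant_deriv d f g t z i)"
  let ?F = "vimage_algebra (space M) X \<Lambda>"
  let ?J = "(\<Lambda> \<Otimes>\<^sub>M \<Lambda>) \<Otimes>\<^sub>M \<Lambda>"
  let ?\<phi> = "\<lambda>(z, \<xi>). (lincomb d 1 (m z) (\<sigma> t) \<xi>, z)"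
  let ?v = "\<lambda>x. velocity d p f g \<sigma> t x i"
  have law': "distr M ?J (\<lambda>\<omega>. (Z \<omega>, \<xi> \<omega>)) = \<Theta> \<Otimes>\<^sub>M \<Gamma>"
    using law unfolding Z_def coupling_def .
  have setsJ: "sets (\<Theta> \<Otimes>\<^sub>M \<Gamma>) = sets ?J" by (intro sets_pair_measure_cong) auto
  have Zm[measurable]: "Z \<in> M \<rightarrow>\<^sub>M \<Theta>"
  proof -
    have "Z \<in> M \<rightarrow>\<^sub>M \<Lambda> \<Otimes>\<^sub>M \<Lambda>" unfolding Z_def by measurable
    then show ?thesis using measurable_cong_sets[OF refl sets_\<Theta>] by blast
  qed
  have Jm: "(\<lambda>\<omega>. (Z \<omega>, \<xi> \<omega>)) \<in> M \<rightarrow>\<^sub>M ?J" unfolding Z_def by measurable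
  have X_eq: "X \<omega> = lincomb d 1 (m (Z \<omega>)) (\<sigma> t) (\<xi> \<omega>)" for \<omega>
    unfolding X lincomb_def interpolant_def Z_def by (auto simp: fun_eq_iff)
  have Xm[measurable]: "X \<in> M \<rightarrow>\<^sub>M \<Lambda>"
    unfolding X_eq[abs_def] by measurable
  have Xsp: "X \<in> space M \<rightarrow> space \<Lambda>" using measurable_space[OF Xm] by auto
  have [measurable]: "(\<lambda>q. snd q) \<in> \<Theta> \<Otimes>\<^sub>M \<Gamma> \<rightarrow>\<^sub>M \<Lambda>"
    using measurable_snd[of \<Theta> \<Gamma>] measurable_cong_sets[OF refl sets_std_gaussian] by blast
  have ph: "?\<phi> \<in> \<Theta> \<Otimes>\<^sub>M \<Gamma> \<rightarrow>\<^sub>M \<Lambda> \<Otimes>\<^sub>M \<Theta>"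
    unfolding split_beta' by measurable
  have ph': "?\<phi> \<in> ?J \<rightarrow>\<^sub>M \<Lambda> \<Otimes>\<^sub>M \<Theta>" using ph measurable_cong_sets[OF setsJ refl] by blast
  have XZ: "distr M (\<Lambda> \<Otimes>\<^sub>M \<Theta>) (\<lambda>\<omega>. (X \<omega>, Z \<omega>)) =
      density (\<Lambda> \<Otimes>\<^sub>M \<Theta>) (\<lambda>(x, z). ennreal (c * w x z))"
    unfolding joint_density[symmetric] law'[symmetric]
    by (subst distr_distr[OF ph' Jm]) (simp add: comp_def X_eq)
  have XZm[measurable]: "(\<lambda>\<omega>. (X \<omega>, Z \<omega>)) \<in> M \<rightarrow>\<^sub>M \<Lambda> \<Otimes>\<^sub>M \<Theta>" by measurable

  have gm: "integrable \<Gamma> (\<lambda>x. x i)"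
  proof -
    let ?G = "density lborel (\<lambda>x. ennreal (std_normal_density x))"
    have "integrable ?G (\<lambda>x. x)"
      using integrable_std_normal_moment[of 1] by (subst integrable_density) auto
    moreover have "distr \<Gamma> ?G (\<lambda>x. x i) = ?G"
      unfolding std_gaussian_def using i
      by (intro distr_PiM_component prob_space_normal_density) auto
    ultimately have "integrable (distr \<Gamma> ?G (\<lambda>x. x i)) (\<lambda>x. x)" by simp
    then show ?thesis
      by (rule integrable_distr[rotated]) (use i in \<open>auto simp: std_gaussian_def\<close>)
  qed
  have fst_law: "distr M \<Gamma> X\<^sub>0 = \<Gamma>"
  proof -
    have "distr (\<Theta> \<Otimes>\<^sub>M \<Gamma>) \<Theta> fst = \<Theta>" by (rule \<Gamma>.distr_pair_fst)
    moreover have "distr \<Theta> \<Gamma> fst = \<Gamma>"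
      unfolding coupling_def by (rule p.distr_pair_fst)
    moreover have "distr (distr (distr M ?J (\<lambda>\<omega>. (Z \<omega>, \<xi> \<omega>))) \<Theta> fst) \<Gamma> fst = distr M \<Gamma> X\<^sub>0"
    proof -
      have a: "fst \<in> ?J \<rightarrow>\<^sub>M \<Theta>" using measurable_fst measurable_cong_sets[OF refl sets_\<Theta>] by blast
      have b: "fst \<in> \<Theta> \<rightarrow>\<^sub>M \<Gamma>" unfolding coupling_def by measurable
      show ?thesis
        by (subst distr_distr[OF b], simp add: a)
           (subst distr_distr[OF measurable_comp[OF a b] Jm], simp add: comp_def Z_def)
    qed
    ultimately show ?thesis unfolding law' by simp
  qed
  have snd_law: "distr M \<Gamma> \<xi> = \<Gamma>"
  proof -
    have "distr (\<Theta> \<Otimes>\<^sub>M \<Gamma>) \<Gamma> snd = \<Gamma>"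
    proof (rule measure_eqI)
      fix A assume "A \<in> sets (distr (\<Theta> \<Otimes>\<^sub>M \<Gamma>) \<Gamma> snd)"
      then have A: "A \<in> sets \<Gamma>" by simp
      have "snd -` A \<inter> space (\<Theta> \<Otimes>\<^sub>M \<Gamma>) = space \<Theta> \<times> A"
        using sets.sets_into_space[OF A] by (auto simp: space_pair_measure)
      then show "emeasure (distr (\<Theta> \<Otimes>\<^sub>M \<Gamma>) \<Gamma> snd) A = emeasure \<Gamma> A"
        using emeasure_distr[OF measurable_snd A, of \<Theta>]
          \<Gamma>.emeasure_pair_measure_Times[OF sets.top A, of \<Theta>]
        by (simp add: \<Theta>.emeasure_space_1)
    qed simp
    moreover have "distr (distr M ?J (\<lambda>\<omega>. (Z \<omega>, \<xi> \<omega>))) \<Gamma> snd = distr M \<Gamma> \<xi>"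
    proof -
      have a: "snd \<in> ?J \<rightarrow>\<^sub>M \<Gamma>" using measurable_snd measurable_cong_sets[OF refl sets_std_gaussian] by blast
      show ?thesis by (subst distr_distr[OF a Jm]) (simp add: comp_def)
    qed
    ultimately show ?thesis unfolding law' by simp
  qed
  have \<Gamma>m: "U \<in> M \<rightarrow>\<^sub>M \<Gamma>" if "U \<in> M \<rightarrow>\<^sub>M \<Lambda>" for U :: "'w \<Rightarrow> nat \<Rightarrow> real"
    using that measurable_cong_sets[OF refl sets_std_gaussian] by blast
  have intX0: "integrable M (\<lambda>\<omega>. X\<^sub>0 \<omega> i)"
    by (rule integrable_distr[OF \<Gamma>m[OF rv(1)]]) (simp add: fst_law gm)
  have int\<xi>: "integrable M (\<lambda>\<omega>. \<xi> \<omega> i)"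
    by (rule integrable_distr[OF \<Gamma>m[OF rv(3)]]) (simp add: snd_law gm)
  have Gint: "integrable M G"
    unfolding G_def using intX0 int\<xi> Y by auto
  have GH: "G \<omega> = H (X \<omega>) (Z \<omega>)" for \<omega>
    unfolding G_def H_def X_eq using s i
    by (simp add: lincomb_def Z_def interpolant_deriv_def field_simps)
  have compm: "(\<lambda>\<omega>. F \<omega> i) \<in> borel_measurable N" if "F \<in> N \<rightarrow>\<^sub>M \<Lambda>" for F and N :: "'z measure"
    using component_meas[OF that i] .
  have Hm[measurable]: "(\<lambda>(x, z). H x z) \<in> borel_measurable (\<Lambda> \<Otimes>\<^sub>M \<Theta>)"
  proof -
    have 1: "(\<lambda>q. fst q) \<in> \<Lambda> \<Otimes>\<^sub>M \<Theta> \<rightarrow>\<^sub>M \<Lambda>" by simp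
    have 2: "(\<lambda>q. m (snd q)) \<in> \<Lambda> \<Otimes>\<^sub>M \<Theta> \<rightarrow>\<^sub>M \<Lambda>" by measurable
    have "(\<lambda>z. lincomb d (tderiv g t) (fst z) (tderiv f t) (snd z)) \<in> \<Lambda> \<Otimes>\<^sub>M \<Lambda> \<rightarrow>\<^sub>M \<Lambda>" by measurable
    then have "interpolant_deriv d f g t \<in> \<Theta> \<rightarrow>\<^sub>M \<Lambda>"
      unfolding interpolant_deriv_def[abs_def] using measurable_cong_sets[OF sets_\<Theta> refl] by blast
    then have 3: "(\<lambda>q. interpolant_deriv d f g t (snd q)) \<in> \<Lambda> \<Otimes>\<^sub>M \<Theta> \<rightarrow>\<^sub>M \<Lambda>" by measurable
    note [measurable] = component_meas[OF 1 i] component_meas[OF 2 i] component_meas[OF 3 i]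
    show ?thesis unfolding H_def split_beta' by measurable
  qed
  have cw0: "0 \<le> c * w x z" for x z using c_pos w_bounds(1)[of x z] by simp
  have cwm[measurable]: "(\<lambda>(x, z). c * w x z) \<in> borel_measurable (\<Lambda> \<Otimes>\<^sub>M \<Theta>)"
    unfolding split_beta' using w_meas[unfolded split_beta'] by measurable
  have cwH: "integrable (\<Lambda> \<Otimes>\<^sub>M \<Theta>) (\<lambda>(x, z). c * w x z * H x z)"
  proof -
    have "integrable (distr M (\<Lambda> \<Otimes>\<^sub>M \<Theta>) (\<lambda>\<omega>. (X \<omega>, Z \<omega>))) (\<lambda>(x, z). H x z)"
      by (subst integrable_distr_eq[OF XZm Hm]) (use Gint in \<open>simp add: GH[symmetric]\<close>)
    then have "integrable (density (\<Lambda> \<Otimes>\<^sub>M \<Theta>) (\<lambda>q. ennreal ((\<lambda>(x, z). c * w x z) q))) (\<lambda>(x, z). H x z)"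
      unfolding XZ by (simp add: split_beta')
    then show ?thesis
      by (subst (asm) integrable_density[OF Hm cwm]) (auto simp: cw0 split_beta')
  qed
  have wxm: "w x \<in> borel_measurable \<Theta>" "(\<lambda>z. H x z) \<in> borel_measurable \<Theta>" if "x \<in> Rd d" for x
  proof -
    have "(\<lambda>z. (x, z)) \<in> \<Theta> \<rightarrow>\<^sub>M \<Lambda> \<Otimes>\<^sub>M \<Theta>" using that by (intro measurable_Pair1') simp
    from measurable_compose[OF this w_meas] measurable_compose[OF this Hm]
    show "w x \<in> borel_measurable \<Theta>" "(\<lambda>z. H x z) \<in> borel_measurable \<Theta>" by simp_all
  qed
  have v_eq: "c * W x * ?v x = (LINT z|\<Theta>. c * w x z * H x z)" if x: "x \<in> Rd d" for x
  proof -
    have "?v x = (LINT z|density \<Theta> (\<lambda>z. ennreal (w x z / W x)). H x z)"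
      unfolding velocity_def posterior_def H_def W_def using i by simp
    also have "\<dots> = (LINT z|\<Theta>. (w x z / W x) *\<^sub>R H x z)"
      using wxm[OF x] W_pos[OF x] w_bounds(1)
      by (intro integral_density) (auto intro!: divide_nonneg_pos simp: less_imp_le)
    finally have 1: "?v x = (LINT z|\<Theta>. (w x z / W x) *\<^sub>R H x z)" .
    have "c * W x * ?v x = (LINT z|\<Theta>. c * W x * ((w x z / W x) *\<^sub>R H x z))" unfolding 1 by simp
    also have "\<dots> = (LINT z|\<Theta>. c * w x z * H x z)"
    proof (rule Bochner_Integration.integral_cong[OF refl])
      have "W x \<noteq> 0" using W_pos[OF x] by simp
      then show "c * W x * ((w x z / W x) *\<^sub>R H x z) = c * w x z * H x z" for z
        by (simp add: field_simps)
    qed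
    finally show ?thesis .
  qed
  have Wm[measurable]: "W \<in> borel_measurable \<Lambda>"
    unfolding W_def[abs_def] by (rule \<Theta>.borel_measurable_lebesgue_integral[OF w_meas])
  have vm[measurable]: "?v \<in> borel_measurable \<Lambda>"
  proof -
    have "(\<lambda>x. (LINT z|\<Theta>. c * w x z * H x z) / (c * W x)) \<in> borel_measurable \<Lambda>"
      using cwH by (intro borel_measurable_divide \<Theta>.borel_measurable_lebesgue_integral) auto
    moreover have "(LINT z|\<Theta>. c * w x z * H x z) / (c * W x) = ?v x" if "x \<in> space \<Lambda>" for x
      using v_eq[of x] W_pos[of x] c_pos that by (simp add: field_simps)
    ultimately show ?thesis by (rule measurable_cong[THEN iffD1, rotated])
  qed
  have Xlaw: "distr M \<Lambda> X = density \<Lambda> (\<lambda>x. ennreal (c * W x))"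
  proof -
    have "distr M \<Lambda> X = distr (density (\<Lambda> \<Otimes>\<^sub>M \<Theta>) (\<lambda>(x, z). ennreal (c * w x z))) \<Lambda> fst"
      unfolding XZ[symmetric] by (subst distr_distr) (auto simp: comp_def)
    also have "\<dots> = density \<Lambda> (\<lambda>x. ennreal (c * W x))" (is "?A = ?B")
    proof (rule measure_eqI)
      fix A assume "A \<in> sets ?A"
      then have A[measurable]: "A \<in> sets \<Lambda>" by simp
      have "emeasure ?A A = (\<integral>\<^sup>+ q. (case q of (x, z) \<Rightarrow> ennreal (c * w x z)) *
          indicator (fst -` A \<inter> space (\<Lambda> \<Otimes>\<^sub>M \<Theta>)) q \<partial>(\<Lambda> \<Otimes>\<^sub>M \<Theta>))"
      proof -
        have fA: "fst -` A \<inter> space (\<Lambda> \<Otimes>\<^sub>M \<Theta>) \<in> sets (\<Lambda> \<Otimes>\<^sub>M \<Theta>)"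
          by (rule measurable_sets[OF measurable_fst A])
        have "emeasure ?A A = emeasure (density (\<Lambda> \<Otimes>\<^sub>M \<Theta>) (\<lambda>(x, z). ennreal (c * w x z)))
            (fst -` A \<inter> space (\<Lambda> \<Otimes>\<^sub>M \<Theta>))"
          by (subst emeasure_distr[OF _ A]) auto
        also have "\<dots> = (\<integral>\<^sup>+ q. (case q of (x, z) \<Rightarrow> ennreal (c * w x z)) *
            indicator (fst -` A \<inter> space (\<Lambda> \<Otimes>\<^sub>M \<Theta>)) q \<partial>(\<Lambda> \<Otimes>\<^sub>M \<Theta>))"
          by (intro emeasure_density fA) measurable
        finally show ?thesis .
      qed
      also have "\<dots> = (\<integral>\<^sup>+ q. (case q of (x, z) \<Rightarrow> ennreal (c * w x z) * indicator A x) \<partial>(\<Lambda> \<Otimes>\<^sub>M \<Theta>))"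
        by (intro nn_integral_cong) (auto simp: indicator_def)
      also have "\<dots> = (\<integral>\<^sup>+ x. \<integral>\<^sup>+ z. ennreal (c * w x z) * indicator A x \<partial>\<Theta> \<partial>\<Lambda>)"
        by (subst \<Theta>.nn_integral_fst[symmetric]) (auto simp: split_beta')
      also have "\<dots> = (\<integral>\<^sup>+ x. ennreal (c * W x) * indicator A x \<partial>\<Lambda>)"
      proof (rule nn_integral_cong)
        fix x assume "x \<in> space \<Lambda>"
        then have x: "x \<in> Rd d" by simp
        have "(\<integral>\<^sup>+ z. ennreal (c * w x z) * indicator A x \<partial>\<Theta>) = (\<integral>\<^sup>+ z. ennreal (c * w x z) \<partial>\<Theta>) * indicator A x"
          using wxm(1)[OF x] by (intro nn_integral_multc) auto
        also have "(\<integral>\<^sup>+ z. ennreal (c * w x z) \<partial>\<Theta>) = ennreal (LINT z|\<Theta>. c * w x z)"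
          using w_int[OF x] by (intro nn_integral_eq_integral) (auto simp: cw0)
        finally show "(\<integral>\<^sup>+ z. ennreal (c * w x z) * indicator A x \<partial>\<Theta>) = ennreal (c * W x) * indicator A x"
          by (simp add: W_def)
      qed
      also have "\<dots> = emeasure ?B A" by (intro emeasure_density[symmetric] A) measurable
      finally show "emeasure ?A A = emeasure ?B A" .
    qed simp
    finally show ?thesis .
  qed
  have cW0: "AE x in \<Lambda>. 0 \<le> c * W x"
    using AE_space by eventually_elim (use W_pos c_pos in \<open>auto simp: less_imp_le\<close>)
  have vint: "integrable M (\<lambda>\<omega>. ?v (X \<omega>))"
  proof -
    have "integrable \<Lambda> (\<lambda>x. LINT z|\<Theta>. c * w x z * H x z)"
      using P.integrable_fst'[OF cwH] by simp
    then have "integrable \<Lambda> (\<lambda>x. c * W x * ?v x)"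
      by (subst Bochner_Integration.integrable_cong[OF refl v_eq]) auto
    then have "integrable (distr M \<Lambda> X) ?v"
      unfolding Xlaw by (subst integrable_density) (use cW0 in auto)
    then show ?thesis by (rule integrable_distr[OF Xm])
  qed
  interpret fs: finite_measure_subalgebra M ?F
  proof
    show "subalgebra M ?F"
      unfolding subalgebra_def using sets_vimage_algebra2[OF Xsp] measurable_sets[OF Xm] by auto
  qed
  show ?thesis
    unfolding G_def[symmetric]
  proof (rule fs.real_cond_exp_charact[OF _ Gint vint])
    show "(\<lambda>\<omega>. ?v (X \<omega>)) \<in> borel_measurable ?F"
      by (rule measurable_compose[OF measurable_vimage_algebra1[OF Xsp] vm])
    fix A assume "A \<in> sets ?F"
    then obtain B where B[measurable]: "B \<in> sets \<Lambda>" and A: "A = X -` B \<inter> space M"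
      unfolding sets_vimage_algebra2[OF Xsp] by auto
    have HB[measurable]: "(\<lambda>(x, z). indicator B x * H x z) \<in> borel_measurable (\<Lambda> \<Otimes>\<^sub>M \<Theta>)"
      unfolding split_beta' using Hm[unfolded split_beta'] by measurable
    have vB: "(\<lambda>x. indicator B x * ?v x) \<in> borel_measurable \<Lambda>" by measurable
    have int: "integrable (\<Lambda> \<Otimes>\<^sub>M \<Theta>) (\<lambda>q. indicator (B \<times> space \<Theta>) q *\<^sub>R (case q of (x, z) \<Rightarrow> c * w x z * H x z))"
      by (intro integrable_mult_indicator cwH pair_measureI B sets.top)
    have "(\<integral>\<omega>\<in>A. G \<omega> \<partial>M) = (LINT \<omega>|M. (\<lambda>(x, z). indicator B x * H x z) (X \<omega>, Z \<omega>))"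
      unfolding set_lebesgue_integral_def A
      by (intro Bochner_Integration.integral_cong) (auto simp: indicator_def GH)
    also have "\<dots> = (LINT q|distr M (\<Lambda> \<Otimes>\<^sub>M \<Theta>) (\<lambda>\<omega>. (X \<omega>, Z \<omega>)). (\<lambda>(x, z). indicator B x * H x z) q)"
      by (rule integral_distr[OF XZm HB, symmetric])
    also have "\<dots> = (LINT q|density (\<Lambda> \<Otimes>\<^sub>M \<Theta>) (\<lambda>q. ennreal ((\<lambda>(x, z). c * w x z) q)). (\<lambda>(x, z). indicator B x * H x z) q)"
      unfolding XZ by (simp add: split_beta')
    also have "\<dots> = (LINT q|(\<Lambda> \<Otimes>\<^sub>M \<Theta>). (\<lambda>(x, z). c * w x z) q *\<^sub>R (\<lambda>(x, z). indicator B x * H x z) q)"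
      by (intro integral_density HB cwm) (auto simp: cw0)
    also have "\<dots> = (LINT q|(\<Lambda> \<Otimes>\<^sub>M \<Theta>). indicator (B \<times> space \<Theta>) q *\<^sub>R (case q of (x, z) \<Rightarrow> c * w x z * H x z))"
      by (intro Bochner_Integration.integral_cong) (auto simp: indicator_def space_pair_measure)
    also have "\<dots> = (LINT x|\<Lambda>. LINT z|\<Theta>. indicator (B \<times> space \<Theta>) (x, z) *\<^sub>R (c * w x z * H x z))"
      using P.integral_fst'[OF int] by simp
    also have "\<dots> = (LINT x|\<Lambda>. (c * W x) *\<^sub>R (indicator B x * ?v x))"
    proof (rule Bochner_Integration.integral_cong[OF refl])
      fix x assume "x \<in> space \<Lambda>"
      then have x: "x \<in> Rd d" by simp
      have "(LINT z|\<Theta>. indicator (B \<times> space \<Theta>) (x, z) *\<^sub>R (c * w x z * H x z)) =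
        (LINT z|\<Theta>. indicator B x * (c * w x z * H x z))"
        by (intro Bochner_Integration.integral_cong) (auto simp: indicator_def)
      also have "\<dots> = indicator B x * (c * W x * ?v x)" by (simp add: v_eq[OF x])
      finally show "(LINT z|\<Theta>. indicator (B \<times> space \<Theta>) (x, z) *\<^sub>R (c * w x z * H x z)) =
        (c * W x) *\<^sub>R (indicator B x * ?v x)" by simp
    qed
    also have "\<dots> = (LINT x|density \<Lambda> (\<lambda>x. ennreal (c * W x)). indicator B x * ?v x)"
      by (rule integral_density[symmetric]) (use vB cW0 in auto)
    also have "\<dots> = (LINT \<omega>|M. indicator B (X \<omega>) * ?v (X \<omega>))"
      unfolding Xlaw[symmetric] by (rule integral_distr[OF Xm vB])
    also have "\<dots> = (\<integral>\<omega>\<in>A. ?v (X \<omega>) \<partial>M)"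
      unfolding set_lebesgue_integral_def A
      by (intro Bochner_Integration.integral_cong) (auto simp: indicator_def)
    finally show "(\<integral>\<omega>\<in>A. G \<omega> \<partial>M) = (\<integral>\<omega>\<in>A. ?v (X \<omega>) \<partial>M)" .
  qed
qed

end


section \<open>The integrated one-sided Lipschitz constant\<close>

definition jacobian_mat ::
  "nat \<Rightarrow> ((nat \<Rightarrow> real) \<Rightarrow> (nat \<Rightarrow> real)) \<Rightarrow> (nat \<Rightarrow> real) \<Rightarrow> real mat" where
  "jacobian_mat d v x = Matrix.mat d d (\<lambda>(i, j). partial j (\<lambda>y. v y i) x)"

definition lambda_max :: "real mat \<Rightarrow> real" where
  "lambda_max A = Max {k. eigenvalue ((1/2) \<cdot>\<^sub>m (A + transpose_mat A)) k}"

text \<open>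
  Lebesgue integral of an extended-real function as positive part minus negative part, so a
  value \<open>-\<infinity>\<close> is possible. Since \<open>\<infinity> - \<infinity> = \<infinity>\<close> in \<^typ>\<open>ereal\<close>, a finite upper bound forces the positive
  part to have a finite integral.
\<close>

definition ereal_integral :: "'a measure \<Rightarrow> ('a \<Rightarrow> ereal) \<Rightarrow> ereal" where
  "ereal_integral M h =
     enn2ereal (\<integral>\<^sup>+ x. e2ennreal (h x) \<partial>M) - enn2ereal (\<integral>\<^sup>+ x. e2ennreal (- h x) \<partial>M)"

end

theory Submission
  imports Defs "Jordan_Normal_Form.Spectral_Radius"
begin

text \<open>
  Write \<open>s\<^sup>2 = g\<^sup>2 + \<sigma>\<^sup>2\<close>. Integrating out the Gaussian variables gives
  \<open>v\<^sub>t(x) = A x + (f' - f A) E[Y | X\<^sub>t = x]\<close> with \<open>A = s'/s\<close>, hence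
  \<open>\<nabla>v\<^sub>t = A Id + (f' - f A) f/s\<^sup>2 Cov(Y | X\<^sub>t = x)\<close>. The posterior of \<open>Y\<close> is a Hoelder perturbation of a density
  that is strongly log-concave with constant \<open>\<kappa> = \<alpha> + f\<^sup>2/s\<^sup>2\<close>. Tilting it by \<open>exp(\<plusminus> h \<langle>w, y\<rangle>)\<close> and applying
  the Prekopa-Leindler inequality at the midpoint bounds the product of the two tilted masses, and
  therefore \<open>Var \<langle>w, Y\<rangle> \<le> (1 + C \<kappa> powr (-\<beta>/4)) / \<kappa>\<close>, independently of the dimension.

  Inserting this bound where \<open>f' - f A \<ge> 0\<close> (elsewhere \<open>\<lambda>\<^sub>m\<^sub>a\<^sub>x \<le> A\<close>), the main terms combine to
  \<open>(\<alpha> s s' + f f') / (\<alpha> s\<^sup>2 + f\<^sup>2)\<close>. Everything is dominated by derivatives of the bounded monotone functions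
  \<open>f\<close>, \<open>-g\<close>, \<open>\<sigma>\<close> before time \<open>\<delta>\<close>, and \<open>- s powr (\<beta>/2)\<close> after time \<open>\<delta>\<close>.
\<close>

section \<open>The Prekopa-Leindler inequality\<close>

text \<open>The leading constant 1 in the variance bound decides whether the time integral stays
  bounded. As s tends to 0 near time 1, the Jacobian contains A = s'/s and a covariance term of the
  same size with the opposite sign, and neither is integrable. They cancel because the main part of
  the variance bound is exactly 1/\<kappa>; a bound c/\<kappa> with c > 1 would leave a multiple of
  |s'|/s. The correction gains \<kappa> powr (-\<beta>/4), of order s powr (\<beta>/2) there, and s
  powr (\<beta>/2 - 1) |s'| is integrable. The constant 1 can be reached because the posterior lives
  on the length scale \<kappa> powr (-1/2), over which \<open>a\<close> varies by about K \<kappa>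
  powr (-\<beta>/2) only. As \<open>a\<close> is merely Hoelder, the full log-density has no
  Hessian; curvature enters through comparisons at midpoints, the form that Prekopa-Leindler accepts
  without a dimensional constant. In time, signs of derivatives are known only off null sets, so the
  integrand is dominated by derivatives of monotone functions, whose integrals are at most their
  increments.\<close>

text \<open>Shift \<open>A\<close> by the least point of \<open>B\<close>, and \<open>B\<close> by
  the greatest point of \<open>A\<close>. Both shifts lie in the set of sums, hence in
  \<open>C\<close> doubled, and they meet in at most one point, so their measures add up.\<close>

lemma brunn_minkowski_compact:
  fixes A B :: "real set"
  assumes "compact A" "compact B" "A \<noteq> {}" "B \<noteq> {}" "C \<in> sets borel"
    and mid: "\<And>a b. a \<in> A \<Longrightarrow> b \<in> B \<Longrightarrow> (a + b) / 2 \<in> C"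
  shows "emeasure lborel A + emeasure lborel B \<le> 2 * emeasure lborel C"
proof -
  obtain a where a: "a \<in> A" "\<And>x. x \<in> A \<Longrightarrow> x \<le> a"
    using compact_attains_sup[OF assms(1,3)] by blast
  obtain b where b: "b \<in> B" "\<And>x. x \<in> B \<Longrightarrow> b \<le> x"
    using compact_attains_inf[OF assms(2,4)] by blast
  define A' where "A' = (\<lambda>x. x + b) ` A"
  define B' where "B' = (\<lambda>x. x + a) ` B"
  define C' where "C' = (\<lambda>x. x / 2) -` C"
  have tr: "emeasure lborel ((\<lambda>x. x + c) ` S) = emeasure lborel S" if "compact S" for S :: "real set" and c
  proof -
    have "emeasure lborel ((\<lambda>x. x + c) ` S) = emeasure lebesgue ((\<lambda>x. x + c) ` S)"
      using that by (simp add: borel_compact compact_continuous_image continuous_intros)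
    also have "\<dots> = emeasure lebesgue S"
      using emeasure_lebesgue_affine[of 1 c S] by (simp add: image_def)
    finally show ?thesis using that by (simp add: borel_compact)
  qed
  have cA: "compact A'" "compact B'" unfolding A'_def B'_def
    using assms by (auto intro!: compact_continuous_image continuous_intros)
  have C'm: "C' \<in> sets borel" unfolding C'_def
    by (rule measurable_sets_borel[OF _ assms(5)]) simp
  have sub: "A' \<union> B' \<subseteq> C'"
    unfolding A'_def B'_def C'_def using mid[OF _ b(1)] mid[OF a(1)] by (auto simp: add.commute)
  have null: "A' \<inter> B' \<subseteq> {a + b}"
    unfolding A'_def B'_def using a(2) b(2) by (fastforce simp: add.commute intro: antisym)
  have n0: "emeasure lborel (A' \<inter> B') = 0"
    using emeasure_mono[OF null, of lborel] by simp
  have "emeasure lborel A + emeasure lborel B = emeasure lborel A' + emeasure lborel B'"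
    unfolding A'_def B'_def using tr assms by simp
  also have "\<dots> = emeasure lborel (A' \<union> B')"
    using emeasure_Un_Int[of A' lborel B'] cA n0 by (simp add: borel_compact)
  also have "\<dots> \<le> emeasure lborel C'" using sub C'm by (intro emeasure_mono) auto
  also have im: "C' = (\<lambda>x. 2 *\<^sub>R x + 0) ` C" unfolding C'_def by (auto simp: image_iff intro!: bexI[of _ "_ / 2"])
  also have "emeasure lborel \<dots> = emeasure lebesgue \<dots>"
    using C'm im by simp
  also have "\<dots> = 2 * emeasure lborel C"
    using emeasure_lebesgue_affine[of 2 0 C] assms(5) by simp
  finally show ?thesis .
qed

text \<open>Inner regularity by closed sets, followed by intersection with growing balls. The strict
  bound \<open>c\<close> leaves a slack \<open>e\<close> that the closed set may lose, which also
  covers sets of infinite measure.\<close>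

lemma compact_approx:
  fixes A :: "real set"
  assumes "A \<in> sets borel" "c < emeasure lborel A"
  obtains S where "compact S" "S \<subseteq> A" "c < emeasure lborel S"
proof -
  have "\<exists>e>0. c + ennreal e < emeasure lborel A"
  proof -
    obtain c' where c': "c < c'" "c' < emeasure lborel A" using dense[OF assms(2)] by blast
    obtain r' where r': "c' = ennreal r'" "0 \<le> r'" using c'(2) by (cases c') auto
    obtain r where r: "c = ennreal r" "0 \<le> r" using c'(1) r' by (cases c) auto
    have "r < r'" using c'(1) r r' by (simp add: ennreal_less_iff)
    then show ?thesis using c'(2) r r' by (intro exI[of _ "r' - r"]) (simp add: ennreal_plus[symmetric])
  qed
  then obtain e where e: "e > 0" "c + ennreal e < emeasure lborel A" by blast
  obtain T where T: "closed T" "T \<subseteq> A" "A - T \<in> lmeasurable" "emeasure lebesgue (A - T) < ennreal e"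
    using sets_lebesgue_inner_closed[of A e] assms(1) e(1) by auto
  have "emeasure lborel A \<le> emeasure lborel T + emeasure lborel (A - T)"
    using T assms(1) by (subst plus_emeasure) (auto intro!: emeasure_mono)
  also have "\<dots> \<le> emeasure lborel T + ennreal e"
    using T assms(1) by (intro add_mono) (auto simp: less_imp_le)
  finally have cT: "c < emeasure lborel T"
    using e(2) by (metis add.commute ennreal_add_left_cancel_less leD less_le_trans linorder_not_le add_right_mono)
  have "emeasure lborel T = (SUP n. emeasure lborel (T \<inter> cball 0 (real n)))"
  proof (subst SUP_emeasure_incseq)
    show "incseq (\<lambda>n. T \<inter> cball 0 (real n))" by (auto simp: incseq_def)
    have "(\<Union>n. T \<inter> cball 0 (real n)) = T"
      by (auto simp: real_arch_simple)
    then show "emeasure lborel T = emeasure lborel (\<Union>n. T \<inter> cball 0 (real n))" by simp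
  qed (use T in auto)
  then obtain n where "c < emeasure lborel (T \<inter> cball 0 (real n))"
    using cT by (auto simp: less_SUP_iff)
  moreover have "compact (T \<inter> cball 0 (real n))" using T(1) by (intro closed_Int_compact) auto
  ultimately show ?thesis using T(2) that[of "T \<inter> cball 0 (real n)"] by blast
qed

lemma brunn_minkowski_real:
  fixes A B :: "real set"
  assumes "A \<in> sets borel" "B \<in> sets borel" "A \<noteq> {}" "B \<noteq> {}" "C \<in> sets borel"
    and mid: "\<And>a b. a \<in> A \<Longrightarrow> b \<in> B \<Longrightarrow> (a + b) / 2 \<in> C"
  shows "emeasure lborel A + emeasure lborel B \<le> 2 * emeasure lborel C"
proof -
  \<comment> \<open>The alternative \<open>c = 0\<close> is for null sets: the compact version wants
    nonempty sets, and then a single point of \<open>A\<close> serves.\<close>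
  have approx: "\<exists>S. compact S \<and> S \<subseteq> A \<and> S \<noteq> {} \<and> c \<le> emeasure lborel S"
    if A: "A \<in> sets borel" "A \<noteq> {}" "c < emeasure lborel A \<or> c = 0" for A :: "real set" and c :: ennreal
  proof (cases "c < emeasure lborel A")
    case True
    then obtain S where "compact S" "S \<subseteq> A" "c < emeasure lborel S" using compact_approx[OF A(1)] by blast
    then show ?thesis by (intro exI[of _ S]) auto
  next
    case False
    obtain x where "x \<in> A" using A(2) by auto
    then show ?thesis using False A(3) by (intro exI[of _ "{x}"]) auto
  qed
  have key: "c + c' \<le> 2 * emeasure lborel C"
    if c: "c < emeasure lborel A \<or> c = 0" "c' < emeasure lborel B \<or> c' = 0" for c c'
  proof -
    obtain S where S: "compact S" "S \<subseteq> A" "S \<noteq> {}" "c \<le> emeasure lborel S"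
      using approx[OF assms(1,3) c(1)] by auto
    obtain S' where S': "compact S'" "S' \<subseteq> B" "S' \<noteq> {}" "c' \<le> emeasure lborel S'"
      using approx[OF assms(2,4) c(2)] by auto
    have "emeasure lborel S + emeasure lborel S' \<le> 2 * emeasure lborel C"
      using S S' assms(5) mid by (intro brunn_minkowski_compact) auto
    then show ?thesis using add_mono[OF S(4) S'(4)] by simp
  qed
  \<comment> \<open>Passage to the supremum in one summand. Adding \<open>c = 0\<close> keeps the
    index set nonempty when \<open>X = 0\<close>, so that the supremum commutes with the
    addition.\<close>
  have add_le: "X + Y \<le> Z" if "\<And>c. c < X \<or> c = 0 \<Longrightarrow> c + Y \<le> Z" for X Y Z :: ennreal
  proof -
    have "X \<le> (SUP c\<in>{c. c < X \<or> c = 0}. c)"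
    proof (rule dense_le)
      fix x assume "x < X"
      then show "x \<le> (SUP c\<in>{c. c < X \<or> c = 0}. c)" by (intro SUP_upper2[of x]) auto
    qed
    then have "X + Y \<le> (SUP c\<in>{c. c < X \<or> c = 0}. c) + Y" by (rule add_right_mono)
    also have "\<dots> = (SUP c\<in>{c. c < X \<or> c = 0}. c + Y)" by (intro ennreal_SUP_add_left[symmetric]) auto
    also have "\<dots> \<le> Z" using that by (intro SUP_least) simp
    finally show ?thesis .
  qed
  have 1: "emeasure lborel B + c \<le> 2 * emeasure lborel C" if "c < emeasure lborel A \<or> c = 0" for c
    by (rule add_le) (use key[OF that] in \<open>simp add: add.commute\<close>)
  show ?thesis
    by (rule add_le) (use 1 in \<open>simp add: add.commute\<close>)
qed

text \<open>Only levels below 1 are used, because \<open>F\<close> and \<open>G\<close> will be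
  scaled to supremum 1. The first part, an inequality, serves for \<open>H\<close>, which may exceed
  1.\<close>

lemma layer_cake_unit:
  fixes F :: "real \<Rightarrow> ennreal"
  assumes [measurable]: "F \<in> borel_measurable borel"
  shows "(\<integral>\<^sup>+ t. indicator {0<..<1} t * emeasure lborel {x. ennreal t < F x} \<partial>lborel)
    \<le> (\<integral>\<^sup>+ x. F x \<partial>lborel)"
    "(\<And>x. F x \<le> 1) \<Longrightarrow> (\<integral>\<^sup>+ t. indicator {0<..<1} t * emeasure lborel {x. ennreal t < F x} \<partial>lborel)
    = (\<integral>\<^sup>+ x. F x \<partial>lborel)"
proof -
  have "(\<integral>\<^sup>+ t. indicator {0<..<1} t * emeasure lborel {x. ennreal t < F x} \<partial>lborel)
    = (\<integral>\<^sup>+ t. \<integral>\<^sup>+ x. indicator {0<..<1} t * indicator {x. ennreal t < F x} x \<partial>lborel \<partial>lborel)"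
    by (intro nn_integral_cong) (subst nn_integral_cmult, auto)
  also have "\<dots> = (\<integral>\<^sup>+ x. \<integral>\<^sup>+ t. indicator {0<..<1} t * indicator {x. ennreal t < F x} x \<partial>lborel \<partial>lborel)"
    by (rule lborel_pair.Fubini') (simp add: indicator_def split_beta')
  also have "\<dots> = (\<integral>\<^sup>+ x. emeasure lborel {t. 0 < t \<and> t < 1 \<and> ennreal t < F x} \<partial>lborel)"
    by (intro nn_integral_cong trans[OF _ nn_integral_indicator]) (auto simp: indicator_def)
  finally have eq: "(\<integral>\<^sup>+ t. indicator {0<..<1} t * emeasure lborel {x. ennreal t < F x} \<partial>lborel)
    = (\<integral>\<^sup>+ x. emeasure lborel {t. 0 < t \<and> t < 1 \<and> ennreal t < F x} \<partial>lborel)" .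
  have ge1: "emeasure lborel {t. 0 < t \<and> t < 1 \<and> ennreal t < F x} = 1" if "F x \<ge> 1" for x
  proof -
    have "{t. 0 < t \<and> t < 1 \<and> ennreal t < F x} = {0<..<1}"
      using that by (auto intro: less_le_trans[OF _ that])
    then show ?thesis by simp
  qed
  have le1: "emeasure lborel {t. 0 < t \<and> t < 1 \<and> ennreal t < F x} = F x" if "F x \<le> 1" for x
  proof -
    have "F x \<noteq> \<infinity>" using that by (auto simp: top_unique)
    then obtain r where r: "F x = ennreal r" "0 \<le> r" by (cases "F x") (auto simp: top_unique)
    then have "{t. 0 < t \<and> t < 1 \<and> ennreal t < F x} = {0<..<r}"
      using that by (auto simp: ennreal_less_iff)
    then show ?thesis using r by simp
  qed
  show "(\<integral>\<^sup>+ t. indicator {0<..<1} t * emeasure lborel {x. ennreal t < F x} \<partial>lborel)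
    \<le> (\<integral>\<^sup>+ x. F x \<partial>lborel)"
    unfolding eq
  proof (rule nn_integral_mono)
    show "emeasure lborel {t. 0 < t \<and> t < 1 \<and> ennreal t < F x} \<le> F x" for x
      using ge1[of x] le1[of x] by (cases "F x \<le> 1") auto
  qed
  show "(\<And>x. F x \<le> 1) \<Longrightarrow> (\<integral>\<^sup>+ t. indicator {0<..<1} t * emeasure lborel {x. ennreal t < F x} \<partial>lborel)
    = (\<integral>\<^sup>+ x. F x \<partial>lborel)"
    unfolding eq by (simp add: le1)
qed

text \<open>With both suprema equal to 1, the sets where \<open>F\<close> and \<open>G\<close>
  exceed a level t < 1 are nonempty, as Brunn-Minkowski demands. Their midpoints lie where
  \<open>H\<close> exceeds t, since there the square of \<open>H\<close> is above t^2. Integrating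
  over t gives the additive form.\<close>

lemma prekopa_leindler_normalized:
  fixes F G H :: "real \<Rightarrow> ennreal"
  assumes [measurable]: "F \<in> borel_measurable borel" "G \<in> borel_measurable borel" "H \<in> borel_measurable borel"
    and F1: "\<And>x. F x \<le> 1" "\<And>t. t < 1 \<Longrightarrow> \<exists>x. t < F x"
    and G1: "\<And>x. G x \<le> 1" "\<And>t. t < 1 \<Longrightarrow> \<exists>x. t < G x"
    and mid: "\<And>x y. F x * G y \<le> (H ((x + y) / 2))\<^sup>2"
  shows "(\<integral>\<^sup>+ x. F x \<partial>lborel) + (\<integral>\<^sup>+ x. G x \<partial>lborel) \<le> 2 * (\<integral>\<^sup>+ x. H x \<partial>lborel)"
proof -
  have lev: "emeasure lborel {x. ennreal t < F x} + emeasure lborel {x. ennreal t < G x}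
      \<le> 2 * emeasure lborel {x. ennreal t < H x}" if t: "0 < t" "t < 1" for t
  proof (rule brunn_minkowski_real)
    show "{x. ennreal t < F x} \<noteq> {}" "{x. ennreal t < G x} \<noteq> {}"
      using F1(2)[of "ennreal t"] G1(2)[of "ennreal t"] t by auto
    fix a b assume "a \<in> {x. ennreal t < F x}" "b \<in> {x. ennreal t < G x}"
    then have "ennreal t * ennreal t < ennreal t * G b" "ennreal t * G b \<le> F a * G b"
      using t by (auto intro!: ennreal_mult_strict_left_mono mult_right_mono)
    then have "(ennreal t)\<^sup>2 < (H ((a + b) / 2))\<^sup>2" using mid[of a b] by (auto simp: power2_eq_square intro: less_le_trans)
    then have "ennreal t < H ((a + b) / 2)" by (meson linorder_not_le power_mono zero_le)
    then show "(a + b) / 2 \<in> {x. ennreal t < H x}" by simp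
  qed auto
  have "(\<integral>\<^sup>+ x. F x \<partial>lborel) + (\<integral>\<^sup>+ x. G x \<partial>lborel) =
     (\<integral>\<^sup>+ t. indicator {0<..<1} t * (emeasure lborel {x. ennreal t < F x} + emeasure lborel {x. ennreal t < G x}) \<partial>lborel)"
    unfolding layer_cake_unit(2)[OF assms(1) F1(1), symmetric] layer_cake_unit(2)[OF assms(2) G1(1), symmetric]
    by (subst nn_integral_add[symmetric]) (auto simp: distrib_left)
  also have "\<dots> \<le> (\<integral>\<^sup>+ t. 2 * (indicator {0<..<1} t * emeasure lborel {x. ennreal t < H x}) \<partial>lborel)"
    by (intro nn_integral_mono) (auto simp: indicator_def lev)
  also have "\<dots> = 2 * (\<integral>\<^sup>+ t. indicator {0<..<1} t * emeasure lborel {x. ennreal t < H x} \<partial>lborel)"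
    by (intro nn_integral_cmult) measurable
  also have "\<dots> \<le> 2 * (\<integral>\<^sup>+ x. H x \<partial>lborel)"
    by (intro mult_left_mono layer_cake_unit(1)) auto
  finally show ?thesis .
qed

text \<open>The inequality of arithmetic and geometric means; it converts the additive form for
  normalized functions into the multiplicative one.\<close>

lemma ennreal_mult_le_power2:
  fixes a b h :: ennreal
  assumes "a + b \<le> 2 * h"
  shows "a * b \<le> h\<^sup>2"
proof (cases "h = \<infinity>")
  case False
  then obtain h' where h: "h = ennreal h'" "0 \<le> h'" by (cases h) auto
  have 2: "a + b \<le> ennreal (2 * h')" using assms h by (simp add: ennreal_mult)
  have "a \<le> ennreal (2 * h')" "b \<le> ennreal (2 * h')"
    using 2 by (auto intro: order_trans[OF _ 2])
  then obtain a' b' where ab: "a = ennreal a'" "0 \<le> a'" "b = ennreal b'" "0 \<le> b'"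
    by (cases a; cases b) (auto simp: top_unique)
  have "a' + b' \<le> 2 * h'" using 2 ab h by (simp add: ennreal_plus[symmetric] del: ennreal_plus)
  then have "(a' + b')\<^sup>2 \<le> (2 * h')\<^sup>2" using ab by (intro power_mono) auto
  then have "a' * b' \<le> h'\<^sup>2" using sum_squares_bound[of a' b'] by (simp add: power2_sum power_mult_distrib)
  then show ?thesis using ab h by (simp add: ennreal_mult[symmetric] ennreal_power)
qed simp

lemma prekopa_leindler_bounded:
  fixes F G H :: "real \<Rightarrow> ennreal"
  assumes [measurable]: "F \<in> borel_measurable borel" "G \<in> borel_measurable borel" "H \<in> borel_measurable borel"
    and bd: "\<And>x. F x \<le> ennreal B" "\<And>x. G x \<le> ennreal B"
    and mid: "\<And>x y. F x * G y \<le> (H ((x + y) / 2))\<^sup>2"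
  shows "(\<integral>\<^sup>+ x. F x \<partial>lborel) * (\<integral>\<^sup>+ x. G x \<partial>lborel) \<le> (\<integral>\<^sup>+ x. H x \<partial>lborel)\<^sup>2"
proof (cases "(\<forall>x. F x = 0) \<or> (\<forall>x. G x = 0)")
  case False
  have sup: "\<exists>m>0. (\<forall>x. F x \<le> ennreal m) \<and> (\<forall>c<ennreal m. \<exists>x. c < F x)"
    if b: "\<And>x. F x \<le> ennreal B" and n: "\<not> (\<forall>x. F x = 0)" for F :: "real \<Rightarrow> ennreal"
  proof -
    have "(SUP x. F x) \<le> ennreal B" using b by (auto intro: SUP_least)
    then obtain m where m: "(SUP x. F x) = ennreal m" "0 \<le> m" by (cases "SUP x. F x") (auto simp: top_unique)
    obtain x where "F x \<noteq> 0" using n by auto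
    then have "0 < F x" by (simp add: zero_less_iff_neq_zero)
    also have "\<dots> \<le> ennreal m" unfolding m(1)[symmetric] by (intro SUP_upper) auto
    finally have "m > 0" by simp
    moreover have "F x \<le> ennreal m" for x unfolding m(1)[symmetric] by (intro SUP_upper) auto
    moreover have "\<exists>x. c < F x" if "c < ennreal m" for c using that unfolding m(1)[symmetric] by (auto simp: less_SUP_iff)
    ultimately show ?thesis by blast
  qed
  obtain m where m: "m > 0" "\<And>x. F x \<le> ennreal m" "\<And>c. c < ennreal m \<Longrightarrow> \<exists>x. c < F x"
    using sup[of F, OF bd(1)] False by blast
  obtain n where n: "n > 0" "\<And>x. G x \<le> ennreal n" "\<And>c. c < ennreal n \<Longrightarrow> \<exists>x. c < G x"
    using sup[of G, OF bd(2)] False by blast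
  have norm: "ennreal (1/m) * F x \<le> 1" "t < 1 \<Longrightarrow> \<exists>x. t < ennreal (1/m) * F x"
    if m: "m > 0" "\<And>x. F x \<le> ennreal m" "\<And>c. c < ennreal m \<Longrightarrow> \<exists>x. c < F x"
    for F :: "real \<Rightarrow> ennreal" and m t x
  proof -
    have "ennreal (1/m) * F x \<le> ennreal (1/m) * ennreal m" by (intro mult_left_mono m) auto
    also have "\<dots> = 1" using m(1) by (simp add: ennreal_mult[symmetric])
    finally show "ennreal (1/m) * F x \<le> 1" .
    assume "t < 1"
    then obtain r where r: "t = ennreal r" "0 \<le> r" "r < 1" by (cases t) auto
    then obtain x where "ennreal (r * m) < F x" using m(3)[of "ennreal (r * m)"] m(1) by (auto simp: ennreal_less_iff)
    then have "ennreal (1/m) * ennreal (r * m) < ennreal (1/m) * F x"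
      using m(1) by (intro ennreal_mult_strict_left_mono) auto
    also have "ennreal (1/m) * ennreal (r * m) = t" using m(1) r by (simp add: ennreal_mult[symmetric])
    finally show "\<exists>x. t < ennreal (1/m) * F x" by blast
  qed
  \<comment> \<open>Dividing \<open>F\<close> by its supremum \<open>m\<close> and \<open>G\<close>
    by \<open>n\<close> preserves the midpoint hypothesis if \<open>H\<close> is multiplied by this
    factor.\<close>
  let ?h = "1 / sqrt (m * n)"
  have hh: "(ennreal ?h)\<^sup>2 = ennreal (1/m) * ennreal (1/n)"
    using m(1) n(1) by (simp add: ennreal_power ennreal_mult[symmetric] power_divide)
  have "(\<integral>\<^sup>+ x. ennreal (1/m) * F x \<partial>lborel) + (\<integral>\<^sup>+ x. ennreal (1/n) * G x \<partial>lborel)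
      \<le> 2 * (\<integral>\<^sup>+ x. ennreal ?h * H x \<partial>lborel)"
  proof (rule prekopa_leindler_normalized)
    fix x y
    show "ennreal (1/m) * F x * (ennreal (1/n) * G y) \<le> (ennreal ?h * H ((x + y) / 2))\<^sup>2"
      using mult_left_mono[OF mid[of x y], of "ennreal (1/m) * ennreal (1/n)"]
      by (simp add: power_mult_distrib hh ac_simps)
  qed (use norm[OF m] norm[OF n] in auto)
  then have "ennreal (1/m) * (\<integral>\<^sup>+ x. F x \<partial>lborel) + ennreal (1/n) * (\<integral>\<^sup>+ x. G x \<partial>lborel)
      \<le> 2 * (ennreal ?h * (\<integral>\<^sup>+ x. H x \<partial>lborel))"
    by (simp add: nn_integral_cmult)
  from ennreal_mult_le_power2[OF this]
  have "ennreal (1/m) * ennreal (1/n) * ((\<integral>\<^sup>+ x. F x \<partial>lborel) * (\<integral>\<^sup>+ x. G x \<partial>lborel))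
      \<le> ennreal (1/m) * ennreal (1/n) * (\<integral>\<^sup>+ x. H x \<partial>lborel)\<^sup>2"
    unfolding power_mult_distrib hh by (simp only: ac_simps)
  from mult_left_mono[OF this zero_le, of "ennreal (m * n)"]
  have "ennreal (m * n) * (ennreal (1/m) * ennreal (1/n)) * ((\<integral>\<^sup>+ x. F x \<partial>lborel) * (\<integral>\<^sup>+ x. G x \<partial>lborel))
      \<le> ennreal (m * n) * (ennreal (1/m) * ennreal (1/n)) * (\<integral>\<^sup>+ x. H x \<partial>lborel)\<^sup>2"
    by (simp only: mult.assoc)
  also have "ennreal (m * n) * (ennreal (1/m) * ennreal (1/n)) = 1"
    using m(1) n(1) by (simp add: ennreal_mult[symmetric])
  finally show ?thesis by simp
qed auto

lemma SUP_min_of_nat: "(SUP k::nat. min x (of_nat k)) = (x::ennreal)"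
proof (cases x)
  case (real r)
  obtain k :: nat where "r \<le> real k" using real_arch_simple by blast
  then have "min x (of_nat k) = x" using real by (simp add: min_def ennreal_of_nat_eq_real_of_nat)
  then show ?thesis by (intro antisym SUP_least) (auto intro: SUP_upper2[of k])
qed (simp add: ennreal_SUP_of_nat_eq_top)

lemma nn_integral_truncate:
  fixes F :: "'a \<Rightarrow> ennreal"
  assumes "F \<in> borel_measurable M"
  shows "(\<integral>\<^sup>+ x. F x \<partial>M) = (SUP k::nat. \<integral>\<^sup>+ x. min (F x) (of_nat k) \<partial>M)"
proof -
  have "(\<integral>\<^sup>+ x. F x \<partial>M) = (\<integral>\<^sup>+ x. (SUP k::nat. min (F x) (of_nat k)) \<partial>M)"
    by (simp add: SUP_min_of_nat)
  also have "\<dots> = (SUP k::nat. \<integral>\<^sup>+ x. min (F x) (of_nat k) \<partial>M)"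
    using assms
    by (intro nn_integral_monotone_convergence_SUP) (auto simp: incseq_def le_fun_def min.coboundedI1 intro!: min.coboundedI2)
  finally show ?thesis .
qed

text \<open>Truncating \<open>F\<close> and \<open>G\<close> lowers only the left side of the
  midpoint hypothesis, so \<open>H\<close> can stay as it is; monotone convergence removes the
  truncation.\<close>

lemma prekopa_leindler_real:
  fixes F G H :: "real \<Rightarrow> ennreal"
  assumes [measurable]: "F \<in> borel_measurable borel" "G \<in> borel_measurable borel" "H \<in> borel_measurable borel"
    and mid: "\<And>x y. F x * G y \<le> (H ((x + y) / 2))\<^sup>2"
  shows "(\<integral>\<^sup>+ x. F x \<partial>lborel) * (\<integral>\<^sup>+ x. G x \<partial>lborel) \<le> (\<integral>\<^sup>+ x. H x \<partial>lborel)\<^sup>2"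
proof -
  have kl: "(\<integral>\<^sup>+ x. min (F x) (of_nat k) \<partial>lborel) * (\<integral>\<^sup>+ x. min (G x) (of_nat l) \<partial>lborel)
      \<le> (\<integral>\<^sup>+ x. H x \<partial>lborel)\<^sup>2" for k l :: nat
  proof (rule prekopa_leindler_bounded[of _ _ _ "real (max k l)"])
    show "min (F x) (of_nat k) \<le> ennreal (real (max k l))" "min (G x) (of_nat l) \<le> ennreal (real (max k l))" for x
      by (auto simp flip: ennreal_of_nat_eq_real_of_nat intro: order_trans[OF min.cobounded2])
    show "min (F x) (of_nat k) * min (G y) (of_nat l) \<le> (H ((x + y) / 2))\<^sup>2" for x y
      by (rule order_trans[OF mult_mono mid]) auto
  qed auto
  have F: "(\<integral>\<^sup>+ x. F x \<partial>lborel) = (SUP k::nat. \<integral>\<^sup>+ x. min (F x) (of_nat k) \<partial>lborel)"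
    and G: "(\<integral>\<^sup>+ x. G x \<partial>lborel) = (SUP k::nat. \<integral>\<^sup>+ x. min (G x) (of_nat k) \<partial>lborel)"
    by (auto intro!: nn_integral_truncate)
  show ?thesis
    unfolding F G by (simp add: SUP_mult_right_ennreal SUP_mult_left_ennreal SUP_least kl)
qed

section \<open>Prekopa-Leindler in every dimension by slicing off the last coordinate\<close>

lemma Rd_fun_upd: "x \<in> Rd d \<Longrightarrow> x(d := t) \<in> Rd (Suc d)"
  unfolding Rd_def by (auto simp: PiE_iff extensional_def)

lemma lincomb_fun_upd:
  "lincomb (Suc d) r (x(d := a)) s (y(d := b)) = (lincomb d r x s y)(d := r * a + s * b)"
  unfolding lincomb_def by (auto simp: fun_eq_iff)

lemma measurable_Rd_fun_upd [measurable]: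
  "(\<lambda>(x, t). x(d := t)) \<in> Rd_lborel d \<Otimes>\<^sub>M lborel \<rightarrow>\<^sub>M Rd_lborel (Suc d)"
  using measurable_add_dim[of d "{..<d}" "\<lambda>_. lborel :: real measure"]
  by (simp add: Rd_lborel_def lessThan_Suc)

lemma product_sigma_finite_lborel: "product_sigma_finite (\<lambda>_. lborel :: real measure)"
  by (intro product_sigma_finite.intro sigma_finite_lborel)

lemma nn_integral_Rd_Suc:
  assumes "F \<in> borel_measurable (Rd_lborel (Suc d))"
  shows "(\<integral>\<^sup>+ x. F x \<partial>Rd_lborel (Suc d)) = (\<integral>\<^sup>+ x. \<integral>\<^sup>+ t. F (x(d := t)) \<partial>lborel \<partial>Rd_lborel d)"
    "(\<integral>\<^sup>+ x. F x \<partial>Rd_lborel (Suc d)) = (\<integral>\<^sup>+ t. \<integral>\<^sup>+ x. F (x(d := t)) \<partial>Rd_lborel d \<partial>lborel)"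
  using product_sigma_finite.product_nn_integral_insert[OF product_sigma_finite_lborel, of "{..<d}" d F]
    product_sigma_finite.product_nn_integral_insert_rev[OF product_sigma_finite_lborel, of "{..<d}" d F] assms
  by (simp_all add: Rd_lborel_def lessThan_Suc)

text \<open>Induction on the dimension: by the inequality on the line, the integrals over the last
  coordinate satisfy the midpoint hypothesis in the remaining coordinates.\<close>

theorem prekopa_leindler:
  fixes F G H :: "(nat \<Rightarrow> real) \<Rightarrow> ennreal"
  assumes "F \<in> borel_measurable (Rd_lborel d)" "G \<in> borel_measurable (Rd_lborel d)"
    "H \<in> borel_measurable (Rd_lborel d)"
    and "\<And>x y. x \<in> Rd d \<Longrightarrow> y \<in> Rd d \<Longrightarrow> F x * G y \<le> (H (lincomb d (1/2) x (1/2) y))\<^sup>2"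
  shows "(\<integral>\<^sup>+ x. F x \<partial>Rd_lborel d) * (\<integral>\<^sup>+ x. G x \<partial>Rd_lborel d) \<le> (\<integral>\<^sup>+ x. H x \<partial>Rd_lborel d)\<^sup>2"
  using assms
proof (induction d arbitrary: F G H)
  \<comment> \<open>Dimension 0 is a single point of mass 1, represented by the function that is
    \<open>undefined\<close> everywhere.\<close>
  case 0
  have "(\<integral>\<^sup>+ x. F x \<partial>Rd_lborel 0) = F (\<lambda>_. undefined)" for F
    unfolding Rd_lborel_def
    using product_sigma_finite.nn_integral_empty[OF product_sigma_finite_lborel, of F] by simp
  moreover have "(\<lambda>_. undefined) \<in> Rd 0" "lincomb 0 (1/2) (\<lambda>_. undefined) (1/2) (\<lambda>_. undefined) = (\<lambda>_. undefined)"
    by (auto simp: Rd_def lincomb_def)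
  ultimately show ?case using "0.prems"(4)[of "\<lambda>_. undefined" "\<lambda>_. undefined"] by simp
next
  case (Suc d)
  note [measurable] = Suc.prems(1-3)
  have m: "(\<lambda>(x, t). F (x(d := t))) \<in> borel_measurable (Rd_lborel d \<Otimes>\<^sub>M lborel)"
    if "F \<in> borel_measurable (Rd_lborel (Suc d))" for F :: "(nat \<Rightarrow> real) \<Rightarrow> ennreal"
    using measurable_compose[OF measurable_Rd_fun_upd that] by (simp add: split_beta')
  have mt: "(\<lambda>t. F (x(d := t))) \<in> borel_measurable borel" "(\<lambda>x. \<integral>\<^sup>+ t. F (x(d := t)) \<partial>lborel) \<in> borel_measurable (Rd_lborel d)"
    if "F \<in> borel_measurable (Rd_lborel (Suc d))" "x \<in> Rd d" for F :: "(nat \<Rightarrow> real) \<Rightarrow> ennreal" and x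
  proof -
    show "(\<lambda>t. F (x(d := t))) \<in> borel_measurable borel"
      using measurable_compose[OF measurable_Pair1' m[OF that(1)], of x] that(2) by simp
    show "(\<lambda>x. \<integral>\<^sup>+ t. F (x(d := t)) \<partial>lborel) \<in> borel_measurable (Rd_lborel d)"
      using m[OF that(1)] by (intro lborel.borel_measurable_nn_integral) simp
  qed
  \<comment> \<open>Both claims of \<open>mt\<close> carry the premise that some point lies in
    \<open>Rd d\<close>; the origin discharges it for the measurability claim.\<close>
  have ne: "(\<lambda>i\<in>{..<d}. 0) \<in> Rd d" by (simp add: Rd_def)
  show ?case
    unfolding nn_integral_Rd_Suc(1)[OF Suc.prems(1)] nn_integral_Rd_Suc(1)[OF Suc.prems(2)] nn_integral_Rd_Suc(1)[OF Suc.prems(3)]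
  proof (rule Suc.IH)
    fix x y assume xy: "x \<in> Rd d" "y \<in> Rd d"
    have "lincomb d (1/2) x (1/2) y \<in> Rd d" by (simp add: Rd_def lincomb_def)
    then show "(\<integral>\<^sup>+ t. F (x(d := t)) \<partial>lborel) * (\<integral>\<^sup>+ t. G (y(d := t)) \<partial>lborel)
        \<le> (\<integral>\<^sup>+ t. H ((lincomb d (1/2) x (1/2) y)(d := t)) \<partial>lborel)\<^sup>2"
    proof (intro prekopa_leindler_real mt Suc.prems xy)
      show "F (x(d := a)) * G (y(d := b)) \<le> (H ((lincomb d (1/2) x (1/2) y)(d := (a + b) / 2)))\<^sup>2" for a b
        using Suc.prems(4)[OF Rd_fun_upd[OF xy(1), of a] Rd_fun_upd[OF xy(2), of b]]
        unfolding lincomb_fun_upd by (simp only: add_divide_distrib mult_1_left times_divide_eq_left)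
    qed
  qed (rule mt(2)[OF Suc.prems(1) ne] mt(2)[OF Suc.prems(2) ne] mt(2)[OF Suc.prems(3) ne])+
qed

section \<open>Convex sets in coordinate space\<close>

text \<open>Cubes take the place of balls: they are products of intervals, so that their measure and
  their openness come from the product structure.\<close>

definition Rd_box :: "nat \<Rightarrow> (nat \<Rightarrow> real) \<Rightarrow> real \<Rightarrow> (nat \<Rightarrow> real) set" where
  "Rd_box d c r = {x \<in> Rd d. \<forall>i<d. \<bar>x i - c i\<bar> < r}"

definition convex_Rd :: "nat \<Rightarrow> (nat \<Rightarrow> real) set \<Rightarrow> bool" where
  "convex_Rd d D \<longleftrightarrow> D \<subseteq> Rd d \<and> (\<forall>x\<in>D. \<forall>y\<in>D. \<forall>r\<in>{0..1}. lincomb d r x (1 - r) y \<in> D)"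

lemma lincomb_in_Rd [simp]: "lincomb d r x s y \<in> Rd d"
  by (simp add: lincomb_def Rd_def)

lemma Rd_eqI: "x \<in> Rd d \<Longrightarrow> y \<in> Rd d \<Longrightarrow> (\<And>i. i < d \<Longrightarrow> x i = y i) \<Longrightarrow> x = y"
  unfolding Rd_def by (erule (1) PiE_ext) simp

lemma Rd_box_eq_PiE: "Rd_box d c r = Pi\<^sub>E {..<d} (\<lambda>i. {c i - r<..<c i + r})"
  unfolding Rd_box_def Rd_def PiE_iff set_eq_iff abs_diff_less_iff by force

lemma sets_Rd_box [measurable]: "Rd_box d c r \<in> sets (Rd_lborel d)"
  unfolding Rd_box_eq_PiE Rd_lborel_def by (intro sets_PiM_I_finite) auto

lemma emeasure_Rd_box: "emeasure (Rd_lborel d) (Rd_box d c r) = ennreal (2 * r) ^ d"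
proof -
  have "emeasure (Rd_lborel d) (Rd_box d c r) = (\<Prod>i<d. emeasure lborel {c i - r<..<c i + r})"
    unfolding Rd_box_eq_PiE Rd_lborel_def
    by (intro product_sigma_finite.emeasure_PiM[OF product_sigma_finite_lborel]) auto
  moreover have "emeasure lborel {c i - r<..<c i + r} = ennreal (2 * r)" for i
    by (cases "r \<ge> 0") (auto simp: ennreal_neg)
  ultimately show ?thesis by simp
qed

text \<open>The homothety with centre \<open>x\<close> and ratio 1 - t maps the cube at
  \<open>y\<close> onto the cube at the point of the segment.\<close>

lemma Rd_box_segment:
  assumes D: "convex_Rd d D" and x: "x \<in> D" and y: "Rd_box d y r \<subseteq> D" and t: "0 \<le> t" "t < 1"
  shows "Rd_box d (lincomb d t x (1 - t) y) ((1 - t) * r) \<subseteq> D"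
proof
  fix z assume z: "z \<in> Rd_box d (lincomb d t x (1 - t) y) ((1 - t) * r)"
  define y' where "y' = (\<lambda>i\<in>{..<d}. (z i - t * x i) / (1 - t))"
  have "y' \<in> Rd_box d y r"
    unfolding Rd_box_def
  proof (safe intro!: )
    show "y' \<in> Rd d" by (simp add: y'_def Rd_def)
    fix i assume i: "i < d"
    have "y' i - y i = (z i - (t * x i + (1 - t) * y i)) / (1 - t)"
      using i t by (simp add: y'_def field_simps)
    moreover have "\<bar>z i - (t * x i + (1 - t) * y i)\<bar> < (1 - t) * r"
      using z i by (simp add: Rd_box_def lincomb_def)
    ultimately show "\<bar>y' i - y i\<bar> < r" using t by (simp add: abs_divide pos_divide_less_eq mult.commute)
  qed
  then have "lincomb d t x (1 - t) y' \<in> D" using D x y t unfolding convex_Rd_def by auto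
  also have "lincomb d t x (1 - t) y' = z"
    using z t by (intro Rd_eqI[OF lincomb_in_Rd]) (auto simp: Rd_box_def lincomb_def y'_def)
  finally show "z \<in> D" .
qed

text \<open>If at most one horizontal slice had positive measure, Fubini would make \<open>D\<close>
  null. So two slices at different heights do; each contains a cube by induction, and the convex
  hull of two parallel cubes contains a cube about the midpoint of their centres.\<close>

lemma convex_contains_box:
  assumes "D \<in> sets (Rd_lborel d)" "emeasure (Rd_lborel d) D \<noteq> 0" "convex_Rd d D"
  shows "\<exists>c\<in>Rd d. \<exists>r>0. Rd_box d c r \<subseteq> D"
  using assms
proof (induction d arbitrary: D)
  case 0
  then obtain x where x: "x \<in> D" by fastforce
  have "y = x" if "y \<in> Rd 0" for y using that x "0.prems"(3) by (intro Rd_eqI[of _ 0]) (auto simp: convex_Rd_def)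
  then show ?case using x "0.prems"(3) by (intro bexI[of _ x] exI[of _ 1]) (auto simp: Rd_box_def convex_Rd_def)
next
  case (Suc d)
  define S where "S t = {x \<in> Rd d. x(d := t) \<in> D}" for t
  have m: "(\<lambda>x. x(d := t)) \<in> Rd_lborel d \<rightarrow>\<^sub>M Rd_lborel (Suc d)" for t
    using measurable_compose[OF measurable_Pair2' measurable_Rd_fun_upd, of t d] by simp
  have Sm: "S t \<in> sets (Rd_lborel d)" for t
    using measurable_sets[OF m Suc.prems(1), of t] by (simp add: S_def vimage_def Int_def conj_commute)
  have Sc: "convex_Rd d (S t)" for t
  proof -
    have "lincomb d r x (1 - r) y \<in> S t" if "x \<in> S t" "y \<in> S t" "r \<in> {0..1}" for x y r
    proof -
      have "lincomb (Suc d) r (x(d := t)) (1 - r) (y(d := t)) \<in> D"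
        using Suc.prems(3) that unfolding convex_Rd_def S_def by blast
      moreover have "r * t + (1 - r) * t = t" by (simp add: algebra_simps)
      ultimately show ?thesis unfolding lincomb_fun_upd by (simp add: S_def)
    qed
    then show ?thesis unfolding convex_Rd_def by (auto simp: S_def)
  qed
  have "\<exists>t1 t2. t1 < t2 \<and> emeasure (Rd_lborel d) (S t1) \<noteq> 0 \<and> emeasure (Rd_lborel d) (S t2) \<noteq> 0"
  proof (rule ccontr)
    assume neg: "\<not> ?thesis"
    have "\<exists>t0. \<forall>t. t \<noteq> t0 \<longrightarrow> emeasure (Rd_lborel d) (S t) = 0"
    proof (cases "\<exists>t0. emeasure (Rd_lborel d) (S t0) \<noteq> 0")
      case True
      then show ?thesis using neg by (metis linorder_neqE)
    qed auto
    then obtain t0 where t0: "\<And>t. t \<noteq> t0 \<Longrightarrow> emeasure (Rd_lborel d) (S t) = 0" by blast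
    have "emeasure (Rd_lborel (Suc d)) D = (\<integral>\<^sup>+ x. indicator D x \<partial>Rd_lborel (Suc d))"
      using Suc.prems(1) by simp
    also have "\<dots> = (\<integral>\<^sup>+ t. \<integral>\<^sup>+ x. indicator D (x(d := t)) \<partial>Rd_lborel d \<partial>lborel)"
      using Suc.prems(1) by (intro nn_integral_Rd_Suc) auto
    also have "\<dots> = (\<integral>\<^sup>+ t. emeasure (Rd_lborel d) (S t) \<partial>lborel)"
    proof (rule nn_integral_cong)
      fix t
      have "(\<integral>\<^sup>+ x. indicator D (x(d := t)) \<partial>Rd_lborel d) = (\<integral>\<^sup>+ x. indicator (S t) x \<partial>Rd_lborel d)"
        by (intro nn_integral_cong) (auto simp: S_def indicator_def)
      then show "(\<integral>\<^sup>+ x. indicator D (x(d := t)) \<partial>Rd_lborel d) = emeasure (Rd_lborel d) (S t)"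
        using Sm by simp
    qed
    also have "\<dots> = (\<integral>\<^sup>+ t. 0 \<partial>(lborel :: real measure))"
      by (intro nn_integral_cong_AE AE_I[of _ _ "{t0}"]) (auto intro: t0)
    finally show False using Suc.prems(2) by simp
  qed
  then obtain t1 t2 where t: "t1 < t2" "emeasure (Rd_lborel d) (S t1) \<noteq> 0" "emeasure (Rd_lborel d) (S t2) \<noteq> 0"
    by blast
  obtain c1 r1 where 1: "c1 \<in> Rd d" "r1 > 0" "Rd_box d c1 r1 \<subseteq> S t1" using Suc.IH[OF Sm t(2) Sc] by blast
  obtain c2 r2 where 2: "c2 \<in> Rd d" "r2 > 0" "Rd_box d c2 r2 \<subseteq> S t2" using Suc.IH[OF Sm t(3) Sc] by blast
  define r where "r = min r1 r2"
  define M where "M = (\<Sum>i<d. \<bar>c1 i - c2 i\<bar>)"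
  \<comment> \<open>The first bound keeps the height strictly between \<open>t1\<close> and
    \<open>t2\<close>. The second pays for the offset from the cube itself and for the drift of the
    centres, at most M / (t2 - t1) per unit of height.\<close>
  define \<rho> where "\<rho> = min ((t2 - t1) / 2) (r / (1 + M / (t2 - t1)))"
  have M: "M \<ge> 0" "\<And>i. i < d \<Longrightarrow> \<bar>c1 i - c2 i\<bar> \<le> M" unfolding M_def by (auto intro!: sum_nonneg member_le_sum)
  have r: "r > 0" using 1 2 by (simp add: r_def)
  have pos: "1 + M / (t2 - t1) > 0" using M t by (intro add_pos_nonneg) auto
  have "\<rho> \<le> r / (1 + M / (t2 - t1))" by (simp add: \<rho>_def)
  then have "\<rho> * (1 + M / (t2 - t1)) \<le> r" by (rule iffD1[OF pos_le_divide_eq[OF pos]])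
  moreover have "\<rho> > 0" using r t pos by (simp add: \<rho>_def)
  moreover have "\<rho> \<le> (t2 - t1) / 2" unfolding \<rho>_def by (rule min.cobounded1)
  ultimately have \<rho>: "\<rho> > 0" "\<rho> \<le> (t2 - t1) / 2" "\<rho> * (1 + M / (t2 - t1)) \<le> r" by simp_all
  define c where "c = (lincomb d (1/2) c1 (1/2) c2)(d := (t1 + t2) / 2)"
  have "Rd_box (Suc d) c \<rho> \<subseteq> D"
  proof
    fix x assume "x \<in> Rd_box (Suc d) c \<rho>"
    then have x: "x \<in> Rd (Suc d)" "\<And>i. i < Suc d \<Longrightarrow> \<bar>x i - c i\<bar> < \<rho>" by (auto simp: Rd_box_def)
    define h where "h = (t2 - x d) / (t2 - t1)"
    have xd: "\<bar>x d - (t1 + t2) / 2\<bar> < \<rho>" using x(2)[of d] by (simp add: c_def)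
    have hm: "h * (t2 - t1) = t2 - x d"
      using t by (simp add: h_def)
    then have hx: "x d = h * t1 + (1 - h) * t2"
      by (simp add: algebra_simps)
    have "(h - 1/2) * (t2 - t1) = (t1 + t2) / 2 - x d" using hm by (simp add: field_simps)
    then have "\<bar>h - 1/2\<bar> * (t2 - t1) = \<bar>(t1 + t2) / 2 - x d\<bar>" using t by (metis abs_mult abs_of_pos diff_gt_0_iff_gt)
    then have "\<bar>h - 1/2\<bar> * (t2 - t1) < \<rho>" using xd by (simp add: abs_minus_commute)
    then have h12: "\<bar>h - 1/2\<bar> < \<rho> / (t2 - t1)" using t by (simp add: pos_less_divide_eq)
    also have "\<dots> \<le> 1/2" using \<rho> t by (simp add: pos_divide_le_eq)
    finally have "\<bar>h - 1/2\<bar> < 1/2" .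
    then have h: "h \<in> {0..1}" unfolding abs_diff_less_iff by simp
    define e where "e i = x i - (h * c1 i + (1 - h) * c2 i)" for i
    have e: "\<bar>e i\<bar> < r" if i: "i < d" for i
    proof -
      have "e i = (x i - c i) - (h - 1/2) * (c1 i - c2 i)"
        using i by (simp add: e_def c_def lincomb_def field_simps)
      also have "\<bar>\<dots>\<bar> \<le> \<bar>x i - c i\<bar> + \<bar>h - 1/2\<bar> * \<bar>c1 i - c2 i\<bar>"
        using abs_triangle_ineq4[of "x i - c i" "(h - 1/2) * (c1 i - c2 i)"] by (simp only: abs_mult)
      also have "\<dots> < \<rho> + \<rho> / (t2 - t1) * M"
        using h12 M i x(2)[of i] by (intro add_less_le_mono mult_mono) auto
      also have "\<dots> = \<rho> * (1 + M / (t2 - t1))" by (simp add: algebra_simps)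
      finally show ?thesis using \<rho>(3) by (rule less_le_trans)
    qed
    define y1 where "y1 = (\<lambda>i\<in>{..<d}. c1 i + e i)"
    define y2 where "y2 = (\<lambda>i\<in>{..<d}. c2 i + e i)"
    have "y1 \<in> Rd_box d c1 r1" "y2 \<in> Rd_box d c2 r2"
      using e by (auto simp: Rd_box_def y1_def y2_def Rd_def r_def)
    then have "y1 \<in> S t1" "y2 \<in> S t2" using 1(3) 2(3) by auto
    then have "lincomb (Suc d) h (y1(d := t1)) (1 - h) (y2(d := t2)) \<in> D"
      using Suc.prems(3) h unfolding convex_Rd_def S_def by blast
    also have "lincomb (Suc d) h (y1(d := t1)) (1 - h) (y2(d := t2)) = x"
    proof (rule Rd_eqI[of _ "Suc d"])
      fix i assume "i < Suc d"
      then consider "i = d" | "i < d" by linarith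
      then show "lincomb (Suc d) h (y1(d := t1)) (1 - h) (y2(d := t2)) i = x i"
        by cases (simp_all add: lincomb_def hx y1_def y2_def e_def algebra_simps)
    qed (use x in auto)
    finally show "x \<in> D" .
  qed
  moreover have "c \<in> Rd (Suc d)" by (simp add: c_def Rd_fun_upd)
  ultimately show ?case using \<rho> by blast
qed

section \<open>Open and Borel sets of coordinate space described by cubes\<close>

lemma openin_Rd_top:
  "openin (Rd_top d) U \<longleftrightarrow> U \<subseteq> Rd d \<and> (\<forall>x\<in>U. \<exists>r>0. Rd_box d x r \<subseteq> U)"
proof
  assume U: "openin (Rd_top d) U"
  have "\<exists>r>0. Rd_box d x r \<subseteq> U" if x: "x \<in> U" for x
  proof -
    obtain W where W: "\<And>i. i < d \<Longrightarrow> open (W i)" "x \<in> Pi\<^sub>E {..<d} W" "Pi\<^sub>E {..<d} W \<subseteq> U"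
      using U[unfolded Rd_top_def openin_product_topology_alt, rule_format, OF x] by auto
    have "\<forall>i\<in>{..<d}. \<exists>r>0. ball (x i) r \<subseteq> W i"
      using W by (auto simp: PiE_iff open_contains_ball)
    then obtain r where r: "\<And>i. i < d \<Longrightarrow> r i > 0 \<and> ball (x i) (r i) \<subseteq> W i" by (metis lessThan_iff)
    \<comment> \<open>Inserting 1 keeps the minimum meaningful and positive when d = 0.\<close>
    define \<rho> where "\<rho> = Min (insert 1 (r ` {..<d}))"
    have "\<rho> > 0" "\<And>i. i < d \<Longrightarrow> \<rho> \<le> r i" unfolding \<rho>_def using r by (auto simp: Min_le_iff)
    moreover have "Rd_box d x \<rho> \<subseteq> Pi\<^sub>E {..<d} W"
    proof
      fix y assume y: "y \<in> Rd_box d x \<rho>"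
      have "y i \<in> W i" if "i < d" for i
        using r[OF that] y that \<open>\<And>i. i < d \<Longrightarrow> \<rho> \<le> r i\<close>[OF that]
        by (force simp: Rd_box_def dist_real_def abs_minus_commute)
      then show "y \<in> Pi\<^sub>E {..<d} W" using y by (auto simp: Rd_box_def Rd_def PiE_iff)
    qed
    ultimately show ?thesis using W(3) by blast
  qed
  moreover have "U \<subseteq> Rd d" using openin_subset[OF U] by (simp add: Rd_top_def Rd_def)
  ultimately show "U \<subseteq> Rd d \<and> (\<forall>x\<in>U. \<exists>r>0. Rd_box d x r \<subseteq> U)" by blast
next
  assume U: "U \<subseteq> Rd d \<and> (\<forall>x\<in>U. \<exists>r>0. Rd_box d x r \<subseteq> U)"
  show "openin (Rd_top d) U"
    unfolding Rd_top_def openin_product_topology_alt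
  proof safe
    fix x assume x: "x \<in> U"
    then obtain r where r: "r > 0" "Rd_box d x r \<subseteq> U" using U by blast
    have "x \<in> Rd_box d x r" using x U r(1) by (auto simp: Rd_box_def)
    then show "\<exists>Ua. finite {i \<in> {..<d}. Ua i \<noteq> topspace euclideanreal} \<and> (\<forall>i\<in>{..<d}. openin euclideanreal (Ua i)) \<and>
        x \<in> Pi\<^sub>E {..<d} Ua \<and> Pi\<^sub>E {..<d} Ua \<subseteq> U"
      using r(2) unfolding Rd_box_eq_PiE by (intro exI[of _ "\<lambda>i. {x i - r<..<x i + r}"]) auto
  qed
qed

lemma openin_Rd_top_box: "openin (Rd_top d) (Rd_box d c r)"
  unfolding openin_Rd_top
proof (intro conjI ballI)
  fix x assume x: "x \<in> Rd_box d c r"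
  define \<rho> where "\<rho> = Min (insert 1 ((\<lambda>i. r - \<bar>x i - c i\<bar>) ` {..<d}))"
  have \<rho>: "\<rho> > 0" "\<And>i. i < d \<Longrightarrow> \<rho> \<le> r - \<bar>x i - c i\<bar>" unfolding \<rho>_def using x by (auto simp: Rd_box_def Min_le_iff)
  have "Rd_box d x \<rho> \<subseteq> Rd_box d c r"
  proof
    fix y assume "y \<in> Rd_box d x \<rho>"
    then show "y \<in> Rd_box d c r" using \<rho>(2) unfolding Rd_box_def by force
  qed
  then show "\<exists>r'>0. Rd_box d x r' \<subseteq> Rd_box d c r" using \<rho>(1) by blast
next
  show "Rd_box d c r \<subseteq> Rd d" unfolding Rd_box_def by blast
qed

text \<open>Second countability: an open set is a countable union of cubes with rational centres and
  radii 1 / Suc n.\<close>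

lemma sets_openin_Rd_top:
  assumes "openin (Rd_top d) U"
  shows "U \<in> sets (Rd_lborel d)"
proof -
  define Q where "Q = {(c, n :: nat). c \<in> Pi\<^sub>E {..<d} (\<lambda>_. \<rat>) \<and> Rd_box d c (1 / Suc n) \<subseteq> U}"
  have "countable Q"
    by (rule countable_subset[of _ "(Pi\<^sub>E {..<d} (\<lambda>_. \<rat>)) \<times> UNIV"])
       (auto simp: Q_def intro!: countable_SIGMA countable_PiE countable_rat)
  moreover have "U = (\<Union>(c, n)\<in>Q. Rd_box d c (1 / Suc n))"
  proof (intro equalityI subsetI)
    fix x assume x: "x \<in> U"
    then obtain r where r: "r > 0" "Rd_box d x r \<subseteq> U" "x \<in> Rd d" using assms unfolding openin_Rd_top by blast
    obtain n :: nat where n: "1 / Suc n < r / 2" using r(1) nat_approx_posE[of "r / 2"] by auto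
    have "\<exists>q\<in>\<rat>. \<bar>x i - q\<bar> < 1 / Suc n" for i
    proof -
      obtain q where "q \<in> \<rat>" "x i < q" "q < x i + 1 / Suc n" using Rats_dense_in_real[of "x i" "x i + 1 / Suc n"] by auto
      then show ?thesis by (intro bexI[of _ q]) auto
    qed
    then obtain q where q: "\<And>i. q i \<in> \<rat> \<and> \<bar>x i - q i\<bar> < 1 / Suc n" by metis
    define c where "c = (\<lambda>i\<in>{..<d}. q i)"
    have "Rd_box d c (1 / Suc n) \<subseteq> Rd_box d x r"
    proof
      fix y assume y: "y \<in> Rd_box d c (1 / Suc n)"
      have "\<bar>y i - x i\<bar> < r" if "i < d" for i
      proof -
        have "\<bar>y i - q i\<bar> < 1 / Suc n" using y that by (simp add: Rd_box_def c_def)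
        then show ?thesis using q[of i] n by linarith
      qed
      then show "y \<in> Rd_box d x r" using y by (auto simp: Rd_box_def)
    qed
    then have "(c, n) \<in> Q" using r(2) q by (auto simp: Q_def c_def)
    moreover have "x \<in> Rd_box d c (1 / Suc n)" using q r(3) by (auto simp: Rd_box_def c_def)
    ultimately show "x \<in> (\<Union>(c, n)\<in>Q. Rd_box d c (1 / Suc n))" by auto
  qed (auto simp: Q_def)
  ultimately show ?thesis by (metis (no_types, lifting) case_prod_beta' sets.countable_UN'' sets_Rd_box)
qed

text \<open>If \<open>U\<close> is the interior of a convex set \<open>D\<close>, then midpoints of \<open>D\<close> and \<open>U\<close> lie in \<open>U\<close>, so that
  Prekopa-Leindler gives \<open>|D| |U| \<le> |U|\<^sup>2\<close> inside each bounded box.\<close>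

lemma convex_diff_interior_null:
  assumes D: "D \<in> sets (Rd_lborel d)" "convex_Rd d D"
    and U: "openin (Rd_top d) U" "U \<subseteq> D" "\<And>W. openin (Rd_top d) W \<Longrightarrow> W \<subseteq> D \<Longrightarrow> W \<subseteq> U"
  shows "D - U \<in> null_sets (Rd_lborel d)"
proof (cases "emeasure (Rd_lborel d) D = 0")
  case True
  then have "D \<in> null_sets (Rd_lborel d)" using D by auto
  then show ?thesis using sets_openin_Rd_top[OF U(1)] by (rule null_set_Diff)
next
  case False
  have Um[measurable]: "U \<in> sets (Rd_lborel d)" by (rule sets_openin_Rd_top[OF U(1)])
  note [measurable] = D(1)
  let ?B = "\<lambda>n. Rd_box d (\<lambda>_. 0) (real n)"
  have incB: "incseq ?B"
  proof (intro monoI subsetI)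
    fix m n :: nat and x assume "m \<le> n" "x \<in> ?B m"
    then show "x \<in> ?B n" by (auto simp: Rd_box_def intro: order_less_le_trans[of _ "real m" "real n"])
  qed
  have UnB: "(\<Union>n. ?B n) = Rd d"
  proof (intro equalityI subsetI)
    fix x assume x: "x \<in> Rd d"
    obtain n :: nat where n: "(\<Sum>i<d. \<bar>x i\<bar>) < real n"
      using reals_Archimedean2[of "\<Sum>i<d. \<bar>x i\<bar>"] by (elim exE)
    have "\<bar>x i\<bar> < real n" if "i < d" for i
      using member_le_sum[of i "{..<d}" "\<lambda>i. \<bar>x i\<bar>"] that n by auto
    then show "x \<in> (\<Union>n. ?B n)" using x by (auto simp: Rd_box_def)
  qed (auto simp: Rd_box_def)
  \<comment> \<open>If \<open>U\<close> were null, the product inequality would say nothing. A cube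
    inside \<open>D\<close> lies in \<open>U\<close> by maximality, so \<open>U\<close> has positive
    measure.\<close>
  obtain c r where c: "c \<in> Rd d" "r > 0" "Rd_box d c r \<subseteq> D"
    using convex_contains_box[OF D(1) False D(2)] by blast
  have "Rd_box d c r \<subseteq> U" by (rule U(3)[OF openin_Rd_top_box c(3)])
  then have "ennreal (2 * r) ^ d \<le> emeasure (Rd_lborel d) U"
    unfolding emeasure_Rd_box[symmetric, of r d c] by (intro emeasure_mono Um)
  moreover have "0 < ennreal (2 * r) ^ d" using c(2) by (simp add: ennreal_power)
  ultimately have Upos: "0 < emeasure (Rd_lborel d) U" by (rule less_le_trans[rotated])
  have "emeasure (Rd_lborel d) U = emeasure (Rd_lborel d) (\<Union>n. U \<inter> ?B n)"
  proof -
    have "(\<Union>n. U \<inter> ?B n) = U" unfolding Int_UN_distrib[symmetric] UnB using U(2) D(2) unfolding convex_Rd_def by blast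
    then show ?thesis by (simp only:)
  qed
  also have "\<dots> = (SUP n. emeasure (Rd_lborel d) (U \<inter> ?B n))"
  proof (rule SUP_emeasure_incseq[symmetric])
    show "range (\<lambda>n. U \<inter> ?B n) \<subseteq> sets (Rd_lborel d)" using Um sets_Rd_box by blast
    show "incseq (\<lambda>n. U \<inter> ?B n)" using incB unfolding incseq_def by blast
  qed
  finally obtain N where N: "0 < emeasure (Rd_lborel d) (U \<inter> ?B N)"
    using Upos by (auto simp: less_SUP_iff)
  have mid: "lincomb d (1/2) x (1/2) y \<in> U" if xy: "x \<in> D" "y \<in> U" for x y
  proof -
    obtain r where r: "r > 0" "Rd_box d y r \<subseteq> D" using U(1,2) xy(2) unfolding openin_Rd_top by blast
    have "Rd_box d (lincomb d (1/2) x (1 - 1/2) y) ((1 - 1/2) * r) \<subseteq> U"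
      by (intro U(3) openin_Rd_top_box Rd_box_segment D xy r) auto
    moreover have "lincomb d (1/2) x (1 - 1/2) y \<in> Rd_box d (lincomb d (1/2) x (1 - 1/2) y) ((1 - 1/2) * r)"
      using r(1) by (auto simp: Rd_box_def)
    ultimately show ?thesis by auto
  qed
  \<comment> \<open>The common factor, the measure of \<open>U\<close> in the box, can be cancelled:
    it is finite by the box and positive from \<open>N\<close> on.\<close>
  have null: "(D - U) \<inter> ?B n \<in> null_sets (Rd_lborel d)" if "n \<ge> N" for n
  proof -
    let ?\<mu> = "emeasure (Rd_lborel d)"
    have fin: "?\<mu> (U \<inter> ?B n) \<noteq> \<infinity>"
    proof -
      have "?\<mu> (U \<inter> ?B n) \<le> ?\<mu> (?B n)" by (intro emeasure_mono sets_Rd_box) auto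
      then show ?thesis by (auto simp: emeasure_Rd_box top_unique power_eq_top_ennreal)
    qed
    have pos: "0 < ?\<mu> (U \<inter> ?B n)"
    proof (rule less_le_trans[OF N emeasure_mono])
      show "U \<inter> ?B N \<subseteq> U \<inter> ?B n" using incB that unfolding incseq_def by blast
    qed (intro sets.Int Um sets_Rd_box)
    have "(\<integral>\<^sup>+ x. indicator (D \<inter> ?B n) x \<partial>Rd_lborel d) * (\<integral>\<^sup>+ x. indicator (U \<inter> ?B n) x \<partial>Rd_lborel d)
        \<le> (\<integral>\<^sup>+ x. indicator (U \<inter> ?B n) x \<partial>Rd_lborel d)\<^sup>2"
    proof (rule prekopa_leindler)
      fix x y assume "x \<in> Rd d" "y \<in> Rd d"
      have "lincomb d (1/2) x (1/2) y \<in> U \<inter> ?B n" if "x \<in> D \<inter> ?B n" "y \<in> U \<inter> ?B n"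
      proof -
        have "\<bar>lincomb d (1/2) x (1/2) y i - 0\<bar> < real n" if i: "i < d" for i
        proof -
          have "\<bar>x i\<bar> < real n" "\<bar>y i\<bar> < real n" using \<open>x \<in> D \<inter> ?B n\<close> \<open>y \<in> U \<inter> ?B n\<close> i by (auto simp: Rd_box_def)
          then show ?thesis using i by (simp add: lincomb_def abs_less_iff)
        qed
        then show ?thesis using that mid[of x y] by (simp add: Rd_box_def)
      qed
      then show "indicator (D \<inter> ?B n) x * indicator (U \<inter> ?B n) y \<le> (indicator (U \<inter> ?B n) (lincomb d (1/2) x (1/2) y) :: ennreal)\<^sup>2"
        by (auto simp: indicator_def)
    qed (use D(1) Um in auto)
    then have DU: "?\<mu> (D \<inter> ?B n) * ?\<mu> (U \<inter> ?B n) \<le> ?\<mu> (U \<inter> ?B n) * ?\<mu> (U \<inter> ?B n)"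
      unfolding nn_integral_indicator[OF sets.Int[OF D(1) sets_Rd_box]]
        nn_integral_indicator[OF sets.Int[OF Um sets_Rd_box]] power2_eq_square .
    have le: "?\<mu> (D \<inter> ?B n) \<le> ?\<mu> (U \<inter> ?B n)"
    proof (rule ccontr)
      assume "\<not> ?thesis"
      then have "?\<mu> (U \<inter> ?B n) * ?\<mu> (U \<inter> ?B n) < ?\<mu> (D \<inter> ?B n) * ?\<mu> (U \<inter> ?B n)"
        using pos fin by (intro ennreal_mult_strict_right_mono) (simp_all add: less_top[symmetric])
      then show False using DU by simp
    qed
    have diff: "(D - U) \<inter> ?B n = (D \<inter> ?B n) - (U \<inter> ?B n)" by blast
    have "?\<mu> ((D - U) \<inter> ?B n) = ?\<mu> (D \<inter> ?B n) - ?\<mu> (U \<inter> ?B n)"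
      unfolding diff
      by (rule emeasure_Diff[OF fin sets.Int[OF D(1) sets_Rd_box] sets.Int[OF Um sets_Rd_box]]) (use U(2) in auto)
    also have "\<dots> = 0" using le fin by (intro diff_eq_0_ennreal) (auto simp: less_top[symmetric] top_unique)
    finally show ?thesis by (rule null_setsI[OF _ sets.Int[OF sets.Diff[OF D(1) Um] sets_Rd_box]])
  qed
  have "D - U = (\<Union>n. (D - U) \<inter> ?B (n + N))"
  proof (intro equalityI subsetI)
    fix x assume x: "x \<in> D - U"
    then have "x \<in> (\<Union>n. ?B n)" unfolding UnB using D(2) by (auto simp: convex_Rd_def)
    then obtain n where "x \<in> ?B n" by blast
    then have "x \<in> ?B (n + N)" using incseqD[OF incB, of n "n + N"] by auto
    then show "x \<in> (\<Union>n. (D - U) \<inter> ?B (n + N))" using x by blast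
  qed auto
  moreover have "(\<Union>n. (D - U) \<inter> ?B (n + N)) \<in> null_sets (Rd_lborel d)"
    by (intro null_sets_UN null) simp
  ultimately show ?thesis by (simp only:)
qed

section \<open>Midpoint inequality for weakly log-concave densities\<close>

lemma continuous_inD:
  assumes F: "continuous_in d U F" and U: "openin (Rd_top d) U" and x: "x \<in> U" and e: "\<epsilon> > 0"
  shows "\<exists>r>0. Rd_box d x r \<subseteq> U \<and> (\<forall>y\<in>Rd_box d x r. \<bar>F y - F x\<bar> < \<epsilon>)"
proof -
  have sub: "U \<subseteq> topspace (Rd_top d)" using U by (rule openin_subset)
  have "openin (subtopology (Rd_top d) U) {y \<in> topspace (subtopology (Rd_top d) U). F y \<in> ball (F x) \<epsilon>}"
    using F unfolding continuous_in_def by (rule openin_continuous_map_preimage) auto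
  moreover have "topspace (subtopology (Rd_top d) U) = U" using sub by (rule topspace_subtopology_subset)
  ultimately have "openin (subtopology (Rd_top d) U) {y \<in> U. F y \<in> ball (F x) \<epsilon>}" by (simp only:)
  then have "openin (Rd_top d) {y \<in> U. F y \<in> ball (F x) \<epsilon>}" using U by (rule openin_trans_full)
  moreover have "x \<in> {y \<in> U. F y \<in> ball (F x) \<epsilon>}" using x e by simp
  ultimately obtain r where r: "r > 0" "Rd_box d x r \<subseteq> {y \<in> U. F y \<in> ball (F x) \<epsilon>}"
    unfolding openin_Rd_top by meson
  have "\<bar>F y - F x\<bar> < \<epsilon>" if "y \<in> Rd_box d x r" for y
  proof -
    have "y \<in> {y \<in> U. F y \<in> ball (F x) \<epsilon>}" using that r(2) by (rule subsetD[rotated])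
    then show ?thesis by (simp add: dist_real_def abs_minus_commute)
  qed
  moreover have "Rd_box d x r \<subseteq> U" using r(2) by (rule order_trans) simp
  ultimately show ?thesis using r(1) by meson
qed

lemma partial_has_derivative:
  assumes "has_partials_on d U F" "x(i := s) \<in> U" "i < d"
  shows "((\<lambda>s. F (x(i := s))) has_real_derivative partial i F (x(i := s))) (at s)"
proof -
  have "(\<lambda>s'. F ((x(i := s))(i := s'))) field_differentiable (at ((x(i := s)) i))"
    using assms unfolding has_partials_on_def by meson
  then have "(\<lambda>s'. F (x(i := s'))) field_differentiable (at s)" by simp
  then show ?thesis unfolding partial_def by (simp add: DERIV_deriv_iff_field_differentiable)
qed

text \<open>The mean value theorem along one coordinate; convexity of the cube keeps the
  intermediate point inside it.\<close>

lemma partial_increment: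
  assumes U: "openin (Rd_top d) U" and F: "has_partials_on d U F"
    and box: "Rd_box d z r \<subseteq> U" and y: "y \<in> Rd_box d z r" "y(k := y k + h) \<in> Rd_box d z r" and k: "k < d"
  shows "\<exists>\<xi>\<in>Rd_box d z r. F (y(k := y k + h)) - F y = h * partial k F \<xi>"
proof -
  define q where "q \<tau> = y(k := y k + \<tau> * h)" for \<tau>
  have q: "q \<tau> \<in> Rd_box d z r" if t: "0 \<le> \<tau>" "\<tau> \<le> 1" for \<tau>
  proof -
    have "\<bar>y k + h - z k\<bar> < r" "\<bar>y k - z k\<bar> < r" using y k by (auto simp: Rd_box_def dest: spec[of _ k])
    then have "\<tau> * \<bar>y k + h - z k\<bar> + (1 - \<tau>) * \<bar>y k - z k\<bar> < r"
      using t by (intro convex_bound_lt) auto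
    moreover have "y k + \<tau> * h - z k = \<tau> * (y k + h - z k) + (1 - \<tau>) * (y k - z k)" by (simp add: algebra_simps)
    moreover have "\<bar>\<tau> * (y k + h - z k) + (1 - \<tau>) * (y k - z k)\<bar> \<le> \<tau> * \<bar>y k + h - z k\<bar> + (1 - \<tau>) * \<bar>y k - z k\<bar>"
      using t abs_triangle_ineq[of "\<tau> * (y k + h - z k)" "(1 - \<tau>) * (y k - z k)"] by (simp add: abs_mult)
    ultimately have "\<bar>y k + \<tau> * h - z k\<bar> < r" by simp
    moreover have "q \<tau> \<in> Rd d" using y k by (auto simp: q_def Rd_box_def Rd_def PiE_iff extensional_def)
    ultimately show ?thesis using y(1) by (simp add: Rd_box_def q_def)
  qed
  have "\<exists>\<tau>>0. \<tau> < 1 \<and> F (q 1) - F (q 0) = (1 - 0) * (partial k F (q \<tau>) * h)"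
  proof (rule MVT2)
    fix \<tau> :: real assume "0 \<le> \<tau>" "\<tau> \<le> 1"
    then have "q \<tau> \<in> U" using q box by auto
    then have "((\<lambda>s. F (y(k := s))) has_real_derivative partial k F (q \<tau>)) (at (y k + \<tau> * h))"
      unfolding q_def by (intro partial_has_derivative[OF F]) (use k in auto)
    moreover have "((\<lambda>\<tau>. y k + \<tau> * h) has_real_derivative h) (at \<tau>)" by (auto intro!: derivative_eq_intros)
    ultimately show "((\<lambda>\<tau>. F (q \<tau>)) has_real_derivative partial k F (q \<tau>) * h) (at \<tau>)"
      unfolding q_def by (rule DERIV_chain2)
  qed simp
  then obtain \<tau> where t: "0 < \<tau>" "\<tau> < 1" "F (q 1) - F (q 0) = partial k F (q \<tau>) * h" by auto
  then show ?thesis using q[of \<tau>] by (intro bexI[of _ "q \<tau>"]) (auto simp: q_def mult.commute)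
qed

text \<open>The classical argument that continuous partial derivatives give differentiability: the
  increment is split into coordinate steps, each evaluated at a point near \<open>z\<close>.\<close>

lemma directional_derivative_at_0:
  assumes U: "openin (Rd_top d) U" and F: "has_partials_on d U F"
    and cont: "\<And>i. i < d \<Longrightarrow> continuous_in d U (partial i F)" and z: "z \<in> U"
  shows "((\<lambda>h. F (lincomb d 1 z h w)) has_real_derivative (\<Sum>i<d. partial i F z * w i)) (at 0)"
  unfolding DERIV_def
proof (rule LIM_I)
  fix \<epsilon> :: real assume e: "0 < \<epsilon>"
  \<comment> \<open>The summand 1 makes \<open>W\<close> positive even for w = 0 and leaves the
    total error (W - 1) * (\<epsilon> / W) strictly below \<epsilon>.\<close>
  define W where "W = 1 + (\<Sum>i<d. \<bar>w i\<bar>)"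
  have W: "W > 0" "\<And>i. i < d \<Longrightarrow> \<bar>w i\<bar> < W"
  proof -
    show "W > 0" unfolding W_def by (intro add_pos_nonneg sum_nonneg) auto
    show "\<bar>w i\<bar> < W" if "i < d" for i
      using member_le_sum[of i "{..<d}" "\<lambda>i. \<bar>w i\<bar>"] that by (simp add: W_def)
  qed
  have "\<forall>i\<in>{..<d}. \<exists>r>0. \<forall>y\<in>Rd_box d z r. \<bar>partial i F y - partial i F z\<bar> < \<epsilon> / W"
  proof
    fix i assume "i \<in> {..<d}"
    then show "\<exists>r>0. \<forall>y\<in>Rd_box d z r. \<bar>partial i F y - partial i F z\<bar> < \<epsilon> / W"
      using continuous_inD[OF cont U z, of i "\<epsilon> / W"] e W(1) by auto
  qed
  then obtain r where r: "\<And>i. i < d \<Longrightarrow> r i > 0"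
    "\<And>i y. i < d \<Longrightarrow> y \<in> Rd_box d z (r i) \<Longrightarrow> \<bar>partial i F y - partial i F z\<bar> < \<epsilon> / W"
    by (metis lessThan_iff)
  obtain r0 where r0: "r0 > 0" "Rd_box d z r0 \<subseteq> U" using U z unfolding openin_Rd_top by meson
  define \<rho> where "\<rho> = Min (insert r0 (r ` {..<d}))"
  have \<rho>: "\<rho> > 0" "\<rho> \<le> r0" "\<And>i. i < d \<Longrightarrow> \<rho> \<le> r i"
    unfolding \<rho>_def using r(1) r0(1) by (auto intro: Min_le)
  have mono: "Rd_box d z \<rho> \<subseteq> Rd_box d z s" if "\<rho> \<le> s" for s
    unfolding Rd_box_def using that by (auto intro: less_le_trans)
  have "\<bar>(F (lincomb d 1 z (0 + h) w) - F (lincomb d 1 z 0 w)) / h - (\<Sum>i<d. partial i F z * w i)\<bar> < \<epsilon>"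
    if h: "h \<noteq> 0" "\<bar>h\<bar> < \<rho> / W" for h
  proof -
    \<comment> \<open>A staircase from \<open>z\<close> to the displaced point: the first
      \<open>k\<close> coordinates have already been moved.\<close>
    define Z where "Z k = (\<lambda>i\<in>{..<d}. z i + (if i < k then h * w i else 0))" for k
    have hw: "\<bar>h * w i\<bar> < \<rho>" if "i < d" for i
    proof -
      have "\<bar>h * w i\<bar> \<le> \<bar>h\<bar> * W" using W(2)[OF that] by (simp add: abs_mult mult_left_mono)
      also have "\<dots> < \<rho>" using h(2) W(1) by (simp add: pos_less_divide_eq)
      finally show ?thesis .
    qed
    have Zbox: "Z k \<in> Rd_box d z \<rho>" for k
      using hw \<rho>(1) by (simp add: Rd_box_def Z_def Rd_def)
    have Zs: "Z (Suc k) = (Z k)(k := Z k k + h * w k)" if "k < d" for k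
      using that by (auto simp: Z_def fun_eq_iff)
    have "\<exists>\<xi>\<in>Rd_box d z \<rho>. F (Z (Suc k)) - F (Z k) = h * w k * partial k F \<xi>" if "k < d" for k
      unfolding Zs[OF that]
      by (rule partial_increment[OF U F _ Zbox _ that])
         (use mono[OF \<rho>(2)] r0(2) Zbox[of "Suc k"] Zs[OF that] in auto)
    then obtain \<xi> where \<xi>: "\<And>k. k < d \<Longrightarrow> \<xi> k \<in> Rd_box d z \<rho>"
      "\<And>k. k < d \<Longrightarrow> F (Z (Suc k)) - F (Z k) = h * w k * partial k F (\<xi> k)" by metis
    have Z0: "Z 0 = lincomb d 1 z 0 w" "Z d = lincomb d 1 z (0 + h) w"
      by (auto simp: Z_def lincomb_def fun_eq_iff)
    have "F (Z d) - F (Z 0) = (\<Sum>k<d. F (Z (Suc k)) - F (Z k))"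
      by (rule sum_lessThan_telescope[symmetric])
    also have "\<dots> = (\<Sum>k<d. h * (w k * partial k F (\<xi> k)))"
      by (intro sum.cong refl) (simp add: \<xi>(2) mult.assoc)
    also have "\<dots> = h * (\<Sum>k<d. w k * partial k F (\<xi> k))" by (simp add: sum_distrib_left)
    finally have "(F (lincomb d 1 z (0 + h) w) - F (lincomb d 1 z 0 w)) / h - (\<Sum>i<d. partial i F z * w i) =
        (\<Sum>k<d. w k * (partial k F (\<xi> k) - partial k F z))"
      using h(1) unfolding Z0 by (simp add: sum_subtractf[symmetric] right_diff_distrib mult.commute)
    also have "\<bar>\<dots>\<bar> \<le> (\<Sum>k<d. \<bar>w k\<bar> * (\<epsilon> / W))"
    proof (rule order_trans[OF sum_abs sum_mono])
      fix k assume "k \<in> {..<d}"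
      then have k: "k < d" by simp
      have "\<bar>partial k F (\<xi> k) - partial k F z\<bar> < \<epsilon> / W"
        using r(2)[OF k] mono[OF \<rho>(3)[OF k]] \<xi>(1)[OF k] by auto
      then show "\<bar>w k * (partial k F (\<xi> k) - partial k F z)\<bar> \<le> \<bar>w k\<bar> * (\<epsilon> / W)"
        unfolding abs_mult by (intro mult_left_mono) auto
    qed
    also have "\<dots> = (W - 1) * (\<epsilon> / W)" unfolding sum_distrib_right[symmetric] by (simp add: W_def)
    also have "\<dots> < \<epsilon>" using W(1) e by (simp add: field_simps)
    finally show ?thesis .
  qed
  then show "\<exists>s>0. \<forall>h. h \<noteq> 0 \<and> norm (h - 0) < s \<longrightarrow>
      norm ((F (lincomb d 1 z (0 + h) w) - F (lincomb d 1 z 0 w)) / h - (\<Sum>i<d. partial i F z * w i)) < \<epsilon>"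
    using \<rho>(1) W(1) by (intro exI[of _ "\<rho> / W"]) simp
qed

lemma directional_derivative:
  assumes U: "openin (Rd_top d) U" and F: "has_partials_on d U F"
    and cont: "\<And>i. i < d \<Longrightarrow> continuous_in d U (partial i F)" and z: "lincomb d 1 x t w \<in> U"
  shows "((\<lambda>t. F (lincomb d 1 x t w)) has_real_derivative (\<Sum>i<d. partial i F (lincomb d 1 x t w) * w i)) (at t)"
proof -
  have eq: "lincomb d 1 (lincomb d 1 x t w) h w = lincomb d 1 x (h + t) w" for h
    by (auto simp: lincomb_def fun_eq_iff algebra_simps)
  have "((\<lambda>h. F (lincomb d 1 x (h + t) w)) has_real_derivative (\<Sum>i<d. partial i F (lincomb d 1 x t w) * w i)) (at 0)"
    using directional_derivative_at_0[OF U F cont z, of w] unfolding eq .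
  then show ?thesis
    using DERIV_shift[of "\<lambda>t. F (lincomb d 1 x t w)" _ 0 t] by simp
qed

lemma lincomb_one_zero:
  assumes "x \<in> Rd d"
  shows "lincomb d 1 x 0 y = x" "lincomb d 0 y 1 x = x"
  using assms unfolding Rd_def lincomb_def by (simp_all add: PiE_restrict)

text \<open>Along the segment, subtracting (A / 2) t^2 with A = \<alpha> |x - y|^2 leaves a convex
  function. At t = 1/2 the subtracted term is A / 8 against a mean of A / 4 at the ends, whence the
  gain \<alpha> / 8.\<close>

lemma strongly_convex_midpoint:
  assumes U: "openin (Rd_top d) U" "\<And>x y t. x \<in> U \<Longrightarrow> y \<in> U \<Longrightarrow> t \<in> {0..1} \<Longrightarrow> lincomb d (1 - t) x t y \<in> U"
    and F: "C2_on d U F"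
    and hess: "\<And>x w. x \<in> U \<Longrightarrow> (\<Sum>i<d. \<Sum>j<d. partial j (partial i F) x * w i * w j) \<ge> \<alpha> * (\<Sum>i<d. (w i)\<^sup>2)"
    and xy: "x \<in> U" "y \<in> U"
  shows "F (lincomb d (1/2) x (1/2) y) \<le> (F x + F y) / 2 - \<alpha> / 8 * (\<Sum>i<d. (x i - y i)\<^sup>2)"
proof -
  define w where "w i = y i - x i" for i
  define A where "A = \<alpha> * (\<Sum>i<d. (w i)\<^sup>2)"
  define q where "q t = lincomb d 1 x t w" for t
  have q: "q t = lincomb d (1 - t) x t y" for t
    by (auto simp: q_def w_def lincomb_def fun_eq_iff algebra_simps)
  have qU: "q t \<in> U" if "t \<in> {0..1}" for t unfolding q using U(2) xy that by simp
  have xR: "x \<in> Rd d" "y \<in> Rd d" using U(1) xy unfolding openin_Rd_top by auto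
  have q01: "q 0 = x" "q 1 = y" unfolding q using lincomb_one_zero xR by simp_all
  have qh: "q (1/2) = lincomb d (1/2) x (1/2) y" unfolding q by simp
  have P: "has_partials_on d U F" "\<And>i. i < d \<Longrightarrow> continuous_in d U (partial i F)"
    "\<And>i. i < d \<Longrightarrow> has_partials_on d U (partial i F)" "\<And>i j. i < d \<Longrightarrow> j < d \<Longrightarrow> continuous_in d U (partial j (partial i F))"
    using F unfolding C2_on_def by auto
  define f1 where "f1 t = (\<Sum>i<d. partial i F (q t) * w i)" for t
  define f2 where "f2 t = (\<Sum>i<d. (\<Sum>j<d. partial j (partial i F) (q t) * w j) * w i)" for t
  have d1: "((\<lambda>t. F (q t)) has_real_derivative f1 t) (at t)" if "t \<in> {0..1}" for t
    unfolding f1_def q_def by (rule directional_derivative[OF U(1) P(1,2)]) (use qU[OF that] in \<open>auto simp: q_def\<close>)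
  have d2: "(f1 has_real_derivative f2 t) (at t)" if "t \<in> {0..1}" for t
    unfolding f1_def f2_def q_def
    by (intro DERIV_sum DERIV_cmult_right directional_derivative[OF U(1) P(3,4)])
       (use qU[OF that] in \<open>auto simp: q_def\<close>)
  have h: "A \<le> f2 t" if "t \<in> {0..1}" for t
  proof -
    have "f2 t = (\<Sum>i<d. \<Sum>j<d. partial j (partial i F) (q t) * w i * w j)"
      unfolding f2_def sum_distrib_right by (intro sum.cong refl) simp
    then show ?thesis using hess[OF qU[OF that], of w] unfolding A_def by simp
  qed
  have "convex_on {0..1} (\<lambda>t. F (q t) - A / 2 * t\<^sup>2)"
  proof (rule f''_ge0_imp_convex)
    show "((\<lambda>t. F (q t) - A / 2 * t\<^sup>2) has_real_derivative f1 t - A * t) (at t)" if "t \<in> {0..1}" for t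
    proof (rule DERIV_diff[OF d1[OF that]])
      show "((\<lambda>t. A / 2 * t\<^sup>2) has_real_derivative A * t) (at t)" by (auto intro!: derivative_eq_intros)
    qed
    show "((\<lambda>t. f1 t - A * t) has_real_derivative f2 t - A) (at t)" if "t \<in> {0..1}" for t
    proof (rule DERIV_diff[OF d2[OF that]])
      show "((\<lambda>t. A * t) has_real_derivative A) (at t)" by (auto intro!: derivative_eq_intros)
    qed
    show "0 \<le> f2 t - A" if "t \<in> {0..1}" for t using h[OF that] by simp
  qed simp
  from convex_onD[OF this, of "1/2" 0 1]
  have "F (q (1/2)) \<le> (F (q 0) + F (q 1)) / 2 - A / 8"
    by (simp add: power2_eq_square field_simps)
  moreover have "(\<Sum>i<d. (w i)\<^sup>2) = (\<Sum>i<d. (x i - y i)\<^sup>2)" unfolding w_def by (simp add: power2_commute)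
  ultimately show ?thesis unfolding q01 qh A_def by simp
qed

section \<open>From the potential to the density\<close>

lemma Rd_norm_lincomb: "Rd_norm d (lincomb d r x s y) = L2_set (\<lambda>i. r * x i + s * y i) {..<d}"
  unfolding Rd_norm_def lincomb_def by (intro L2_set_cong) auto

lemma Rd_dist_mid:
  "Rd_norm d (lincomb d 1 x (-1) (lincomb d (1/2) x (1/2) y)) = Rd_norm d (lincomb d 1 x (-1) y) / 2"
  "Rd_norm d (lincomb d 1 y (-1) (lincomb d (1/2) x (1/2) y)) = Rd_norm d (lincomb d 1 x (-1) y) / 2"
proof -
  have 1: "L2_set (\<lambda>i. (x i - y i) / 2) {..<d} = L2_set (\<lambda>i. x i - y i) {..<d} / 2"
    using L2_set_right_distrib[of "1/2" "\<lambda>i. x i - y i" "{..<d}"] by simp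
  have 2: "L2_set (\<lambda>i. (y i - x i) / 2) {..<d} = L2_set (\<lambda>i. (x i - y i) / 2) {..<d}"
    unfolding L2_set_def by (simp add: power_divide power2_commute)
  have "L2_set (\<lambda>i. 1 * x i + - 1 * lincomb d (1/2) x (1/2) y i) {..<d} = L2_set (\<lambda>i. (x i - y i) / 2) {..<d}"
    by (intro L2_set_cong) (auto simp: lincomb_def field_simps)
  moreover have "L2_set (\<lambda>i. 1 * y i + - 1 * lincomb d (1/2) x (1/2) y i) {..<d} = L2_set (\<lambda>i. (y i - x i) / 2) {..<d}"
    by (intro L2_set_cong) (auto simp: lincomb_def field_simps)
  ultimately show "Rd_norm d (lincomb d 1 x (-1) (lincomb d (1/2) x (1/2) y)) = Rd_norm d (lincomb d 1 x (-1) y) / 2"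
    "Rd_norm d (lincomb d 1 y (-1) (lincomb d (1/2) x (1/2) y)) = Rd_norm d (lincomb d 1 x (-1) y) / 2"
    unfolding Rd_norm_lincomb using 1 2 by simp_all
qed

lemma Rd_norm_diff_sq: "(Rd_norm d (lincomb d 1 x (-1) y))\<^sup>2 = (\<Sum>i<d. (x i - y i)\<^sup>2)"
  unfolding Rd_norm_lincomb L2_set_def by (simp add: sum_nonneg)

text \<open>A convex function can jump at the boundary of its domain, so the strong midpoint convexity of the
  potential is only available on the interior \<open>U\<close> of the support, which carries all the mass.\<close>

theorem weakly_log_concave_midpoint:
  assumes p: "weakly_log_concave d \<alpha> \<beta> K p"
  shows "\<exists>U. U \<in> sets (Rd_lborel d) \<and> U \<subseteq> Rd d \<and> (AE x in Rd_lborel d. x \<notin> U \<longrightarrow> p x = 0) \<and>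
    (\<forall>x\<in>U. \<forall>y\<in>U. lincomb d (1/2) x (1/2) y \<in> U \<and>
      p x * p y \<le> (p (lincomb d (1/2) x (1/2) y))\<^sup>2 *
        exp (- (\<alpha> / 4) * (Rd_norm d (lincomb d 1 x (-1) y))\<^sup>2 + 2 * K * (Rd_norm d (lincomb d 1 x (-1) y) / 2) powr \<beta>))"
proof -
  have pd: "prob_density d p" using p unfolding weakly_log_concave_def by (rule conjunct1)
  obtain u a where A: "(\<forall>x\<in>Rd d. u x \<noteq> -\<infinity>) \<and>
    (\<forall>x\<in>Rd d. p x = (if u x = \<infinity> then 0 else exp (- real_of_ereal (u x) + a x))) \<and>
    Rd_convex d u \<and> (\<forall>x\<in>support_interior d p. u x \<noteq> \<infinity>) \<and>
    C2_on d (support_interior d p) (\<lambda>x. real_of_ereal (u x)) \<and>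
    (\<forall>x\<in>support_interior d p. \<forall>w :: nat \<Rightarrow> real.
       (\<Sum>i<d. \<Sum>j<d. partial j (partial i (\<lambda>x. real_of_ereal (u x))) x * w i * w j) \<ge> \<alpha> * (\<Sum>i<d. (w i)\<^sup>2)) \<and>
    (\<forall>x\<in>Rd d. \<forall>y\<in>Rd d. \<bar>a x - a y\<bar> \<le> K * Rd_norm d (lincomb d 1 x (-1) y) powr \<beta>)"
    using p[unfolded weakly_log_concave_def, THEN conjunct2] by (elim exE) (rule that)
  note u = A[THEN conjunct1, rule_format] A[THEN conjunct2, THEN conjunct1, rule_format]
    A[THEN conjunct2, THEN conjunct2, THEN conjunct1]
    A[THEN conjunct2, THEN conjunct2, THEN conjunct2, THEN conjunct1, rule_format]
    A[THEN conjunct2, THEN conjunct2, THEN conjunct2, THEN conjunct2, THEN conjunct1]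
    A[THEN conjunct2, THEN conjunct2, THEN conjunct2, THEN conjunct2, THEN conjunct2, THEN conjunct1, rule_format]
    A[THEN conjunct2, THEN conjunct2, THEN conjunct2, THEN conjunct2, THEN conjunct2, THEN conjunct2, rule_format]
  define D where "D = {x \<in> Rd d. p x \<noteq> 0}"
  define U where "U = support_interior d p"
  have pm: "p \<in> borel_measurable (Rd_lborel d)" using pd unfolding prob_density_def by (rule conjunct1)
  have Dm: "D \<in> sets (Rd_lborel d)"
  proof -
    have "p -` (- {0}) \<inter> space (Rd_lborel d) \<in> sets (Rd_lborel d)"
      by (rule measurable_sets[OF pm]) auto
    also have "p -` (- {0}) \<inter> space (Rd_lborel d) = D" by (auto simp: D_def)
    finally show ?thesis .
  qed
  have Du: "x \<in> D \<longleftrightarrow> x \<in> Rd d \<and> u x \<noteq> \<infinity>" for x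
    using u(2)[of x] by (auto simp: D_def)
  have Dc: "convex_Rd d D"
    unfolding convex_Rd_def
  proof (intro conjI ballI)
    fix x y and r :: real assume x: "x \<in> D" and y: "y \<in> D" and r: "r \<in> {0..1}"
    have xy: "x \<in> Rd d" "y \<in> Rd d" using x y by (auto simp: Du)
    obtain ux where ux: "u x = ereal ux" using x u(1)[OF xy(1)] by (cases "u x") (auto simp: Du)
    obtain uy where uy: "u y = ereal uy" using y u(1)[OF xy(2)] by (cases "u y") (auto simp: Du)
    have "u (lincomb d r x (1 - r) y) \<le> ereal r * u x + ereal (1 - r) * u y"
      using u(3) xy r unfolding Rd_convex_def by blast
    then have "u (lincomb d r x (1 - r) y) \<noteq> \<infinity>" unfolding ux uy by auto
    then show "lincomb d r x (1 - r) y \<in> D" by (simp add: Du)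
  qed (auto simp: D_def)
  have Uo: "openin (Rd_top d) U" unfolding U_def support_interior_def by (rule openin_interior_of)
  have UR: "U \<subseteq> Rd d" using Uo unfolding openin_Rd_top by simp
  \<comment> \<open>\<open>U\<close> is the interior of a closure and could a priori exceed
    \<open>D\<close>. Finiteness of \<open>u\<close> on it excludes this, so with the maximality
    shown next \<open>U\<close> is the interior of \<open>D\<close>.\<close>
  have UD: "U \<subseteq> D" using u(4) UR unfolding U_def by (auto simp: Du)
  have Umax: "W \<subseteq> U" if "openin (Rd_top d) W" "W \<subseteq> D" for W
    unfolding U_def support_interior_def
  proof (rule interior_of_maximal[OF _ that(1)])
    have "D \<subseteq> topspace (Rd_top d)" by (auto simp: D_def Rd_top_def Rd_def)
    then have "D \<subseteq> Rd_top d closure_of D" by (rule closure_of_subset)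
    then show "W \<subseteq> Rd_top d closure_of {x \<in> Rd d. p x \<noteq> 0}" using that(2) unfolding D_def by simp
  qed
  have null: "D - U \<in> null_sets (Rd_lborel d)" by (rule convex_diff_interior_null[OF Dm Dc Uo UD Umax])
  \<comment> \<open>The cube about \<open>y\<close>, shrunk by the factor \<open>t\<close>, follows
    the point along the segment. At t = 0 it degenerates, hence the case distinction.\<close>
  have Uc: "lincomb d (1 - t) x t y \<in> U" if xy: "x \<in> U" "y \<in> U" and t: "t \<in> {0..1}" for x y t
  proof (cases "t = 0")
    case True
    then show ?thesis using lincomb_one_zero(1)[of x d y] xy UR by auto
  next
    case False
    obtain r where r: "r > 0" "Rd_box d y r \<subseteq> U" using Uo xy(2) unfolding openin_Rd_top by meson
    have "Rd_box d (lincomb d (1 - t) x (1 - (1 - t)) y) ((1 - (1 - t)) * r) \<subseteq> D"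
      by (rule Rd_box_segment[OF Dc]) (use xy UD r t False in auto)
    then have "Rd_box d (lincomb d (1 - t) x t y) (t * r) \<subseteq> U"
      by (intro Umax openin_Rd_top_box) simp
    moreover have "lincomb d (1 - t) x t y \<in> Rd_box d (lincomb d (1 - t) x t y) (t * r)"
      using r(1) t False by (simp add: Rd_box_def)
    ultimately show ?thesis by (rule subsetD)
  qed
  have "AE x in Rd_lborel d. x \<notin> U \<longrightarrow> p x = 0"
  proof (rule AE_I')
    show "D - U \<in> null_sets (Rd_lborel d)" by (rule null)
  qed (auto simp: D_def)
  moreover have "lincomb d (1/2) x (1/2) y \<in> U \<and>
      p x * p y \<le> (p (lincomb d (1/2) x (1/2) y))\<^sup>2 *
        exp (- (\<alpha> / 4) * (Rd_norm d (lincomb d 1 x (-1) y))\<^sup>2 + 2 * K * (Rd_norm d (lincomb d 1 x (-1) y) / 2) powr \<beta>)"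
    if xy: "x \<in> U" "y \<in> U" for x y
  proof -
    define m where "m = lincomb d (1/2) x (1/2) y"
    define r where "r = Rd_norm d (lincomb d 1 x (-1) y)"
    have mU: "m \<in> U" using Uc[OF xy, of "1/2"] by (simp add: m_def)
    have R: "x \<in> Rd d" "y \<in> Rd d" "m \<in> Rd d" using xy mU UR by auto
    have pe: "p z = exp (- real_of_ereal (u z) + a z)" if "z \<in> U" for z
      using u(2)[of z] u(4)[of z] that UR unfolding U_def by auto
    have "real_of_ereal (u m) \<le> (real_of_ereal (u x) + real_of_ereal (u y)) / 2 - \<alpha> / 8 * (\<Sum>i<d. (x i - y i)\<^sup>2)"
      unfolding m_def
      by (rule strongly_convex_midpoint[OF Uo Uc u(5)[folded U_def] u(6)[folded U_def] xy])
    then have 1: "real_of_ereal (u m) \<le> (real_of_ereal (u x) + real_of_ereal (u y)) / 2 - \<alpha> / 8 * r\<^sup>2"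
      unfolding r_def Rd_norm_diff_sq .
    have 2: "\<bar>a x - a m\<bar> \<le> K * (r / 2) powr \<beta>" "\<bar>a y - a m\<bar> \<le> K * (r / 2) powr \<beta>"
      using u(7)[OF R(1,3)] u(7)[OF R(2,3)] unfolding m_def r_def Rd_dist_mid by simp_all
    \<comment> \<open>The midpoint counts twice: its convexity gain \<alpha> / 8 doubles to \<alpha>
      / 4, and each endpoint is compared with it at distance r / 2, at a cost of one Hoelder
      term.\<close>
    have "- real_of_ereal (u x) + a x + (- real_of_ereal (u y) + a y) \<le>
      2 * (- real_of_ereal (u m) + a m) + (- (\<alpha> / 4) * r\<^sup>2 + 2 * K * (r / 2) powr \<beta>)"
    proof -
      define Q where "Q = \<alpha> * r\<^sup>2"
      define E where "E = K * (r / 2) powr \<beta>"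
      have eqs: "\<alpha> / 8 * r\<^sup>2 = Q / 8" "- (\<alpha> / 4) * r\<^sup>2 = - (Q / 4)" "2 * K * (r / 2) powr \<beta> = 2 * E"
        by (simp_all add: Q_def E_def)
      have gen: "- u1 + a1 + (- u2 + a2) \<le> 2 * (- u3 + a3) + (- (Q / 4) + 2 * E)"
        if "u3 \<le> (u1 + u2) / 2 - Q / 8" "a1 - a3 \<le> E" "a2 - a3 \<le> E" for u1 u2 u3 a1 a2 a3 :: real
      proof -
        have "8 * u3 \<le> 4 * (u1 + u2) - Q" using that(1) by (simp add: field_simps)
        then show ?thesis using that(2,3) by (simp add: field_simps)
      qed
      have "a x - a m \<le> E" "a y - a m \<le> E"
        using abs_le_D1[OF 2(1)] abs_le_D1[OF 2(2)] by (simp_all only: E_def)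
      with 1 show ?thesis unfolding eqs by (rule gen)
    qed
    then have "exp (- real_of_ereal (u x) + a x + (- real_of_ereal (u y) + a y)) \<le>
      exp (2 * (- real_of_ereal (u m) + a m) + (- (\<alpha> / 4) * r\<^sup>2 + 2 * K * (r / 2) powr \<beta>))" by simp
    then have "p x * p y \<le> (p m)\<^sup>2 * exp (- (\<alpha> / 4) * r\<^sup>2 + 2 * K * (r / 2) powr \<beta>)"
      unfolding pe[OF xy(1)] pe[OF xy(2)] pe[OF mU] power2_eq_square exp_add[symmetric] by simp
    then show ?thesis using mU unfolding m_def r_def by simp
  qed
  ultimately show ?thesis using UR sets_openin_Rd_top[OF Uo] by (intro exI[of _ U]) blast
qed

section \<open>Exponential moments\<close>

lemma abs_exp_minus_taylor: "\<bar>exp x - 1 - x\<bar> \<le> x\<^sup>2 * exp \<bar>x\<bar>" for x :: real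
proof -
  obtain t where t: "\<bar>t\<bar> \<le> \<bar>x\<bar>" "exp x = (\<Sum>m<2. x ^ m / fact m) + exp t / fact 2 * x ^ 2"
    using Maclaurin_exp_le[of x 2] by (elim exE conjE)
  have "exp x - 1 - x = exp t / 2 * x\<^sup>2" using t(2) by (simp add: numeral_2_eq_2)
  then have "\<bar>exp x - 1 - x\<bar> = exp t / 2 * x\<^sup>2" by (simp only:) (simp add: abs_mult)
  also have "\<dots> \<le> exp \<bar>x\<bar> * x\<^sup>2" 
  proof (rule mult_right_mono)
    have "exp t \<le> exp \<bar>x\<bar>" using t(1) by simp
    then show "exp t / 2 \<le> exp \<bar>x\<bar>" using exp_gt_zero[of "\<bar>x\<bar>"] by linarith
  qed simp
  finally show ?thesis by (simp only: mult.commute)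
qed

lemma abs_le_exp_add: "\<bar>x\<bar> \<le> exp x + exp (- x)" for x :: real
  using exp_ge_add_one_self[of x] exp_ge_add_one_self[of "-x"] exp_gt_zero[of x] exp_gt_zero[of "-x"]
  by (intro abs_leI) linarith+

lemma exp_abs_le_exp_add: "exp \<bar>x\<bar> \<le> exp x + exp (- x)" for x :: real
  by (cases "x < 0") simp_all

lemma square_le_exp_abs: "x\<^sup>2 \<le> 2 * exp \<bar>x\<bar>" for x :: real
proof -
  have "1 + \<bar>x\<bar> + \<bar>x\<bar>\<^sup>2 / 2 \<le> exp \<bar>x\<bar>" by (rule exp_lower_Taylor_quadratic) simp
  then show ?thesis by simp
qed

text \<open>Taylor expansion to order 4: the odd terms cancel and both remainders are
  nonnegative.\<close>

lemma cosh_lower_bound: "2 + x\<^sup>2 \<le> exp x + exp (- x)" for x :: real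
proof -
  obtain t where t: "exp x = (\<Sum>m<4. x ^ m / fact m) + exp t / fact 4 * x ^ 4"
    using Maclaurin_exp_le[of x 4] by (elim exE conjE)
  obtain s where s: "exp (- x) = (\<Sum>m<4. (- x) ^ m / fact m) + exp s / fact 4 * (- x) ^ 4"
    using Maclaurin_exp_le[of "- x" 4] by (elim exE conjE)
  have "0 \<le> exp t / fact 4 * x ^ 4" "0 \<le> exp s / fact 4 * (- x) ^ 4" by simp_all
  moreover have "(\<Sum>m<4. x ^ m / fact m) + (\<Sum>m<4. (- x) ^ m / fact m) = 2 + x\<^sup>2"
    by (simp add: numeral_eq_Suc power2_eq_square)
  ultimately show ?thesis unfolding t s by linarith
qed

text \<open>Factors \<open>X\<close> and \<open>X^2 exp |X|\<close> are absorbed by moving the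
  exponent \<open>r\<close> by 1 or by 2 in both directions, since all exponents are
  allowed.\<close>

lemma integrable_exp_moment:
  fixes h X :: "'a \<Rightarrow> real"
  assumes [measurable]: "h \<in> borel_measurable M" "X \<in> borel_measurable M"
    and int: "\<And>r. integrable M (\<lambda>y. h y * exp (r * X y))"
  shows "integrable M (\<lambda>y. h y * X y * exp (r * X y))"
    "integrable M (\<lambda>y. \<bar>h y\<bar> * (X y)\<^sup>2 * exp (\<bar>X y\<bar>) * exp (r * X y))"
proof -
  have i: "integrable M (\<lambda>y. \<bar>h y\<bar> * exp (r * X y))" for r
    using integrable_abs[OF int[of r]] by (simp add: abs_mult)
  show "integrable M (\<lambda>y. h y * X y * exp (r * X y))"
  proof (rule Bochner_Integration.integrable_bound)
    show "integrable M (\<lambda>y. \<bar>h y\<bar> * exp ((r + 1) * X y) + \<bar>h y\<bar> * exp ((r - 1) * X y))"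
      by (intro Bochner_Integration.integrable_add i)
    show "AE y in M. norm (h y * X y * exp (r * X y)) \<le> norm (\<bar>h y\<bar> * exp ((r + 1) * X y) + \<bar>h y\<bar> * exp ((r - 1) * X y))"
    proof (rule AE_I2)
      fix y
      have "\<bar>h y\<bar> * exp (r * X y) * \<bar>X y\<bar> \<le> \<bar>h y\<bar> * exp (r * X y) * (exp (X y) + exp (- X y))"
        by (intro mult_left_mono abs_le_exp_add) simp
      also have "\<dots> = \<bar>h y\<bar> * exp ((r + 1) * X y) + \<bar>h y\<bar> * exp ((r - 1) * X y)"
        by (simp add: exp_add[symmetric] exp_minus[symmetric] distrib_left distrib_right left_diff_distrib mult.assoc)
      finally show "norm (h y * X y * exp (r * X y)) \<le> norm (\<bar>h y\<bar> * exp ((r + 1) * X y) + \<bar>h y\<bar> * exp ((r - 1) * X y))"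
        by (simp add: abs_mult mult.assoc mult.commute mult.left_commute)
    qed
  qed measurable
  show "integrable M (\<lambda>y. \<bar>h y\<bar> * (X y)\<^sup>2 * exp (\<bar>X y\<bar>) * exp (r * X y))"
  proof (rule Bochner_Integration.integrable_bound)
    show "integrable M (\<lambda>y. 2 * (\<bar>h y\<bar> * exp ((r + 2) * X y) + \<bar>h y\<bar> * exp ((r - 2) * X y)))"
      by (intro integrable_mult_right Bochner_Integration.integrable_add i)
    show "AE y in M. norm (\<bar>h y\<bar> * (X y)\<^sup>2 * exp (\<bar>X y\<bar>) * exp (r * X y)) \<le>
        norm (2 * (\<bar>h y\<bar> * exp ((r + 2) * X y) + \<bar>h y\<bar> * exp ((r - 2) * X y)))"
    proof (rule AE_I2)
      fix y
      have "(X y)\<^sup>2 * exp \<bar>X y\<bar> \<le> 2 * exp \<bar>X y\<bar> * exp \<bar>X y\<bar>"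
        by (intro mult_right_mono square_le_exp_abs) simp
      also have "\<dots> = 2 * exp \<bar>2 * X y\<bar>" by (simp add: exp_add[symmetric])
      also have "\<dots> \<le> 2 * (exp (2 * X y) + exp (- (2 * X y)))"
        by (intro mult_left_mono exp_abs_le_exp_add) simp
      finally have "\<bar>h y\<bar> * exp (r * X y) * ((X y)\<^sup>2 * exp \<bar>X y\<bar>) \<le> \<bar>h y\<bar> * exp (r * X y) * (2 * (exp (2 * X y) + exp (- (2 * X y))))"
        by (intro mult_left_mono) simp_all
      also have "\<dots> = 2 * (\<bar>h y\<bar> * exp ((r + 2) * X y) + \<bar>h y\<bar> * exp ((r - 2) * X y))"
      proof -
        have "exp ((r + 2) * X y) = exp (r * X y) * exp (2 * X y)"
          "exp ((r - 2) * X y) = exp (r * X y) * exp (- (2 * X y))"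
          unfolding exp_add[symmetric] by (simp_all add: algebra_simps)
        then show ?thesis by (simp add: algebra_simps)
      qed
      finally show "norm (\<bar>h y\<bar> * (X y)\<^sup>2 * exp (\<bar>X y\<bar>) * exp (r * X y)) \<le>
        norm (2 * (\<bar>h y\<bar> * exp ((r + 2) * X y) + \<bar>h y\<bar> * exp ((r - 2) * X y)))"
        by (simp add: abs_mult mult.assoc mult.commute mult.left_commute)
    qed
  qed measurable
qed

text \<open>Differentiation under the integral sign. The Taylor remainder is at most
  \<open>k^2\<close> times an integrable function, so the difference quotient errs by at most
  \<open>C\<close> times |k|.\<close>

lemma has_derivative_exp_moment:
  fixes h X :: "'a \<Rightarrow> real"
  assumes [measurable]: "h \<in> borel_measurable M" "X \<in> borel_measurable M"
    and int: "\<And>r. integrable M (\<lambda>y. h y * exp (r * X y))"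
  shows "((\<lambda>r. LINT y|M. h y * exp (r * X y)) has_real_derivative (LINT y|M. h y * X y * exp (r * X y))) (at r)"
  unfolding DERIV_def
proof (rule LIM_I)
  fix \<epsilon> :: real assume e: "0 < \<epsilon>"
  note i1 = integrable_exp_moment(1)[OF assms]
  note i2 = integrable_exp_moment(2)[OF assms]
  define C where "C = (LINT y|M. \<bar>h y\<bar> * (X y)\<^sup>2 * exp \<bar>X y\<bar> * exp (r * X y))"
  have C: "C \<ge> 0" unfolding C_def by (intro integral_nonneg_AE AE_I2) simp
  have bd: "\<bar>((LINT y|M. h y * exp ((r + k) * X y)) - (LINT y|M. h y * exp (r * X y))) / k -
      (LINT y|M. h y * X y * exp (r * X y))\<bar> \<le> \<bar>k\<bar> * C" if k: "k \<noteq> 0" "\<bar>k\<bar> < 1" for k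
  proof -
    define D where "D y = h y * exp ((r + k) * X y) - h y * exp (r * X y) - k * (h y * X y * exp (r * X y))" for y
    have Dint: "integrable M D" unfolding D_def by (intro Bochner_Integration.integrable_diff int integrable_mult_right i1)
    have Dbd: "\<bar>D y\<bar> \<le> k\<^sup>2 * (\<bar>h y\<bar> * (X y)\<^sup>2 * exp \<bar>X y\<bar> * exp (r * X y))" for y
    proof -
      have "D y = h y * exp (r * X y) * (exp (k * X y) - 1 - k * X y)"
        by (simp add: D_def exp_add distrib_right right_diff_distrib)
      then have "\<bar>D y\<bar> = \<bar>h y\<bar> * exp (r * X y) * \<bar>exp (k * X y) - 1 - k * X y\<bar>" by (simp add: abs_mult)
      also have "\<dots> \<le> \<bar>h y\<bar> * exp (r * X y) * ((k * X y)\<^sup>2 * exp \<bar>k * X y\<bar>)"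
        by (intro mult_left_mono abs_exp_minus_taylor) simp
      also have "\<dots> \<le> \<bar>h y\<bar> * exp (r * X y) * ((k * X y)\<^sup>2 * exp \<bar>X y\<bar>)"
      proof (intro mult_left_mono)
        have "\<bar>k * X y\<bar> \<le> 1 * \<bar>X y\<bar>" unfolding abs_mult using k(2) by (intro mult_right_mono) auto
        then show "exp \<bar>k * X y\<bar> \<le> exp \<bar>X y\<bar>" by simp
      qed simp_all
      also have "\<dots> = k\<^sup>2 * (\<bar>h y\<bar> * (X y)\<^sup>2 * exp \<bar>X y\<bar> * exp (r * X y))"
        by (simp add: power_mult_distrib)
      finally show ?thesis .
    qed
    have "\<bar>LINT y|M. D y\<bar> \<le> (LINT y|M. \<bar>D y\<bar>)" by (rule integral_abs_bound)
    also have "\<dots> \<le> (LINT y|M. k\<^sup>2 * (\<bar>h y\<bar> * (X y)\<^sup>2 * exp \<bar>X y\<bar> * exp (r * X y)))"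
      by (intro integral_mono integrable_abs Dint integrable_mult_right i2 Dbd)
    also have "\<dots> = k\<^sup>2 * C" unfolding C_def by simp
    finally have 1: "\<bar>LINT y|M. D y\<bar> \<le> k\<^sup>2 * C" .
    have "(LINT y|M. D y) = (LINT y|M. h y * exp ((r + k) * X y)) - (LINT y|M. h y * exp (r * X y)) - k * (LINT y|M. h y * X y * exp (r * X y))"
      unfolding D_def by (simp add: int i1 Bochner_Integration.integral_diff)
    then have "((LINT y|M. h y * exp ((r + k) * X y)) - (LINT y|M. h y * exp (r * X y))) / k - (LINT y|M. h y * X y * exp (r * X y)) = (LINT y|M. D y) / k"
      using k(1) by (simp add: diff_divide_distrib)
    also have "\<bar>\<dots>\<bar> = \<bar>LINT y|M. D y\<bar> / \<bar>k\<bar>" by (rule abs_divide)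
    also have "\<dots> \<le> k\<^sup>2 * C / \<bar>k\<bar>" using 1 by (rule divide_right_mono) simp
    also have "\<dots> = \<bar>k\<bar> * C" using k(1) by (simp add: power2_eq_square abs_if)
    finally show ?thesis .
  qed
  define s where "s = min 1 (\<epsilon> / (C + 1))"
  have "s > 0" using e C by (simp add: s_def)
  moreover have "norm (((LINT y|M. h y * exp ((r + k) * X y)) - (LINT y|M. h y * exp (r * X y))) / k -
      (LINT y|M. h y * X y * exp (r * X y))) < \<epsilon>" if k: "k \<noteq> 0 \<and> norm (k - 0) < s" for k
  proof -
    have k': "k \<noteq> 0" "\<bar>k\<bar> < 1" "\<bar>k\<bar> < \<epsilon> / (C + 1)" using k by (auto simp: s_def)
    have "\<bar>k\<bar> * C \<le> \<bar>k\<bar> * (C + 1)" by (intro mult_left_mono) auto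
    also have "\<dots> < \<epsilon>" using k'(3) C by (simp add: pos_less_divide_eq)
    finally show ?thesis using bd[OF k'(1,2)] by simp
  qed
  ultimately show "\<exists>s>0. \<forall>k. k \<noteq> 0 \<and> norm (k - 0) < s \<longrightarrow> norm (((LINT y|M. h y * exp ((r + k) * X y)) - (LINT y|M. h y * exp (r * X y))) / k -
      (LINT y|M. h y * X y * exp (r * X y))) < \<epsilon>" by blast
qed

text \<open>Symmetrizing over two independent copies turns the tilts by \<open>h\<close> and \<open>-h\<close> into a hyperbolic cosine.\<close>

lemma variance_le_exp_moments:
  fixes k X :: "'a \<Rightarrow> real"
  assumes k: "integrable M k" "\<And>y. 0 \<le> k y"
    and X: "integrable M (\<lambda>y. k y * X y)" "integrable M (\<lambda>y. k y * (X y)\<^sup>2)"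
    and E: "integrable M (\<lambda>y. k y * exp (h * X y))" "integrable M (\<lambda>y. k y * exp (- h * X y))"
  shows "(LINT y|M. k y)\<^sup>2 + h\<^sup>2 * ((LINT y|M. k y) * (LINT y|M. k y * (X y)\<^sup>2) - (LINT y|M. k y * X y)\<^sup>2)
    \<le> (LINT y|M. k y * exp (h * X y)) * (LINT y|M. k y * exp (- h * X y))"
proof -
  define Z where "Z = (LINT y|M. k y)"
  define m1 where "m1 = (LINT y|M. k y * X y)"
  define m2 where "m2 = (LINT y|M. k y * (X y)\<^sup>2)"
  define A where "A = (LINT y|M. k y * exp (h * X y))"
  define B where "B = (LINT y|M. k y * exp (- h * X y))"
  \<comment> \<open>The two copies are integrated one after the other: the second one here, with the
    value \<open>x\<close> of the first held fixed, and the first one below with \<open>X y\<close>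
    for \<open>x\<close>.\<close>
  have inner: "2 * Z + h\<^sup>2 * (x\<^sup>2 * Z - 2 * x * m1 + m2) \<le> exp (h * x) * B + exp (- h * x) * A" for x
  proof -
    have "2 * Z + h\<^sup>2 * (x\<^sup>2 * Z - 2 * x * m1 + m2) =
        (LINT y|M. 2 * k y + h\<^sup>2 * (x\<^sup>2 * k y - 2 * x * (k y * X y) + k y * (X y)\<^sup>2))"
      unfolding Z_def m1_def m2_def using k(1) X by simp
    also have "\<dots> \<le> (LINT y|M. exp (h * x) * (k y * exp (- h * X y)) + exp (- h * x) * (k y * exp (h * X y)))"
    proof (rule integral_mono)
      fix y
      have "k y * (2 + (h * (x - X y))\<^sup>2) \<le> k y * (exp (h * (x - X y)) + exp (- (h * (x - X y))))"
        by (intro mult_left_mono cosh_lower_bound k)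
      also have "\<dots> = exp (h * x) * (k y * exp (- h * X y)) + exp (- h * x) * (k y * exp (h * X y))"
        by (simp add: exp_add[symmetric] distrib_left right_diff_distrib exp_diff exp_minus field_simps)
      also have "k y * (2 + (h * (x - X y))\<^sup>2) = 2 * k y + h\<^sup>2 * (x\<^sup>2 * k y - 2 * x * (k y * X y) + k y * (X y)\<^sup>2)"
        by (simp add: power2_eq_square algebra_simps)
      finally show "2 * k y + h\<^sup>2 * (x\<^sup>2 * k y - 2 * x * (k y * X y) + k y * (X y)\<^sup>2) \<le>
        exp (h * x) * (k y * exp (- h * X y)) + exp (- h * x) * (k y * exp (h * X y))" .
    qed (use k(1) X E in simp_all)
    also have "\<dots> = exp (h * x) * B + exp (- h * x) * A" unfolding A_def B_def using E by simp
    finally show ?thesis .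
  qed
  have "2 * (Z\<^sup>2 + h\<^sup>2 * (Z * m2 - m1\<^sup>2)) =
      2 * Z * Z + h\<^sup>2 * (Z * m2 - 2 * m1 * m1 + m2 * Z)"
    by (simp add: power2_eq_square algebra_simps)
  also have "\<dots> = (LINT y|M. 2 * Z * k y + h\<^sup>2 * (Z * (k y * (X y)\<^sup>2) - 2 * m1 * (k y * X y) + m2 * k y))"
    unfolding Z_def[symmetric] using k(1) X by (simp add: Z_def[symmetric] m1_def[symmetric] m2_def[symmetric])
  also have "\<dots> \<le> (LINT y|M. B * (k y * exp (h * X y)) + A * (k y * exp (- h * X y)))"
  proof (rule integral_mono)
    fix y
    have "k y * (2 * Z + h\<^sup>2 * ((X y)\<^sup>2 * Z - 2 * X y * m1 + m2)) \<le> k y * (exp (h * X y) * B + exp (- h * X y) * A)"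
      by (intro mult_left_mono inner k)
    then show "2 * Z * k y + h\<^sup>2 * (Z * (k y * (X y)\<^sup>2) - 2 * m1 * (k y * X y) + m2 * k y) \<le>
        B * (k y * exp (h * X y)) + A * (k y * exp (- h * X y))"
      by (simp add: algebra_simps)
  qed (use k(1) X E in simp_all)
  also have "\<dots> = 2 * (A * B)" unfolding A_def B_def using E by simp
  finally show ?thesis unfolding Z_def m1_def m2_def A_def B_def by simp
qed

section \<open>Optimal size of the tilt\<close>

text \<open>For \<beta> \<le> 1 the power of \<tau> is at most 1 + \<tau>; the rest is completing
  the square about K + h.\<close>

lemma quadratic_exponent_bound:
  fixes \<tau> h K \<beta> :: real
  assumes "0 \<le> \<tau>" "0 \<le> K" "0 < \<beta>" "\<beta> \<le> 1"
  shows "- \<tau>\<^sup>2 + 2 * K * \<tau> powr \<beta> + 2 * h * \<tau> \<le> (K + h)\<^sup>2 + 2 * K"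
proof -
  have "\<tau> powr \<beta> \<le> 1 + \<tau>"
  proof (cases "\<tau> \<le> 1")
    case True
    then have "\<tau> powr \<beta> \<le> 1" using assms by (intro powr_le1) auto
    then show ?thesis using assms by simp
  next
    case False
    then have "\<tau> powr \<beta> \<le> \<tau> powr 1" using assms by (intro powr_mono) auto
    then show ?thesis using False by simp
  qed
  then have "2 * K * \<tau> powr \<beta> \<le> 2 * K * (1 + \<tau>)" using assms by (intro mult_left_mono) auto
  moreover have "0 \<le> (\<tau> - (K + h))\<^sup>2" by simp
  ultimately show ?thesis by (simp add: power2_eq_square algebra_simps)
qed

lemma exp_le_quadratic: "exp x - 1 \<le> x + x\<^sup>2 * exp x" if "0 \<le> x" for x :: real
  using abs_exp_minus_taylor[of x] that by simp

text \<open>The bound results from the choice \<open>h\<^sup>4 = K \<kappa> powr (-\<beta>/2)\<close>.\<close>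

lemma tilt_optimization:
  fixes \<alpha> \<beta> K :: real
  assumes "\<alpha> > 0" "K > 0" "0 < \<beta>"
  shows "\<exists>C\<ge>0. \<forall>\<kappa> V. \<kappa> \<ge> \<alpha> \<longrightarrow>
    (\<forall>h>0. h\<^sup>2 * V \<le> exp ((K * \<kappa> powr (- \<beta> / 2) + h)\<^sup>2 + 2 * (K * \<kappa> powr (- \<beta> / 2))) - 1) \<longrightarrow>
    V \<le> 1 + C * \<kappa> powr (- \<beta> / 4)"
proof -
  \<comment> \<open>\<open>N\<close> and \<open>B\<close> bound the quantities \<open>n\<close> and
    \<open>b\<close> below uniformly in \<kappa> \<ge> \<alpha>; hence the final constant depends on
    \<alpha>, \<beta> and K alone.\<close>
  define N where "N = sqrt K * \<alpha> powr (- \<beta> / 4)"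
  define B where "B = 1 + 2 * N + 2 * N * (1 + N) + N ^ 3"
  define c where "c = 2 + 2 * (1 + N) + N\<^sup>2 + B\<^sup>2 * exp (N * B)"
  have N: "N \<ge> 0" unfolding N_def using assms by simp
  have B: "B \<ge> 0" unfolding B_def using N by (intro add_nonneg_nonneg mult_nonneg_nonneg zero_le_power) auto
  have c: "c \<ge> 0" unfolding c_def using N by (intro add_nonneg_nonneg mult_nonneg_nonneg) auto
  have main: "V \<le> 1 + c * (sqrt K * \<kappa> powr (- \<beta> / 4))"
    if k: "\<kappa> \<ge> \<alpha>" and V: "\<And>h. h > 0 \<Longrightarrow> h\<^sup>2 * V \<le> exp ((K * \<kappa> powr (- \<beta> / 2) + h)\<^sup>2 + 2 * (K * \<kappa> powr (- \<beta> / 2))) - 1"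
    for \<kappa> V
  proof -
    define n where "n = sqrt K * \<kappa> powr (- \<beta> / 4)"
    define h where "h = sqrt n"
    have kp: "\<kappa> > 0" using k assms by simp
    have n: "n > 0" unfolding n_def using assms kp by simp
    have nN: "n \<le> N" unfolding n_def N_def using k assms by (intro mult_left_mono powr_mono2') auto
    have h: "h > 0" "h\<^sup>2 = n" using n by (simp_all add: h_def)
    have hN: "h \<le> 1 + N"
    proof (rule power2_le_imp_le)
      have "n \<le> N + (1 + N + N\<^sup>2)" using nN N zero_le_power2[of N] by linarith
      then show "h\<^sup>2 \<le> (1 + N)\<^sup>2" unfolding h(2) by (simp add: power2_eq_square algebra_simps)
    qed (use N in simp)
    have Kn: "K * \<kappa> powr (- \<beta> / 2) = n\<^sup>2"
    proof -
      have "n\<^sup>2 = (sqrt K)\<^sup>2 * (\<kappa> powr (- \<beta> / 4))\<^sup>2" unfolding n_def by (rule power_mult_distrib)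
      also have "(\<kappa> powr (- \<beta> / 4))\<^sup>2 = \<kappa> powr (- \<beta> / 2)"
        unfolding power2_eq_square powr_add[symmetric] by simp
      finally show ?thesis using assms by simp
    qed
    \<comment> \<open>With h^2 = n the exponent is n * b, and b tends to 1 with n. Dividing exp (n *
      b) - 1 by h^2 = n therefore leaves 1 plus a multiple of n: this is the leading constant
      1.\<close>
    define b where "b = 1 + 2 * n + 2 * n * h + n ^ 3"
    have E: "(n\<^sup>2 + h)\<^sup>2 + 2 * n\<^sup>2 = n * b"
    proof -
      have "(n\<^sup>2 + h)\<^sup>2 + 2 * n\<^sup>2 = n ^ 4 + 2 * n\<^sup>2 * h + h\<^sup>2 + 2 * n\<^sup>2"
        by (simp add: power2_eq_square power4_eq_xxxx algebra_simps)
      also have "\<dots> = n * b" unfolding h(2) b_def by (simp add: power2_eq_square power3_eq_cube power4_eq_xxxx algebra_simps)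
      finally show ?thesis .
    qed
    have b0: "0 \<le> b" unfolding b_def using n h(1)
      by (intro add_nonneg_nonneg mult_nonneg_nonneg zero_le_power) auto
    have bB: "b \<le> B" unfolding b_def B_def using n nN h(1) N hN
      by (intro add_mono mult_mono power_mono mult_nonneg_nonneg) auto
    note b = b0 bB
    have "n * V \<le> exp (n * b) - 1" using V[OF h(1)] unfolding Kn E h(2) .
    also have "\<dots> \<le> n * b + (n * b)\<^sup>2 * exp (n * b)" using n b by (intro exp_le_quadratic) simp
    also have "\<dots> = n * (b + n * (b\<^sup>2 * exp (n * b)))" by (simp add: power2_eq_square algebra_simps)
    finally have "V \<le> b + n * (b\<^sup>2 * exp (n * b))" using n by simp
    also have "\<dots> \<le> (1 + n * (2 + 2 * (1 + N) + N\<^sup>2)) + n * (B\<^sup>2 * exp (N * B))"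
    proof (intro add_mono)
      have "b = 1 + n * (2 + 2 * h + n\<^sup>2)" by (simp add: b_def power2_eq_square power3_eq_cube algebra_simps)
      also have "\<dots> \<le> 1 + n * (2 + 2 * (1 + N) + N\<^sup>2)"
        using hN nN n by (intro add_left_mono mult_left_mono add_mono power_mono) auto
      finally show "b \<le> 1 + n * (2 + 2 * (1 + N) + N\<^sup>2)" .
      have "n * b \<le> N * B" using nN b n N by (intro mult_mono) auto
      then show "n * (b\<^sup>2 * exp (n * b)) \<le> n * (B\<^sup>2 * exp (N * B))"
        using b n by (intro mult_left_mono mult_mono power_mono) auto
    qed
    also have "\<dots> = 1 + c * n" by (simp add: c_def algebra_simps)
    finally show ?thesis unfolding n_def .
  qed
  show ?thesis
  proof (intro exI[of _ "c * sqrt K"] conjI allI impI)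
    show "0 \<le> c * sqrt K" using c assms by simp
    fix \<kappa> V assume "\<alpha> \<le> \<kappa>" "\<forall>h>0. h\<^sup>2 * V \<le> exp ((K * \<kappa> powr (- \<beta> / 2) + h)\<^sup>2 + 2 * (K * \<kappa> powr (- \<beta> / 2))) - 1"
    then show "V \<le> 1 + c * sqrt K * \<kappa> powr (- \<beta> / 4)" using main[of \<kappa> V] by (simp add: mult.assoc)
  qed
qed

section \<open>Gaussian posteriors\<close>

text \<open>Up to normalization, the density of the observation \<open>x\<close> given Y = y once
  the two Gaussian noises are merged into one of variance s^2.\<close>

definition gauss_kernel :: "nat \<Rightarrow> real \<Rightarrow> real \<Rightarrow> (nat \<Rightarrow> real) \<Rightarrow> (nat \<Rightarrow> real) \<Rightarrow> real" where
  "gauss_kernel d f s x y = exp (\<Sum>i<d. - (x i - f * y i)\<^sup>2 / (2 * s\<^sup>2))"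

definition dot :: "nat \<Rightarrow> (nat \<Rightarrow> real) \<Rightarrow> (nat \<Rightarrow> real) \<Rightarrow> real" where
  "dot d w y = (\<Sum>i<d. w i * y i)"

lemma gauss_kernel_pos: "0 < gauss_kernel d f s x y"
  by (simp add: gauss_kernel_def)

lemma dot_unit: "j < d \<Longrightarrow> dot d (\<lambda>i. if i = j then c else 0) y = c * y j"
  unfolding dot_def by (subst sum.cong[OF refl, of _ _ "\<lambda>i. if i = j then c * y j else 0"]) auto

lemma dot_lin: "r * dot d u y + t * dot d w y = dot d (\<lambda>i. r * u i + t * w i) y"
  unfolding dot_def by (simp add: sum_distrib_left sum.distrib distrib_right mult.assoc)

text \<open>The difference of the two sides is half a square. For f > 0 the kernel decays like a
  Gaussian in \<open>y\<close>, so it absorbs any linear tilt; all exponential moments of the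
  posterior follow, whatever the tails of the law.\<close>

lemma gaussian_tilt_bound:
  fixes x f s y b :: real
  assumes "f > 0" "s > 0"
  shows "- (x - f * y)\<^sup>2 / (2 * s\<^sup>2) + b * y \<le> b * x / f + b\<^sup>2 * s\<^sup>2 / (2 * f\<^sup>2)"
proof -
  have "b * x / f + b\<^sup>2 * s\<^sup>2 / (2 * f\<^sup>2) - (- (x - f * y)\<^sup>2 / (2 * s\<^sup>2) + b * y) = ((x - f * y) / s + b * s / f)\<^sup>2 / 2"
  proof -
    have "(x - f * y) / s * (b * s / f) = b * ((x - f * y) / f)" using assms by simp
    also have "(x - f * y) / f = x / f - y" using assms by (simp add: diff_divide_distrib)
    finally have m: "(x - f * y) / s * (b * s / f) = b * x / f - b * y" by (simp add: right_diff_distrib)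
    have "((x - f * y) / s + b * s / f)\<^sup>2 = ((x - f * y) / s)\<^sup>2 + (b * s / f)\<^sup>2 + 2 * ((x - f * y) / s * (b * s / f))"
      by (simp only: power2_sum mult.assoc)
    then have sq: "((x - f * y) / s + b * s / f)\<^sup>2 = (x - f * y)\<^sup>2 / s\<^sup>2 + b\<^sup>2 * s\<^sup>2 / f\<^sup>2 + 2 * (b * x / f - b * y)"
      unfolding m by (simp only: power_divide power_mult_distrib)
    have e: "- (x - f * y)\<^sup>2 / (2 * s\<^sup>2) = - ((x - f * y)\<^sup>2 / s\<^sup>2 / 2)" "b\<^sup>2 * s\<^sup>2 / (2 * f\<^sup>2) = b\<^sup>2 * s\<^sup>2 / f\<^sup>2 / 2"
      by simp_all
    show ?thesis unfolding sq unfolding e unfolding add_divide_distrib by simp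
  qed
  moreover have "0 \<le> ((x - f * y) / s + b * s / f)\<^sup>2 / 2" by simp
  ultimately show ?thesis by linarith
qed

lemma gauss_kernel_exp_dot_bound:
  assumes "f > 0" "s > 0"
  shows "gauss_kernel d f s x y * exp (dot d b y) \<le> exp (\<Sum>i<d. b i * x i / f + (b i)\<^sup>2 * s\<^sup>2 / (2 * f\<^sup>2))"
  unfolding gauss_kernel_def dot_def exp_add[symmetric] sum.distrib[symmetric] exp_le_cancel_iff
  by (intro sum_mono gaussian_tilt_bound assms)

text \<open>Moving one coordinate of the observation is an exponential tilt in the same coordinate
  of \<open>y\<close>. The remaining factor is free of \<open>y\<close> and cancels in posterior
  means, so their derivatives reduce to exponential moments.\<close>

lemma gauss_kernel_fun_upd:
  assumes "j < d" "s > 0"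
  shows "gauss_kernel d f s (x(j := r)) y =
    exp (((x j)\<^sup>2 - r\<^sup>2) / (2 * s\<^sup>2)) * (gauss_kernel d f s x y * exp ((r - x j) * (f / s\<^sup>2 * y j)))"
proof -
  let ?g = "\<lambda>a i. - (a - f * y i)\<^sup>2 / (2 * s\<^sup>2)"
  have 1: "(\<Sum>i<d. ?g ((x(j := r)) i) i) = ?g r j + (\<Sum>i\<in>{..<d} - {j}. ?g (x i) i)"
    using assms(1) by (subst sum.remove[of _ j]) (auto intro!: sum.cong)
  have 2: "(\<Sum>i<d. ?g (x i) i) = ?g (x j) j + (\<Sum>i\<in>{..<d} - {j}. ?g (x i) i)"
    using assms(1) by (subst sum.remove[of _ j]) auto
  have "?g r j = ((x j)\<^sup>2 - r\<^sup>2) / (2 * s\<^sup>2) + (?g (x j) j + (r - x j) * (f / s\<^sup>2 * y j))"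
  proof -
    have num: "- (r - f * y j)\<^sup>2 = ((x j)\<^sup>2 - r\<^sup>2) + (- (x j - f * y j)\<^sup>2 + 2 * ((r - x j) * (f * y j)))"
      by (simp add: power2_eq_square algebra_simps)
    show ?thesis unfolding num add_divide_distrib by simp
  qed
  then show ?thesis unfolding gauss_kernel_def 1 2 exp_add[symmetric] by simp
qed

abbreviation law :: "nat \<Rightarrow> ((nat \<Rightarrow> real) \<Rightarrow> real) \<Rightarrow> (nat \<Rightarrow> real) measure" where
  "law d p \<equiv> density (Rd_lborel d) (\<lambda>y. ennreal (p y))"

section \<open>Posterior moments for a general prior law\<close>

locale Rd_prob = prob_space P for P :: "(nat \<Rightarrow> real) measure" +
  fixes d :: nat
  assumes sets_P: "sets P = sets (Rd_lborel d)"
begin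

lemma meas_P: "borel_measurable P = borel_measurable (Rd_lborel d)"
  by (rule measurable_cong_sets[OF sets_P refl])

lemma meas_component: "i < d \<Longrightarrow> (\<lambda>y. y i) \<in> borel_measurable P"
  by (rule component_meas[OF measurable_ident_sets[OF sets_P]])

lemma meas_dot: "dot d w \<in> borel_measurable P"
  unfolding dot_def[abs_def] by (intro borel_measurable_sum borel_measurable_times borel_measurable_const meas_component) simp

lemma meas_kernel: "gauss_kernel d f s x \<in> borel_measurable P"
  unfolding gauss_kernel_def[abs_def]
  by (intro borel_measurable_sum borel_measurable_times borel_measurable_const meas_component
      borel_measurable_divide borel_measurable_power borel_measurable_diff borel_measurable_uminus
      measurable_compose[OF _ borel_measurable_exp]) simp

lemma integrable_kernel_exp:
  assumes "f > 0" "s > 0"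
  shows "integrable P (\<lambda>y. gauss_kernel d f s x y * exp (dot d b y))"
proof (rule integrable_const_bound)
  show "AE y in P. norm (gauss_kernel d f s x y * exp (dot d b y)) \<le> exp (\<Sum>i<d. b i * x i / f + (b i)\<^sup>2 * s\<^sup>2 / (2 * f\<^sup>2))"
    using gauss_kernel_exp_dot_bound[OF assms] gauss_kernel_pos by (intro AE_I2) (simp add: abs_mult less_imp_le)
  show "(\<lambda>y. gauss_kernel d f s x y * exp (dot d b y)) \<in> borel_measurable P"
    by (intro borel_measurable_times meas_kernel measurable_compose[OF meas_dot borel_measurable_exp])
qed

lemma integrable_kernel_exp2:
  assumes "f > 0" "s > 0"
  shows "integrable P (\<lambda>y. gauss_kernel d f s x y * exp (t * dot d w y) * exp (r * dot d u y))"
  using integrable_kernel_exp[OF assms, of x "\<lambda>i. t * w i + r * u i"]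
  unfolding dot_lin[symmetric] exp_add by (simp add: mult.assoc)

lemma integrable_kernel_dot:
  assumes "f > 0" "s > 0"
  shows "integrable P (gauss_kernel d f s x)"
    "integrable P (\<lambda>y. gauss_kernel d f s x y * exp (r * dot d w y))"
    "integrable P (\<lambda>y. gauss_kernel d f s x y * dot d u y)"
    "integrable P (\<lambda>y. gauss_kernel d f s x y * dot d u y * exp (r * dot d w y))"
    "integrable P (\<lambda>y. gauss_kernel d f s x y * dot d u y * dot d w y)"
proof -
  show "integrable P (gauss_kernel d f s x)"
    using integrable_kernel_exp2[OF assms, of x 0 u 0 u] by simp
  show "integrable P (\<lambda>y. gauss_kernel d f s x y * exp (r * dot d w y))"
    using integrable_kernel_exp2[OF assms, of x r w 0 u] by simp
  \<comment> \<open>The first-moment lemma is applied in direction \<open>u\<close>, at parameter 0,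
    to the kernel already tilted along \<open>w\<close>. A second application below yields products
    of two linear forms.\<close>
  have 4: "integrable P (\<lambda>y. gauss_kernel d f s x y * dot d u y * exp (r * dot d w y))" for r
  proof -
    have m: "(\<lambda>y. gauss_kernel d f s x y * exp (r * dot d w y)) \<in> borel_measurable P"
      by (rule borel_measurable_integrable) (use integrable_kernel_exp2[OF assms, of x r w 0 u] in simp)
    show ?thesis
      using integrable_exp_moment(1)[OF m meas_dot integrable_kernel_exp2[OF assms], of u 0]
      by (simp add: mult.assoc mult.commute mult.left_commute)
  qed
  then show "integrable P (\<lambda>y. gauss_kernel d f s x y * dot d u y * exp (r * dot d w y))" .
  show "integrable P (\<lambda>y. gauss_kernel d f s x y * dot d u y)" using 4[of 0] by simp
  have "(\<lambda>y. gauss_kernel d f s x y * dot d u y) \<in> borel_measurable P"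
    by (intro borel_measurable_times meas_kernel meas_dot)
  from integrable_exp_moment(1)[OF this meas_dot 4, of 0]
  show "integrable P (\<lambda>y. gauss_kernel d f s x y * dot d u y * dot d w y)" by simp
qed

lemma integrable_kernel: "integrable P (gauss_kernel d f s x)"
proof (rule integrable_const_bound[OF _ meas_kernel])
  have "gauss_kernel d f s x y \<le> 1" for y
    unfolding gauss_kernel_def by (simp add: sum_nonpos divide_nonpos_nonneg)
  then show "AE y in P. norm (gauss_kernel d f s x y) \<le> 1"
    by (intro AE_I2) (simp add: gauss_kernel_pos less_imp_le)
qed

lemma kernel_integral_pos: "0 < (LINT y|P. gauss_kernel d f s x y)"
proof -
  have "(LINT y|P. gauss_kernel d f s x y) \<noteq> 0"
  proof
    assume "(LINT y|P. gauss_kernel d f s x y) = 0"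
    then have "AE y in P. gauss_kernel d f s x y = 0"
      using integral_nonneg_eq_0_iff_AE[OF integrable_kernel, of f s x]
      by (simp add: gauss_kernel_pos less_imp_le)
    then have "AE y in P. False"
      by eventually_elim (metis gauss_kernel_pos less_irrefl)
    then show False by simp
  qed
  moreover have "0 \<le> (LINT y|P. gauss_kernel d f s x y)"
    by (intro integral_nonneg_AE AE_I2) (simp add: gauss_kernel_pos less_imp_le)
  ultimately show ?thesis by simp
qed

text \<open>The conditional expectation of \<open>h\<close> applied to Y, given the observation
  \<open>x\<close>, when \<open>P\<close> is the law of Y.\<close>

definition wmean :: "real \<Rightarrow> real \<Rightarrow> (nat \<Rightarrow> real) \<Rightarrow> ((nat \<Rightarrow> real) \<Rightarrow> real) \<Rightarrow> real" where
  "wmean f s x h = (LINT y|P. gauss_kernel d f s x y * h y) / (LINT y|P. gauss_kernel d f s x y)"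

definition wvar :: "real \<Rightarrow> real \<Rightarrow> (nat \<Rightarrow> real) \<Rightarrow> (nat \<Rightarrow> real) \<Rightarrow> real" where
  "wvar f s x w = wmean f s x (\<lambda>y. (dot d w y)\<^sup>2) - (wmean f s x (dot d w))\<^sup>2"

text \<open>The posterior mean is a quotient of two exponential moments with tilt (f / s^2)
  \<open>y j\<close>; its logarithmic-type derivative is a covariance.\<close>

lemma wmean_derivative:
  assumes fs: "f > 0" "s > 0" and ij: "i < d" "j < d"
  shows "((\<lambda>r. wmean f s (x(j := r)) (\<lambda>y. y i)) has_real_derivative
    f / s\<^sup>2 * (wmean f s x (\<lambda>y. y i * y j) - wmean f s x (\<lambda>y. y i) * wmean f s x (\<lambda>y. y j))) (at (x j))"
proof -
  define k where "k = gauss_kernel d f s x"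
  define X where "X y = f / s\<^sup>2 * y j" for y :: "nat \<Rightarrow> real"
  define A where "A t = (LINT y|P. (k y * y i) * exp (t * X y))" for t
  define B where "B t = (LINT y|P. k y * exp (t * X y))" for t
  have Xdot: "X = dot d (\<lambda>l. if l = j then f / s\<^sup>2 else 0)" by (rule ext) (simp add: dot_unit[OF ij(2)] X_def)
  have Xm: "X \<in> borel_measurable P" unfolding Xdot by (rule meas_dot)
  have im: "(\<lambda>y. y i) \<in> borel_measurable P" by (rule meas_component[OF ij(1)])
  have km: "k \<in> borel_measurable P" unfolding k_def by (rule meas_kernel)
  have dA: "(A has_real_derivative (LINT y|P. k y * y i * X y * exp (t * X y))) (at t)" for t
    unfolding A_def
  proof (rule has_derivative_exp_moment[OF _ Xm])
    show "(\<lambda>y. k y * y i) \<in> borel_measurable P" by (rule borel_measurable_times[OF km im])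
    show "integrable P (\<lambda>y. k y * y i * exp (r * X y))" for r
      unfolding Xdot k_def using integrable_kernel_dot(4)[OF fs, of x "\<lambda>l. if l = i then 1 else 0" r "\<lambda>l. if l = j then f / s\<^sup>2 else 0"]
      by (simp add: dot_unit[OF ij(1)])
  qed
  have dB: "(B has_real_derivative (LINT y|P. k y * X y * exp (t * X y))) (at t)" for t
    unfolding B_def
  proof (rule has_derivative_exp_moment[OF km Xm])
    show "integrable P (\<lambda>y. k y * exp (r * X y))" for r
      unfolding Xdot k_def by (rule integrable_kernel_dot(2)[OF fs])
  qed
  have B0: "B 0 = (LINT y|P. k y)" "A 0 = (LINT y|P. k y * y i)" by (simp_all add: A_def B_def)
  have Bpos: "B 0 > 0" unfolding B0 k_def by (rule kernel_integral_pos)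
  have eq: "wmean f s (x(j := r)) (\<lambda>y. y i) = A (r - x j) / B (r - x j)" for r
  proof -
    define c where "c = exp (((x j)\<^sup>2 - r\<^sup>2) / (2 * s\<^sup>2))"
    have kk: "gauss_kernel d f s (x(j := r)) y = c * (k y * exp ((r - x j) * X y))" for y
      unfolding c_def k_def X_def by (rule gauss_kernel_fun_upd[OF ij(2) fs(2)])
    have "(LINT y|P. gauss_kernel d f s (x(j := r)) y * y i) = (LINT y|P. c * ((k y * y i) * exp ((r - x j) * X y)))"
      unfolding kk by (simp add: mult.assoc mult.commute mult.left_commute)
    also have "\<dots> = c * A (r - x j)" unfolding A_def by simp
    finally have 1: "(LINT y|P. gauss_kernel d f s (x(j := r)) y * y i) = c * A (r - x j)" .
    have 2: "(LINT y|P. gauss_kernel d f s (x(j := r)) y) = c * B (r - x j)"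
      unfolding kk B_def by simp
    have "c \<noteq> 0" by (simp add: c_def)
    then show ?thesis unfolding wmean_def 1 2 by simp
  qed
  have "((\<lambda>t. A t / B t) has_real_derivative
      ((LINT y|P. k y * y i * X y * exp (0 * X y)) * B 0 - A 0 * (LINT y|P. k y * X y * exp (0 * X y))) / (B 0 * B 0)) (at 0)"
    by (rule DERIV_divide[OF dA dB]) (use Bpos in simp)
  then have "((\<lambda>r. A (r - x j) / B (r - x j)) has_real_derivative
      ((LINT y|P. k y * y i * X y * exp (0 * X y)) * B 0 - A 0 * (LINT y|P. k y * X y * exp (0 * X y))) / (B 0 * B 0)) (at (x j))"
    using DERIV_shift[of "\<lambda>t. A t / B t" _ "x j" "- x j"] by simp
  moreover have "((LINT y|P. k y * y i * X y * exp (0 * X y)) * B 0 - A 0 * (LINT y|P. k y * X y * exp (0 * X y))) / (B 0 * B 0) =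
      f / s\<^sup>2 * (wmean f s x (\<lambda>y. y i * y j) - wmean f s x (\<lambda>y. y i) * wmean f s x (\<lambda>y. y j))"
  proof -
    have "(LINT y|P. k y * y i * X y * exp (0 * X y)) = (LINT y|P. f / s\<^sup>2 * (k y * (y i * y j)))"
      unfolding X_def by (simp add: mult.assoc mult.commute mult.left_commute)
    then have 1: "(LINT y|P. k y * y i * X y * exp (0 * X y)) = f / s\<^sup>2 * (LINT y|P. k y * (y i * y j))" by simp
    have "(LINT y|P. k y * X y * exp (0 * X y)) = (LINT y|P. f / s\<^sup>2 * (k y * y j))"
      unfolding X_def by (simp add: mult.assoc mult.commute mult.left_commute)
    then have 2: "(LINT y|P. k y * X y * exp (0 * X y)) = f / s\<^sup>2 * (LINT y|P. k y * y j)" by simp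
    have alg: "(q * a * z - b * (q * c)) / (z * z) = q * (a / z - b / z * (c / z))" if "z > 0" for q a b c z :: real
      using that by (simp add: diff_divide_distrib right_diff_distrib)
    show ?thesis unfolding 1 2 B0 wmean_def k_def[symmetric] by (rule alg[OF Bpos[unfolded B0]])
  qed
  ultimately show ?thesis unfolding eq by simp
qed

text \<open>Serves at the times when the covariance enters the Jacobian with a negative coefficient
  and may simply be dropped.\<close>

lemma wvar_nonneg:
  assumes fs: "f > 0" "s > 0"
  shows "0 \<le> wvar f s x w"
proof -
  define k where "k = gauss_kernel d f s x"
  define Z where "Z = (LINT y|P. k y)"
  define m1 where "m1 = (LINT y|P. k y * dot d w y)"
  define m2 where "m2 = (LINT y|P. k y * (dot d w y)\<^sup>2)"
  have Z: "Z > 0" unfolding Z_def k_def by (rule kernel_integral_pos)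
  have i1: "integrable P (\<lambda>y. k y * dot d w y)" unfolding k_def by (rule integrable_kernel_dot(3)[OF fs])
  have i2: "integrable P (\<lambda>y. k y * (dot d w y)\<^sup>2)"
    using integrable_kernel_dot(5)[OF fs, of x w w] unfolding k_def power2_eq_square by (simp only: mult.assoc)
  have ik: "integrable P k" unfolding k_def by (rule integrable_kernel)
  define a where "a = m1 / Z"
  have "0 \<le> (LINT y|P. k y * (dot d w y - a)\<^sup>2)"
    by (intro integral_nonneg_AE AE_I2) (simp add: k_def gauss_kernel_pos less_imp_le)
  also have "\<dots> = (LINT y|P. k y * (dot d w y)\<^sup>2 - 2 * a * (k y * dot d w y) + a\<^sup>2 * k y)"
    by (intro Bochner_Integration.integral_cong refl) (simp add: power2_eq_square algebra_simps)
  also have "\<dots> = m2 - 2 * a * m1 + a\<^sup>2 * Z"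
    unfolding m1_def m2_def Z_def using i1 i2 ik by simp
  also have "\<dots> = m2 - a\<^sup>2 * Z"
  proof -
    have "m1 = a * Z" using Z by (simp add: a_def)
    then show ?thesis by (simp add: power2_eq_square)
  qed
  finally have "a\<^sup>2 * Z \<le> m2" by simp
  then have "a\<^sup>2 \<le> m2 / Z" using Z by (simp add: pos_le_divide_eq)
  then show ?thesis unfolding wvar_def a_def wmean_def m1_def m2_def Z_def k_def by simp
qed

lemma wmean_quadratic_form:
  assumes fs: "f > 0" "s > 0"
  shows "(\<Sum>i<d. \<Sum>j<d. w i * w j * (wmean f s x (\<lambda>y. y i * y j) - wmean f s x (\<lambda>y. y i) * wmean f s x (\<lambda>y. y j))) = wvar f s x w"
proof -
  define k where "k = gauss_kernel d f s x"
  have i1: "integrable P (\<lambda>y. k y * y i)" if "i < d" for i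
    using integrable_kernel_dot(3)[OF fs, of x "\<lambda>l. if l = i then 1 else 0"] by (simp add: dot_unit[OF that] k_def)
  have i2: "integrable P (\<lambda>y. k y * (y i * y j))" if "i < d" "j < d" for i j
    using integrable_kernel_dot(5)[OF fs, of x "\<lambda>l. if l = i then 1 else 0" "\<lambda>l. if l = j then 1 else 0"]
    by (simp add: dot_unit[OF that(1)] dot_unit[OF that(2)] k_def mult.assoc)
  have "(LINT y|P. k y * dot d w y) = (LINT y|P. (\<Sum>i<d. w i * (k y * y i)))"
    unfolding dot_def sum_distrib_left by (intro Bochner_Integration.integral_cong sum.cong refl) simp
  also have "\<dots> = (\<Sum>i<d. w i * (LINT y|P. k y * y i))"
    using i1 by (subst Bochner_Integration.integral_sum) auto
  finally have 1: "wmean f s x (dot d w) = (\<Sum>i<d. w i * wmean f s x (\<lambda>y. y i))"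
    unfolding wmean_def k_def by (simp add: sum_divide_distrib)
  have "(LINT y|P. k y * (dot d w y)\<^sup>2) = (LINT y|P. (\<Sum>i<d. \<Sum>j<d. w i * w j * (k y * (y i * y j))))"
  proof (intro Bochner_Integration.integral_cong refl)
    fix y
    have "(dot d w y)\<^sup>2 = (\<Sum>i<d. \<Sum>j<d. w i * w j * (y i * y j))"
      unfolding dot_def power2_eq_square sum_product by (intro sum.cong refl) simp
    then show "k y * (dot d w y)\<^sup>2 = (\<Sum>i<d. \<Sum>j<d. w i * w j * (k y * (y i * y j)))"
      by (simp add: sum_distrib_left mult.left_commute)
  qed
  also have "\<dots> = (\<Sum>i<d. \<Sum>j<d. w i * w j * (LINT y|P. k y * (y i * y j)))"
    using i2 by (subst Bochner_Integration.integral_sum, force, intro sum.cong refl, subst Bochner_Integration.integral_sum) auto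
  finally have 2: "wmean f s x (\<lambda>y. (dot d w y)\<^sup>2) = (\<Sum>i<d. \<Sum>j<d. w i * w j * wmean f s x (\<lambda>y. y i * y j))"
    unfolding wmean_def k_def by (simp add: sum_divide_distrib)
  show ?thesis
    unfolding wvar_def 1 2 unfolding power2_eq_square[of "sum _ _"] sum_product sum_subtractf[symmetric]
    by (intro sum.cong refl) (simp add: algebra_simps)
qed

end

section \<open>Posterior variance for weakly log-concave laws\<close>

lemma Rd_prob_density:
  assumes "prob_density d p"
  shows "Rd_prob (law d p) d"
proof -
  have p: "p \<in> borel_measurable (Rd_lborel d)" "(\<integral>\<^sup>+ x. ennreal (p x) \<partial>Rd_lborel d) = 1"
    using assms unfolding prob_density_def by blast+
  have "emeasure (law d p) (Rd d) = (\<integral>\<^sup>+ x. ennreal (p x) * indicator (Rd d) x \<partial>Rd_lborel d)"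
  proof (rule emeasure_density)
    show "(\<lambda>y. ennreal (p y)) \<in> borel_measurable (Rd_lborel d)" using p(1) by (rule measurable_compose[OF _ measurable_ennreal])
    show "Rd d \<in> sets (Rd_lborel d)" using sets.top[of "Rd_lborel d"] by (simp only: space_Rd)
  qed
  also have "\<dots> = (\<integral>\<^sup>+ x. ennreal (p x) \<partial>Rd_lborel d)" by (intro nn_integral_cong) simp
  finally have "emeasure (law d p) (Rd d) = 1" unfolding p(2) .
  then have "prob_space (law d p)"
    by (intro prob_spaceI) simp
  then show ?thesis unfolding Rd_prob_def Rd_prob_axioms_def by simp
qed

lemma nn_integral_density_eq:
  assumes p: "prob_density d p" and g: "integrable (law d p) g" "\<And>y. 0 \<le> g y"
  shows "(\<integral>\<^sup>+ y. ennreal (p y * g y) \<partial>Rd_lborel d) = ennreal (LINT y|law d p. g y)"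
proof -
  let ?P = "law d p"
  have pm: "(\<lambda>y. ennreal (p y)) \<in> borel_measurable (Rd_lborel d)" and p0: "\<And>y. y \<in> Rd d \<Longrightarrow> 0 \<le> p y"
    using p unfolding prob_density_def by (auto intro: measurable_compose[OF _ measurable_ennreal])
  have gm: "g \<in> borel_measurable (Rd_lborel d)"
    using borel_measurable_integrable[OF g(1)] by (simp only: measurable_density_eq1)
  have "ennreal (LINT y|?P. g y) = (\<integral>\<^sup>+ y. ennreal (g y) \<partial>?P)"
    using g by (intro nn_integral_eq_integral[symmetric] AE_I2)
  also have "\<dots> = (\<integral>\<^sup>+ y. ennreal (p y) * ennreal (g y) \<partial>Rd_lborel d)"
    by (rule nn_integral_density[OF pm]) (rule measurable_compose[OF gm measurable_ennreal])
  also have "\<dots> = (\<integral>\<^sup>+ y. ennreal (p y * g y) \<partial>Rd_lborel d)"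
    using p0 g(2) by (intro nn_integral_cong) (simp add: ennreal_mult)
  finally show ?thesis ..
qed

text \<open>The parallelogram identity in each coordinate, hence an equality. It contributes f^2 /
  s^2 to the curvature, in addition to \<alpha>.\<close>

lemma gauss_kernel_midpoint:
  assumes "s > 0"
  shows "gauss_kernel d f s x y * gauss_kernel d f s x y' =
    (gauss_kernel d f s x (lincomb d (1/2) y (1/2) y'))\<^sup>2 * exp (- (f\<^sup>2 / s\<^sup>2 / 4) * (Rd_norm d (lincomb d 1 y (-1) y'))\<^sup>2)"
proof -
  define m where "m = lincomb d (1/2) y (1/2) y'"
  have "- (x i - f * y i)\<^sup>2 / (2 * s\<^sup>2) + - (x i - f * y' i)\<^sup>2 / (2 * s\<^sup>2) =
      (- (x i - f * m i)\<^sup>2 / (2 * s\<^sup>2) + - (x i - f * m i)\<^sup>2 / (2 * s\<^sup>2)) + - (f\<^sup>2 / s\<^sup>2 / 4) * (y i - y' i)\<^sup>2"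
    if i: "i < d" for i
  proof -
    define A where "A = x i - f * y i"
    define B where "B = x i - f * y' i"
    have m2: "2 * (x i - f * m i) = A + B" using i by (simp add: m_def A_def B_def lincomb_def field_simps)
    have ab: "f * (y i - y' i) = B - A" by (simp add: A_def B_def algebra_simps)
    have "4 * (x i - f * m i)\<^sup>2 = (A + B)\<^sup>2" unfolding m2[symmetric] power_mult_distrib by simp
    then have mm: "(x i - f * m i)\<^sup>2 = (A + B)\<^sup>2 / 4" by simp
    have yy: "f\<^sup>2 * (y i - y' i)\<^sup>2 = (B - A)\<^sup>2" unfolding ab[symmetric] by (simp add: power_mult_distrib)
    have "- (f\<^sup>2 / s\<^sup>2 / 4) * (y i - y' i)\<^sup>2 = - ((B - A)\<^sup>2 / (4 * s\<^sup>2))" unfolding yy[symmetric] by simp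
    moreover have "- A\<^sup>2 / (2 * s\<^sup>2) + - B\<^sup>2 / (2 * s\<^sup>2) =
      (- ((A + B)\<^sup>2 / 4) / (2 * s\<^sup>2) + - ((A + B)\<^sup>2 / 4) / (2 * s\<^sup>2)) + - ((B - A)\<^sup>2 / (4 * s\<^sup>2))"
      using assms by (simp add: power2_eq_square field_simps)
    ultimately show ?thesis unfolding mm A_def[symmetric] B_def[symmetric] by simp
  qed
  then have "(\<Sum>i<d. - (x i - f * y i)\<^sup>2 / (2 * s\<^sup>2)) + (\<Sum>i<d. - (x i - f * y' i)\<^sup>2 / (2 * s\<^sup>2)) =
    ((\<Sum>i<d. - (x i - f * m i)\<^sup>2 / (2 * s\<^sup>2)) + (\<Sum>i<d. - (x i - f * m i)\<^sup>2 / (2 * s\<^sup>2))) + - (f\<^sup>2 / s\<^sup>2 / 4) * (\<Sum>i<d. (y i - y' i)\<^sup>2)"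
    unfolding sum_distrib_left sum.distrib[symmetric] by (intro sum.cong refl) simp
  then show ?thesis
    unfolding gauss_kernel_def m_def[symmetric] power2_eq_square[of "exp _"] Rd_norm_diff_sq exp_add[symmetric] by simp
qed

lemma dot_diff_le:
  assumes "(\<Sum>i<d. (w i)\<^sup>2) = 1"
  shows "dot d w y - dot d w y' \<le> Rd_norm d (lincomb d 1 y (-1) y')"
proof -
  have "dot d w y - dot d w y' = (\<Sum>i<d. w i * (y i - y' i))"
    unfolding dot_def by (simp add: sum_subtractf right_diff_distrib)
  also have "\<dots> \<le> (\<Sum>i<d. \<bar>w i\<bar> * \<bar>y i - y' i\<bar>)"
    by (intro sum_mono) (metis abs_ge_self abs_mult)
  also have "\<dots> \<le> L2_set w {..<d} * L2_set (\<lambda>i. y i - y' i) {..<d}" by (rule L2_set_mult_ineq)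
  also have "L2_set w {..<d} = 1" unfolding L2_set_def assms by simp
  also have "L2_set (\<lambda>i. y i - y' i) {..<d} = Rd_norm d (lincomb d 1 y (-1) y')"
    unfolding Rd_norm_lincomb by simp
  finally show ?thesis by simp
qed

text \<open>The substitution \<tau> = sqrt \<kappa> * r / 2 measures distance in units of \<kappa>
  powr (-1/2). It reduces to unit curvature and turns the Hoelder constant K into K \<kappa> powr
  (-\<beta>/2).\<close>

lemma tilted_exponent_bound:
  fixes r h K \<kappa> \<beta> :: real
  assumes "0 \<le> r" "0 < \<kappa>" "0 \<le> K" "0 < \<beta>" "\<beta> \<le> 1"
  shows "- (\<kappa> / 4) * r\<^sup>2 + 2 * K * (r / 2) powr \<beta> + h * sqrt \<kappa> * r \<le>
    (K * \<kappa> powr (- \<beta> / 2) + h)\<^sup>2 + 2 * (K * \<kappa> powr (- \<beta> / 2))"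
proof -
  define \<tau> where "\<tau> = sqrt \<kappa> * (r / 2)"
  have t: "0 \<le> \<tau>" using assms by (simp add: \<tau>_def)
  have t2: "\<tau>\<^sup>2 = \<kappa> / 4 * r\<^sup>2" using assms by (simp add: \<tau>_def power_mult_distrib power_divide)
  have "sqrt \<kappa> powr \<beta> = \<kappa> powr (\<beta> / 2)" using assms by (simp add: powr_half_sqrt[symmetric] powr_powr)
  then have "\<tau> powr \<beta> = \<kappa> powr (\<beta> / 2) * (r / 2) powr \<beta>"
    using assms unfolding \<tau>_def by (subst powr_mult) auto
  moreover have "\<kappa> powr (- \<beta> / 2) * \<kappa> powr (\<beta> / 2) = 1"
    using assms unfolding powr_add[symmetric] by simp
  ultimately have tb: "\<kappa> powr (- \<beta> / 2) * \<tau> powr \<beta> = (r / 2) powr \<beta>"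
    by (metis mult.assoc mult_1)
  have "- \<tau>\<^sup>2 + 2 * (K * \<kappa> powr (- \<beta> / 2)) * \<tau> powr \<beta> + 2 * h * \<tau> \<le> (K * \<kappa> powr (- \<beta> / 2) + h)\<^sup>2 + 2 * (K * \<kappa> powr (- \<beta> / 2))"
    by (rule quadratic_exponent_bound[OF t]) (use assms in auto)
  moreover have e1: "2 * (K * \<kappa> powr (- \<beta> / 2)) * \<tau> powr \<beta> = 2 * K * (r / 2) powr \<beta>"
    unfolding tb[symmetric] by simp
  moreover have e2: "2 * h * \<tau> = h * sqrt \<kappa> * r" by (simp add: \<tau>_def)
  moreover have e3: "- \<tau>\<^sup>2 = - (\<kappa> / 4) * r\<^sup>2" unfolding t2 by simp
  ultimately show ?thesis by (simp only:)
qed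

text \<open>Opposite tilts leave no tilt at the midpoint, only the factor exp (t \<langle>w, y -
  y'\<rangle>), at most exp (t r). The curvature \<kappa> beats it up to the constant exp E,
  whatever the distance r is.\<close>

lemma posterior_tilt_product:
  fixes \<alpha> \<beta> K h f s :: real
  assumes p: "weakly_log_concave d \<alpha> \<beta> K p" and pos: "\<alpha> > 0" "K > 0" "0 < \<beta>" "\<beta> \<le> 1" "f > 0" "s > 0" "h > 0"
    and w: "(\<Sum>i<d. (w i)\<^sup>2) = 1"
  defines "\<kappa> \<equiv> \<alpha> + f\<^sup>2 / s\<^sup>2"
  defines "P \<equiv> law d p"
  shows "(LINT y|P. gauss_kernel d f s x y * exp (h * sqrt \<kappa> * dot d w y)) *
      (LINT y|P. gauss_kernel d f s x y * exp (- (h * sqrt \<kappa>) * dot d w y)) \<le>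
    exp ((K * \<kappa> powr (- \<beta> / 2) + h)\<^sup>2 + 2 * (K * \<kappa> powr (- \<beta> / 2))) * (LINT y|P. gauss_kernel d f s x y)\<^sup>2"
proof -
  have pd: "prob_density d p" using p unfolding weakly_log_concave_def by (rule conjunct1)
  interpret Rd_prob P d unfolding P_def by (rule Rd_prob_density[OF pd])
  define k where "k = gauss_kernel d f s x"
  define t where "t = h * sqrt \<kappa>"
  define E where "E = (K * \<kappa> powr (- \<beta> / 2) + h)\<^sup>2 + 2 * (K * \<kappa> powr (- \<beta> / 2))"
  have kp: "0 < k y" for y unfolding k_def by (rule gauss_kernel_pos)
  have \<kappa>: "\<kappa> > 0" unfolding \<kappa>_def using pos by (intro add_pos_nonneg) auto
  have t: "t > 0" unfolding t_def using pos \<kappa> by simp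
  have p0: "\<And>y. y \<in> Rd d \<Longrightarrow> 0 \<le> p y" and pm: "p \<in> borel_measurable (Rd_lborel d)"
    using pd unfolding prob_density_def by blast+
  obtain U where UU: "U \<in> sets (Rd_lborel d) \<and> U \<subseteq> Rd d \<and> (AE x in Rd_lborel d. x \<notin> U \<longrightarrow> p x = 0) \<and>
    (\<forall>x\<in>U. \<forall>y\<in>U. lincomb d (1/2) x (1/2) y \<in> U \<and>
      p x * p y \<le> (p (lincomb d (1/2) x (1/2) y))\<^sup>2 *
        exp (- (\<alpha> / 4) * (Rd_norm d (lincomb d 1 x (-1) y))\<^sup>2 + 2 * K * (Rd_norm d (lincomb d 1 x (-1) y) / 2) powr \<beta>))"
    using weakly_log_concave_midpoint[OF p] by (rule exE)
  note U = UU[THEN conjunct1] UU[THEN conjunct2, THEN conjunct1] UU[THEN conjunct2, THEN conjunct2, THEN conjunct1]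
    UU[THEN conjunct2, THEN conjunct2, THEN conjunct2, THEN bspec, THEN bspec, THEN conjunct1]
    UU[THEN conjunct2, THEN conjunct2, THEN conjunct2, THEN bspec, THEN bspec, THEN conjunct2]
  \<comment> \<open>The midpoint inequality for \<open>p\<close> is known on \<open>U\<close> only.
    Cutting off outside \<open>U\<close> changes no integral, since \<open>p\<close> vanishes there
    almost everywhere.\<close>
  define F where "F g y = ennreal (p y * g y) * indicator U y" for g :: "(nat \<Rightarrow> real) \<Rightarrow> real" and y
  have F: "F g \<in> borel_measurable (Rd_lborel d)" "(\<integral>\<^sup>+ y. F g y \<partial>Rd_lborel d) = ennreal (LINT y|P. g y)"
    if g: "integrable P g" "\<And>y. 0 \<le> g y" for g
  proof -
    have gm: "g \<in> borel_measurable (Rd_lborel d)"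
      using borel_measurable_integrable[OF g(1)] unfolding meas_P .
    show "F g \<in> borel_measurable (Rd_lborel d)" unfolding F_def[abs_def]
      by (intro borel_measurable_times_ennreal borel_measurable_indicator U(1)
          measurable_compose[OF _ measurable_ennreal] borel_measurable_times pm gm)
    have "(\<integral>\<^sup>+ y. F g y \<partial>Rd_lborel d) = (\<integral>\<^sup>+ y. ennreal (p y * g y) \<partial>Rd_lborel d)"
      by (rule nn_integral_cong_AE, rule AE_mp[OF U(3)], rule AE_I2) (auto simp: F_def indicator_def)
    also have "\<dots> = ennreal (LINT y|P. g y)"
      unfolding P_def by (rule nn_integral_density_eq[OF pd]) (use g in \<open>auto simp: P_def\<close>)
    finally show "(\<integral>\<^sup>+ y. F g y \<partial>Rd_lborel d) = ennreal (LINT y|P. g y)" .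
  qed
  define g1 where "g1 y = k y * exp (t * dot d w y)" for y
  define g2 where "g2 y = k y * exp (- t * dot d w y)" for y
  \<comment> \<open>Prekopa-Leindler squares the midpoint function, so half of the exponent
    \<open>E\<close> goes here.\<close>
  define g3 where "g3 y = exp (E / 2) * k y" for y
  have i1: "integrable P g1" unfolding g1_def[abs_def] k_def by (rule integrable_kernel_dot(2)[OF pos(5,6)])
  have i2: "integrable P g2" unfolding g2_def[abs_def] k_def by (rule integrable_kernel_dot(2)[OF pos(5,6)])
  have ik: "integrable P k" unfolding k_def by (rule integrable_kernel_dot(1)[OF pos(5,6)])
  have i3: "integrable P g3" unfolding g3_def[abs_def] by (intro integrable_mult_right ik)
  have g0: "0 \<le> g1 y" "0 \<le> g2 y" "0 \<le> g3 y" for y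
    using kp[of y] by (simp_all add: g1_def g2_def g3_def less_imp_le)
  have mid: "F g1 y * F g2 y' \<le> (F g3 (lincomb d (1/2) y (1/2) y'))\<^sup>2" for y y'
  proof (cases "y \<in> U \<and> y' \<in> U")
    case False
    then show ?thesis by (auto simp: F_def)
  next
    case True
    then have yU: "y \<in> U" "y' \<in> U" by auto
    define m where "m = lincomb d (1/2) y (1/2) y'"
    define r where "r = Rd_norm d (lincomb d 1 y (-1) y')"
    have mU: "m \<in> U" unfolding m_def by (rule U(4)[OF yU])
    have pn: "0 \<le> p y" "0 \<le> p y'" "0 \<le> p m" using p0 yU mU U(2) by auto
    have r0: "0 \<le> r" unfolding r_def Rd_norm_def by (rule L2_set_nonneg)
    have "p y * g1 y * (p y' * g2 y') = (p y * p y') * (k y * k y') * exp (t * (dot d w y - dot d w y'))"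
      by (simp add: g1_def g2_def exp_add[symmetric] right_diff_distrib exp_diff exp_minus field_simps)
    also have "\<dots> \<le> ((p m)\<^sup>2 * exp (- (\<alpha> / 4) * r\<^sup>2 + 2 * K * (r / 2) powr \<beta>)) *
        ((k m)\<^sup>2 * exp (- (f\<^sup>2 / s\<^sup>2 / 4) * r\<^sup>2)) * exp (t * r)"
    proof -
      have 1: "p y * p y' \<le> (p m)\<^sup>2 * exp (- (\<alpha> / 4) * r\<^sup>2 + 2 * K * (r / 2) powr \<beta>)"
        using U(5)[OF yU] unfolding m_def r_def .
      have 2: "k y * k y' \<le> (k m)\<^sup>2 * exp (- (f\<^sup>2 / s\<^sup>2 / 4) * r\<^sup>2)"
        unfolding k_def m_def r_def by (rule eq_refl[OF gauss_kernel_midpoint[OF pos(6)]])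
      have 3: "exp (t * (dot d w y - dot d w y')) \<le> exp (t * r)"
        using mult_left_mono[OF dot_diff_le[OF w, of y y'] less_imp_le[OF t]] unfolding r_def by simp
      have kk: "0 \<le> k y * k y'" using kp by (intro mult_nonneg_nonneg less_imp_le)
      show ?thesis by (rule mult_mono[OF mult_mono[OF 1 2 _ kk] 3]) (use pn kk in simp_all)
    qed
    also have "\<dots> = (p m)\<^sup>2 * (k m)\<^sup>2 *
        exp ((- (\<alpha> / 4) * r\<^sup>2 + 2 * K * (r / 2) powr \<beta>) + - (f\<^sup>2 / s\<^sup>2 / 4) * r\<^sup>2 + t * r)"
      unfolding exp_add by (simp only: ac_simps)
    also have "(- (\<alpha> / 4) * r\<^sup>2 + 2 * K * (r / 2) powr \<beta>) + - (f\<^sup>2 / s\<^sup>2 / 4) * r\<^sup>2 + t * r =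
        - (\<kappa> / 4) * r\<^sup>2 + 2 * K * (r / 2) powr \<beta> + h * sqrt \<kappa> * r"
    proof -
      have "\<kappa> / 4 = \<alpha> / 4 + f\<^sup>2 / s\<^sup>2 / 4" unfolding \<kappa>_def by (rule add_divide_distrib)
      then show ?thesis unfolding t_def by (simp only:) (simp add: algebra_simps)
    qed
    also have "(p m)\<^sup>2 * (k m)\<^sup>2 * exp (- (\<kappa> / 4) * r\<^sup>2 + 2 * K * (r / 2) powr \<beta> + h * sqrt \<kappa> * r) \<le> (p m)\<^sup>2 * (k m)\<^sup>2 * exp E"
      unfolding E_def using tilted_exponent_bound[OF r0 \<kappa>, of K \<beta> h] pos
      by (intro mult_left_mono) auto
    also have "\<dots> = (p m * g3 m)\<^sup>2"
    proof -
      have "exp E = (exp (E / 2))\<^sup>2" by (simp add: power2_eq_square exp_add[symmetric])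
      then show ?thesis unfolding g3_def by (simp only: power_mult_distrib ac_simps)
    qed
    finally have "ennreal (p y * g1 y * (p y' * g2 y')) \<le> ennreal ((p m * g3 m)\<^sup>2)" by (rule ennreal_leI)
    then show ?thesis
      using yU mU pn g0 unfolding F_def m_def[symmetric]
      by (simp add: ennreal_mult[symmetric] ennreal_power)
  qed
  have "(\<integral>\<^sup>+ y. F g1 y \<partial>Rd_lborel d) * (\<integral>\<^sup>+ y. F g2 y \<partial>Rd_lborel d) \<le> (\<integral>\<^sup>+ y. F g3 y \<partial>Rd_lborel d)\<^sup>2"
    by (intro prekopa_leindler F(1) i1 i2 i3 g0 mid)
  then have le: "ennreal (LINT y|P. g1 y) * ennreal (LINT y|P. g2 y) \<le> (ennreal (LINT y|P. g3 y))\<^sup>2"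
    unfolding F(2)[OF i1 g0(1)] F(2)[OF i2 g0(2)] F(2)[OF i3 g0(3)] .
  have n: "0 \<le> (LINT y|P. g1 y)" "0 \<le> (LINT y|P. g2 y)" "0 \<le> (LINT y|P. g3 y)"
    using g0 by (intro integral_nonneg_AE AE_I2; simp)+
  have "(LINT y|P. g1 y) * (LINT y|P. g2 y) \<le> (LINT y|P. g3 y)\<^sup>2"
    using le n by (simp add: ennreal_mult[symmetric] ennreal_power)
  also have "(LINT y|P. g3 y)\<^sup>2 = exp E * (LINT y|P. k y)\<^sup>2"
    unfolding g3_def by (simp add: power_mult_distrib power2_eq_square[of "exp _"] exp_add[symmetric])
  finally show ?thesis unfolding g1_def g2_def k_def t_def E_def .
qed

text \<open>Combines the symmetrized variance inequality with the tilt product. \<open>C\<close> is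
  chosen before the dimension, the law and the observation, which is how freedom from the dimension
  reaches the final constant.\<close>

theorem posterior_variance_bound:
  fixes \<alpha> \<beta> K :: real
  assumes "\<alpha> > 0" "K > 0" "0 < \<beta>" "\<beta> \<le> 1"
  shows "\<exists>C\<ge>0. \<forall>d p f s x w. weakly_log_concave d \<alpha> \<beta> K p \<longrightarrow> f > 0 \<longrightarrow> s > 0 \<longrightarrow> (\<Sum>i<d. (w i)\<^sup>2) = 1 \<longrightarrow>
    Rd_prob.wvar (law d p) d f s x w \<le> (1 + C * (\<alpha> + f\<^sup>2 / s\<^sup>2) powr (- \<beta> / 4)) / (\<alpha> + f\<^sup>2 / s\<^sup>2)"
proof -
  obtain C where C: "C \<ge> 0" "\<And>\<kappa> V. \<kappa> \<ge> \<alpha> \<Longrightarrow>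
    (\<And>h. h > 0 \<Longrightarrow> h\<^sup>2 * V \<le> exp ((K * \<kappa> powr (- \<beta> / 2) + h)\<^sup>2 + 2 * (K * \<kappa> powr (- \<beta> / 2))) - 1) \<Longrightarrow>
    V \<le> 1 + C * \<kappa> powr (- \<beta> / 4)"
    using tilt_optimization[OF assms(1-3)] by (elim exE conjE) (rule that, assumption, blast)
  show ?thesis
  proof (intro exI[of _ C] conjI C(1) allI impI)
    fix d p and f s :: real and x w :: "nat \<Rightarrow> real"
    assume p: "weakly_log_concave d \<alpha> \<beta> K p" and fs: "f > 0" "s > 0" and w: "(\<Sum>i<d. (w i)\<^sup>2) = 1"
    define P where "P = law d p"
    define \<kappa> where "\<kappa> = \<alpha> + f\<^sup>2 / s\<^sup>2"
    have pd: "prob_density d p" using p unfolding weakly_log_concave_def by (rule conjunct1)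
    interpret Rd_prob P d unfolding P_def by (rule Rd_prob_density[OF pd])
    define k where "k = gauss_kernel d f s x"
    define Z where "Z = (LINT y|P. k y)"
    define m1 where "m1 = (LINT y|P. k y * dot d w y)"
    define m2 where "m2 = (LINT y|P. k y * (dot d w y)\<^sup>2)"
    have Z: "Z > 0" unfolding Z_def k_def by (rule kernel_integral_pos)
    have \<kappa>: "\<kappa> \<ge> \<alpha>" "\<kappa> > 0" unfolding \<kappa>_def using assms(1) by (auto intro!: add_pos_nonneg)
    \<comment> \<open>The posterior variance in units of 1 / \<kappa>; a tilt of size h * sqrt
      \<kappa> then produces h^2 * V.\<close>
    define V where "V = \<kappa> * ((Z * m2 - m1\<^sup>2) / Z\<^sup>2)"
    have "V \<le> 1 + C * \<kappa> powr (- \<beta> / 4)"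
    proof (rule C(2)[OF \<kappa>(1)])
      fix h :: real assume h: "h > 0"
      define E where "E = (K * \<kappa> powr (- \<beta> / 2) + h)\<^sup>2 + 2 * (K * \<kappa> powr (- \<beta> / 2))"
      define t where "t = h * sqrt \<kappa>"
      have t2: "t\<^sup>2 = h\<^sup>2 * \<kappa>" using \<kappa>(2) by (simp add: t_def power_mult_distrib)
      have "Z\<^sup>2 + t\<^sup>2 * (Z * m2 - m1\<^sup>2) \<le> (LINT y|P. k y * exp (t * dot d w y)) * (LINT y|P. k y * exp (- t * dot d w y))"
        unfolding Z_def m1_def m2_def
      proof (rule variance_le_exp_moments)
        show "integrable P (\<lambda>y. k y * (dot d w y)\<^sup>2)"
          using integrable_kernel_dot(5)[OF fs, of x w w] unfolding k_def power2_eq_square by (simp only: mult.assoc)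
      qed (unfold k_def, (intro integrable_kernel_dot[OF fs] less_imp_le[OF gauss_kernel_pos])+)
      also have "\<dots> \<le> exp E * Z\<^sup>2"
        using posterior_tilt_product[OF p assms fs h w, of x]
        unfolding P_def[symmetric] \<kappa>_def[symmetric] k_def[symmetric] t_def[symmetric] E_def[symmetric] Z_def[symmetric] .
      finally have "t\<^sup>2 * (Z * m2 - m1\<^sup>2) \<le> (exp E - 1) * Z\<^sup>2" by (simp add: left_diff_distrib)
      then have "t\<^sup>2 * (Z * m2 - m1\<^sup>2) / Z\<^sup>2 \<le> exp E - 1" using Z by (simp add: pos_divide_le_eq)
      then show "h\<^sup>2 * V \<le> exp ((K * \<kappa> powr (- \<beta> / 2) + h)\<^sup>2 + 2 * (K * \<kappa> powr (- \<beta> / 2))) - 1"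
        unfolding V_def t2 E_def by (simp only: mult.assoc times_divide_eq_right)
    qed
    moreover have "V = \<kappa> * wvar f s x w"
    proof -
      have "(Z * m2 - m1\<^sup>2) / Z\<^sup>2 = m2 / Z - (m1 / Z)\<^sup>2"
        using Z by (simp add: diff_divide_distrib power_divide power2_eq_square[of Z])
      then show ?thesis unfolding V_def wvar_def wmean_def k_def m1_def m2_def Z_def by simp
    qed
    ultimately have "wvar f s x w \<le> (1 + C * \<kappa> powr (- \<beta> / 4)) / \<kappa>"
      using \<kappa>(2) by (simp add: pos_le_divide_eq mult.commute)
    then show "Rd_prob.wvar (law d p) d f s x w \<le> (1 + C * (\<alpha> + f\<^sup>2 / s\<^sup>2) powr (- \<beta> / 4)) / (\<alpha> + f\<^sup>2 / s\<^sup>2)"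
      unfolding P_def \<kappa>_def .
  qed
qed

section \<open>Largest eigenvalue of the symmetric part\<close>

text \<open>\<open>lambda_max\<close> is a \<open>Max\<close>, about which nothing can be said on an
  empty set. A complex eigenvalue exists, it is real because the matrix is Hermitian, and the real
  or the imaginary part of its eigenvector is a real eigenvector.\<close>

lemma symmetric_real_eigenvalue_exists:
  fixes S :: "real mat"
  assumes S: "S \<in> carrier_mat d d" and sym: "\<And>i j. i < d \<Longrightarrow> j < d \<Longrightarrow> S $$ (i, j) = S $$ (j, i)" and d: "0 < d"
  shows "\<exists>r. eigenvalue S r"
proof -
  define C where "C = map_mat complex_of_real S"
  have C: "C \<in> carrier_mat d d" using S by (simp add: C_def)
  obtain k where "k \<in> spectrum C" using spectrum_non_empty[OF C d] by auto
  then obtain v where v: "v \<in> carrier_vec d" "v \<noteq> 0\<^sub>v d" "C *\<^sub>v v = k \<cdot>\<^sub>v v"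
    using C unfolding spectrum_def eigenvalue_def eigenvector_def by auto
  have row: "(\<Sum>j<d. complex_of_real (S $$ (i, j)) * v $ j) = k * v $ i" if i: "i < d" for i
  proof -
    have "(C *\<^sub>v v) $ i = (\<Sum>j<d. complex_of_real (S $$ (i, j)) * v $ j)"
      using i v(1) S C by (simp add: scalar_prod_def C_def lessThan_atLeast0)
    then show ?thesis unfolding v(3) using i v(1) by simp
  qed
  \<comment> \<open>The Hermitian form at the eigenvector: it equals its own conjugate by symmetry,
    and it equals \<open>k\<close> times the squared norm.\<close>
  define Q where "Q = (\<Sum>i<d. \<Sum>j<d. complex_of_real (S $$ (i, j)) * (cnj (v $ i) * v $ j))"
  define n where "n = (\<Sum>i<d. (cmod (v $ i))\<^sup>2)"
  have Q1: "Q = k * complex_of_real n"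
  proof -
    have "Q = (\<Sum>i<d. cnj (v $ i) * (\<Sum>j<d. complex_of_real (S $$ (i, j)) * v $ j))"
      unfolding Q_def sum_distrib_left by (intro sum.cong refl) simp
    also have "\<dots> = (\<Sum>i<d. k * complex_of_real ((cmod (v $ i))\<^sup>2))"
    proof (intro sum.cong refl)
      fix i assume "i \<in> {..<d}"
      then have "cnj (v $ i) * (\<Sum>j<d. complex_of_real (S $$ (i, j)) * v $ j) = cnj (v $ i) * (k * v $ i)"
        using row[of i] by (simp only: lessThan_iff)
      also have "\<dots> = k * complex_of_real ((cmod (v $ i))\<^sup>2)"
        unfolding complex_norm_square by (simp only: ac_simps)
      finally show "cnj (v $ i) * (\<Sum>j<d. complex_of_real (S $$ (i, j)) * v $ j) = k * complex_of_real ((cmod (v $ i))\<^sup>2)" .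
    qed
    finally show ?thesis by (simp add: n_def sum_distrib_left)
  qed
  have "cnj Q = (\<Sum>i<d. \<Sum>j<d. complex_of_real (S $$ (j, i)) * (cnj (v $ j) * v $ i))"
    unfolding Q_def cnj_sum by (intro sum.cong refl) (simp add: sym mult.commute)
  also have "\<dots> = Q" unfolding Q_def by (rule sum.swap)
  finally have Qr: "cnj Q = Q" .
  have n: "n > 0"
  proof -
    obtain i where i: "i < d" "v $ i \<noteq> 0"
      using v(1,2) by (metis carrier_vecD eq_vecI index_zero_vec(1) index_zero_vec(2))
    have "0 < (cmod (v $ i))\<^sup>2" using i by simp
    also have "\<dots> \<le> n" unfolding n_def using i by (intro member_le_sum) auto
    finally show ?thesis .
  qed
  have "cnj k * complex_of_real n = k * complex_of_real n"
    using Qr unfolding Q1 by simp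
  then have "cnj k = k" using n by simp
  then obtain r where r: "k = complex_of_real r" by (metis Reals_cnj_iff Reals_cases)
  have ReIm: "(\<Sum>j<d. S $$ (i, j) * Re (v $ j)) = r * Re (v $ i)" "(\<Sum>j<d. S $$ (i, j) * Im (v $ j)) = r * Im (v $ i)" if "i < d" for i
    using arg_cong[OF row[OF that], of Re] arg_cong[OF row[OF that], of Im] by (simp_all add: r)
  have ev: "eigenvalue S r" if w: "\<And>i. i < d \<Longrightarrow> (\<Sum>j<d. S $$ (i, j) * w j) = r * w i" "i0 < d" "w i0 \<noteq> 0" for w i0
  proof -
    have "S *\<^sub>v vec d w = r \<cdot>\<^sub>v vec d w"
    proof (rule eq_vecI)
      fix i assume "i < dim_vec (r \<cdot>\<^sub>v vec d w)"
      then have i: "i < d" by simp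
      have "(S *\<^sub>v vec d w) $ i = (\<Sum>j<d. S $$ (i, j) * w j)"
        using i S by (simp add: scalar_prod_def lessThan_atLeast0)
      then show "(S *\<^sub>v vec d w) $ i = (r \<cdot>\<^sub>v vec d w) $ i" using w(1)[OF i] i by simp
    qed (use S in simp)
    moreover have "vec d w \<noteq> 0\<^sub>v d"
    proof
      assume "vec d w = 0\<^sub>v d"
      then have "vec d w $ i0 = 0\<^sub>v d $ i0" by simp
      then show False using w(2,3) by simp
    qed
    ultimately show ?thesis using S unfolding eigenvalue_def eigenvector_def by (intro exI[of _ "vec d w"]) simp
  qed
  obtain i where i: "i < d" "v $ i \<noteq> 0"
    using v(1,2) by (metis carrier_vecD eq_vecI index_zero_vec(1) index_zero_vec(2))
  then have "Re (v $ i) \<noteq> 0 \<or> Im (v $ i) \<noteq> 0" by (simp add: complex_eq_iff)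
  then show ?thesis
  proof
    assume "Re (v $ i) \<noteq> 0"
    then show ?thesis using ev[of "\<lambda>j. Re (v $ j)" i] ReIm(1) i(1) by blast
  next
    assume "Im (v $ i) \<noteq> 0"
    then show ?thesis using ev[of "\<lambda>j. Im (v $ j)" i] ReIm(2) i(1) by blast
  qed
qed

text \<open>An eigenvalue of the symmetric part is the value of the quadratic form of
  \<open>A\<close> at a unit eigenvector, to which the antisymmetric part contributes
  nothing.\<close>

lemma lambda_max_le:
  fixes A :: "real mat"
  assumes A: "A \<in> carrier_mat d d" and d: "0 < d"
    and B: "\<And>w :: nat \<Rightarrow> real. (\<Sum>i<d. (w i)\<^sup>2) = 1 \<Longrightarrow> (\<Sum>i<d. \<Sum>j<d. w i * w j * A $$ (i, j)) \<le> B"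
  shows "lambda_max A \<le> B"
proof -
  define S where "S = (1/2) \<cdot>\<^sub>m (A + transpose_mat A)"
  have S: "S \<in> carrier_mat d d" using A by (simp add: S_def)
  have Sij: "S $$ (i, j) = (A $$ (i, j) + A $$ (j, i)) / 2" if "i < d" "j < d" for i j
    using A that by (simp add: S_def)
  have fin: "finite {k. eigenvalue S k}" using card_finite_spectrum(1)[OF S] by (simp add: spectrum_def)
  have ne: "{k. eigenvalue S k} \<noteq> {}"
    using symmetric_real_eigenvalue_exists[OF S _ d] Sij by (auto simp: add.commute)
  have le: "k \<le> B" if k: "eigenvalue S k" for k
  proof -
    obtain v where v: "v \<in> carrier_vec d" "v \<noteq> 0\<^sub>v d" "S *\<^sub>v v = k \<cdot>\<^sub>v v"
      using k S unfolding eigenvalue_def eigenvector_def by auto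
    have row: "(\<Sum>j<d. S $$ (i, j) * v $ j) = k * v $ i" if i: "i < d" for i
    proof -
      have "(S *\<^sub>v v) $ i = (\<Sum>j<d. S $$ (i, j) * v $ j)"
        using i v(1) S by (simp add: scalar_prod_def lessThan_atLeast0)
      then show ?thesis unfolding v(3) using i v(1) by simp
    qed
    define n where "n = (\<Sum>i<d. (v $ i)\<^sup>2)"
    have n: "n > 0"
    proof -
      obtain i where i: "i < d" "v $ i \<noteq> 0"
        using v(1,2) by (metis carrier_vecD eq_vecI index_zero_vec(1) index_zero_vec(2))
      have "0 < (v $ i)\<^sup>2" using i by simp
      also have "\<dots> \<le> n" unfolding n_def using i by (intro member_le_sum) auto
      finally show ?thesis .
    qed
    define q where "q i j = v $ i * v $ j * A $$ (i, j)" for i j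
    have "k * n = (\<Sum>i<d. v $ i * (\<Sum>j<d. S $$ (i, j) * v $ j))"
      unfolding n_def sum_distrib_left[of k] by (intro sum.cong refl) (simp add: row power2_eq_square)
    also have "\<dots> = (\<Sum>i<d. \<Sum>j<d. (q i j + q j i) / 2)"
      unfolding sum_distrib_left by (intro sum.cong refl) (simp add: Sij q_def algebra_simps)
    also have "\<dots> = ((\<Sum>i<d. \<Sum>j<d. q i j) + (\<Sum>i<d. \<Sum>j<d. q j i)) / 2"
      by (simp add: sum.distrib sum_divide_distrib add_divide_distrib)
    also have "(\<Sum>i<d. \<Sum>j<d. q j i) = (\<Sum>i<d. \<Sum>j<d. q i j)" by (rule sum.swap)
    finally have kn: "k * n = (\<Sum>i<d. \<Sum>j<d. q i j)" by simp
    have "(\<Sum>i<d. \<Sum>j<d. v $ i / sqrt n * (v $ j / sqrt n) * A $$ (i, j)) \<le> B"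
    proof (rule B)
      have "(\<Sum>i<d. (v $ i / sqrt n)\<^sup>2) = n / n"
        unfolding n_def[symmetric] using n by (simp add: power_divide sum_divide_distrib[symmetric] n_def[symmetric])
      then show "(\<Sum>i<d. (v $ i / sqrt n)\<^sup>2) = 1" using n by simp
    qed
    also have "(\<Sum>i<d. \<Sum>j<d. v $ i / sqrt n * (v $ j / sqrt n) * A $$ (i, j)) = (\<Sum>i<d. \<Sum>j<d. q i j / n)"
    proof (intro sum.cong refl)
      fix i j
      have "sqrt n * sqrt n = n" using n by simp
      then show "v $ i / sqrt n * (v $ j / sqrt n) * A $$ (i, j) = q i j / n" by (simp add: q_def)
    qed
    also have "\<dots> = k" using n by (simp add: sum_divide_distrib[symmetric] kn[symmetric])
    finally show ?thesis .
  qed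
  have "lambda_max A = Max {k. eigenvalue S k}" unfolding lambda_max_def S_def ..
  also have "\<dots> \<le> B" using fin ne le by (intro Max.boundedI) auto
  finally show ?thesis .
qed

section \<open>The velocity field and its Jacobian\<close>

text \<open>Gaussian conjugacy: prior times likelihood is the marginal, of variance s^2 = g^2 +
  \<sigma>^2, times the posterior, with mean g r / s^2 and deviation \<sigma> / s.\<close>

lemma std_normal_likelihood:
  fixes r g \<sigma> s z :: real
  assumes "\<sigma> > 0" "s > 0" "s\<^sup>2 = g\<^sup>2 + \<sigma>\<^sup>2"
  shows "std_normal_density z * exp (- (r - g * z)\<^sup>2 / (2 * \<sigma>\<^sup>2)) =
    \<sigma> / s * exp (- r\<^sup>2 / (2 * s\<^sup>2)) * normal_density (g * r / s\<^sup>2) (\<sigma> / s) z"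
proof -
  define S where "S = s\<^sup>2"
  define T where "T = \<sigma>\<^sup>2"
  have S: "S > 0" "S = g\<^sup>2 + T" and T: "T > 0"
    using assms(1) zero_less_power[OF assms(2), of 2] assms(3) by (simp_all only: S_def T_def zero_less_power)
  have "- z\<^sup>2 / 2 + - (r - g * z)\<^sup>2 / (2 * T) = - r\<^sup>2 / (2 * S) + - (z - g * r / S)\<^sup>2 / (2 * (T / S))"
  proof -
    have "(- z\<^sup>2 / 2 + - (r - g * z)\<^sup>2 / (2 * T)) * (2 * T * S) = - z\<^sup>2 * T * S - (r - g * z)\<^sup>2 * S"
      using S(1) T by (simp add: field_simps)
    also have "\<dots> = - r\<^sup>2 * T - (S * z - g * r)\<^sup>2"
      unfolding S(2) by (simp add: power2_eq_square algebra_simps)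
    also have "\<dots> = (- r\<^sup>2 / (2 * S) + - (z - g * r / S)\<^sup>2 / (2 * (T / S))) * (2 * T * S)"
    proof -
      have "z - g * r / S = (S * z - g * r) / S" using S(1) by (simp add: diff_divide_distrib)
      then have "(z - g * r / S)\<^sup>2 = (S * z - g * r)\<^sup>2 / (S * S)" by (simp add: power_divide power2_eq_square)
      then have "- (z - g * r / S)\<^sup>2 / (2 * (T / S)) * (2 * T * S) = - (S * z - g * r)\<^sup>2"
        using S(1) T by simp
      moreover have "- r\<^sup>2 / (2 * S) * (2 * T * S) = - r\<^sup>2 * T" using S(1) by simp
      ultimately show ?thesis unfolding distrib_right by simp
    qed
    finally show ?thesis using S(1) T by simp
  qed
  then have ex: "exp (- z\<^sup>2 / 2) * exp (- (r - g * z)\<^sup>2 / (2 * \<sigma>\<^sup>2)) =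
      exp (- r\<^sup>2 / (2 * s\<^sup>2)) * exp (- (z - g * r / s\<^sup>2)\<^sup>2 / (2 * (\<sigma> / s)\<^sup>2))"
    unfolding exp_add[symmetric] S_def[symmetric] T_def[symmetric] power_divide by simp
  have "sqrt (2 * pi * (\<sigma> / s)\<^sup>2) = sqrt (2 * pi) * (\<sigma> / s)"
    using assms(1,2) by (simp add: real_sqrt_mult real_sqrt_divide)
  then have c: "\<sigma> / s * (1 / sqrt (2 * pi * (\<sigma> / s)\<^sup>2)) = 1 / sqrt (2 * pi)"
    using assms(1,2) by simp
  have "std_normal_density z * exp (- (r - g * z)\<^sup>2 / (2 * \<sigma>\<^sup>2)) =
      1 / sqrt (2 * pi) * (exp (- z\<^sup>2 / 2) * exp (- (r - g * z)\<^sup>2 / (2 * \<sigma>\<^sup>2)))"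
    by (simp add: std_normal_density_def)
  also have "\<dots> = \<sigma> / s * (1 / sqrt (2 * pi * (\<sigma> / s)\<^sup>2)) *
      (exp (- r\<^sup>2 / (2 * s\<^sup>2)) * exp (- (z - g * r / s\<^sup>2)\<^sup>2 / (2 * (\<sigma> / s)\<^sup>2)))"
    unfolding ex c ..
  also have "\<dots> = \<sigma> / s * exp (- r\<^sup>2 / (2 * s\<^sup>2)) * normal_density (g * r / s\<^sup>2) (\<sigma> / s) z"
    unfolding normal_density_def by (simp only: ac_simps)
  finally show ?thesis .
qed

abbreviation std_normal :: "real measure" where
  "std_normal \<equiv> density lborel (\<lambda>x. ennreal (std_normal_density x))"

lemma std_normal_likelihood_integrals:
  fixes r g \<sigma> s :: real
  assumes "\<sigma> > 0" "s > 0" "s\<^sup>2 = g\<^sup>2 + \<sigma>\<^sup>2"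
  defines "l \<equiv> \<lambda>z. exp (- (r - g * z)\<^sup>2 / (2 * \<sigma>\<^sup>2))"
  shows "integrable std_normal l" "integrable std_normal (\<lambda>z. z * l z)"
    "(LINT z|std_normal. l z) = \<sigma> / s * exp (- r\<^sup>2 / (2 * s\<^sup>2))"
    "(LINT z|std_normal. z * l z) = \<sigma> / s * exp (- r\<^sup>2 / (2 * s\<^sup>2)) * (g * r / s\<^sup>2)"
proof -
  define c where "c = \<sigma> / s * exp (- r\<^sup>2 / (2 * s\<^sup>2))"
  define \<mu> where "\<mu> = g * r / s\<^sup>2"
  have \<tau>: "\<sigma> / s > 0" using assms(1,2) by simp
  have eq: "std_normal_density z *\<^sub>R l z = c * normal_density \<mu> (\<sigma> / s) z"
    "std_normal_density z *\<^sub>R (z * l z) = c * (normal_density \<mu> (\<sigma> / s) z * z)" for z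
    unfolding l_def c_def \<mu>_def using std_normal_likelihood[OF assms(1-3), of z r] by (simp_all add: mult.left_commute mult.commute)
  have lm: "l \<in> borel_measurable lborel" "(\<lambda>z. z * l z) \<in> borel_measurable lborel" unfolding l_def by simp_all
  have dm: "(\<lambda>x. std_normal_density x) \<in> borel_measurable lborel" by simp
  have nn: "AE x in lborel. 0 \<le> std_normal_density x" by simp
  show "integrable std_normal l"
    unfolding integrable_density[OF lm(1) dm nn] eq by (intro integrable_mult_right integrable_normal_density \<tau>)
  show "integrable std_normal (\<lambda>z. z * l z)"
    unfolding integrable_density[OF lm(2) dm nn] eq by (intro integrable_mult_right integrable_normal_moment_nz_1 \<tau>)
  show "(LINT z|std_normal. l z) = \<sigma> / s * exp (- r\<^sup>2 / (2 * s\<^sup>2))"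
    unfolding integral_density[OF lm(1) dm nn] eq by (simp add: integral_normal_density[OF \<tau>] c_def)
  show "(LINT z|std_normal. z * l z) = \<sigma> / s * exp (- r\<^sup>2 / (2 * s\<^sup>2)) * (g * r / s\<^sup>2)"
    unfolding integral_density[OF lm(2) dm nn] eq by (simp add: integral_normal_moment_nz_1[OF \<tau>] c_def \<mu>_def)
qed

lemma product_sigma_finite_std_normal: "product_sigma_finite (\<lambda>_. std_normal)"
  by (intro product_sigma_finite.intro prob_space_imp_sigma_finite prob_space_normal_density) simp

lemma likelihood_eq_prod:
  "likelihood d f g \<sigma> t x (z, y) = (\<Prod>i<d. exp (- ((x i - f t * y i) - g t * z i)\<^sup>2 / (2 * (\<sigma> t)\<^sup>2)))"
proof -
  have "(Rd_norm d (lincomb d 1 x (-1) (interpolant d f g t (z, y))))\<^sup>2 = (\<Sum>i<d. ((x i - f t * y i) - g t * z i)\<^sup>2)"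
    unfolding Rd_norm_diff_sq interpolant_def by (intro sum.cong refl) (simp add: lincomb_def algebra_simps)
  then show ?thesis
    unfolding likelihood_def by (simp add: exp_sum[symmetric] sum_negf sum_divide_distrib)
qed

lemma gaussian_marginal:
  fixes f g \<sigma> :: "real \<Rightarrow> real"
  assumes s: "\<sigma> t > 0" "s > 0" "s\<^sup>2 = (g t)\<^sup>2 + (\<sigma> t)\<^sup>2" and i: "i < d"
  shows "(LINT z|std_gaussian d. likelihood d f g \<sigma> t x (z, y)) = (\<sigma> t / s) ^ d * gauss_kernel d (f t) s x y"
    "(LINT z|std_gaussian d. likelihood d f g \<sigma> t x (z, y) * z i) =
      (\<sigma> t / s) ^ d * gauss_kernel d (f t) s x y * (g t * (x i - f t * y i) / s\<^sup>2)"
proof -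
  define r where "r j = x j - f t * y j" for j
  define l where "l j z = exp (- (r j - g t * z)\<^sup>2 / (2 * (\<sigma> t)\<^sup>2))" for j z
  note I = std_normal_likelihood_integrals[OF s, where r = "r _", folded l_def]
  have L: "likelihood d f g \<sigma> t x (z, y) = (\<Prod>j<d. l j (z j))" for z
    unfolding likelihood_eq_prod l_def r_def ..
  have K: "(\<Prod>j<d. \<sigma> t / s * exp (- (r j)\<^sup>2 / (2 * s\<^sup>2))) = (\<sigma> t / s) ^ d * gauss_kernel d (f t) s x y"
    unfolding prod.distrib gauss_kernel_def r_def by (simp add: exp_sum)
  have "(LINT z|std_gaussian d. likelihood d f g \<sigma> t x (z, y)) = (\<Prod>j<d. LINT z|std_normal. l j z)"
    unfolding L std_gaussian_def
    by (rule product_sigma_finite.product_integral_prod[OF product_sigma_finite_std_normal]) (simp_all add: I)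
  then show "(LINT z|std_gaussian d. likelihood d f g \<sigma> t x (z, y)) = (\<sigma> t / s) ^ d * gauss_kernel d (f t) s x y"
    unfolding I K .
  \<comment> \<open>The factor \<open>z i\<close> is moved into the \<open>i\<close>-th factor of
    the product, so that the integral still splits over coordinates.\<close>
  define l' where "l' j z = (if j = i then z * l j z else l j z)" for j z
  have il: "integrable std_normal (l' j)" for j
    unfolding l'_def[abs_def] by (cases "j = i") (simp_all add: I)
  have L': "likelihood d f g \<sigma> t x (z, y) * z i = (\<Prod>j<d. l' j (z j))" for z
    unfolding L l'_def prod.remove[of "{..<d}" i, OF finite_lessThan lessThan_iff[THEN iffD2, OF i]]
    by (simp add: mult.commute mult.left_commute)
  have "(LINT z|std_gaussian d. likelihood d f g \<sigma> t x (z, y) * z i) = (\<Prod>j<d. LINT z|std_normal. l' j z)"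
    unfolding L' std_gaussian_def
    by (rule product_sigma_finite.product_integral_prod[OF product_sigma_finite_std_normal]) (simp_all add: il)
  also have "\<dots> = (\<Prod>j<d. \<sigma> t / s * exp (- (r j)\<^sup>2 / (2 * s\<^sup>2)) * (if j = i then g t * r j / s\<^sup>2 else 1))"
    by (intro prod.cong refl) (simp add: l'_def I)
  also have "\<dots> = (\<sigma> t / s) ^ d * gauss_kernel d (f t) s x y * (g t * r i / s\<^sup>2)"
    unfolding prod.distrib[where h = "\<lambda>j. if j = i then _ j else 1"] K using i by simp
  finally show "(LINT z|std_gaussian d. likelihood d f g \<sigma> t x (z, y) * z i) =
      (\<sigma> t / s) ^ d * gauss_kernel d (f t) s x y * (g t * (x i - f t * y i) / s\<^sup>2)" unfolding r_def .
qed

text \<open>In the variable a = |v| / \<sigma> this is a \<le> 1 + a^2 / 2 \<le> exp (a^2 /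
  2).\<close>

lemma abs_mult_gaussian_le: "\<bar>v\<bar> * exp (- v\<^sup>2 / (2 * \<sigma>\<^sup>2)) \<le> \<sigma>" if "\<sigma> > 0" for v \<sigma> :: real
proof -
  define a where "a = \<bar>v\<bar> / \<sigma>"
  have a: "0 \<le> a" and va: "\<bar>v\<bar> = \<sigma> * a" using that by (simp_all add: a_def)
  have "v\<^sup>2 / (2 * \<sigma>\<^sup>2) = a\<^sup>2 / 2" using that by (simp add: a_def power_divide)
  then have e: "exp (- v\<^sup>2 / (2 * \<sigma>\<^sup>2)) = inverse (exp (a\<^sup>2 / 2))" by (simp add: exp_minus)
  have "0 \<le> (a - 1)\<^sup>2" by simp
  then have "2 * a \<le> a\<^sup>2 + 1" by (simp add: power2_eq_square algebra_simps)
  then have "2 * a \<le> 2 * (1 + a\<^sup>2 / 2)" by simp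
  then have "a \<le> 1 + a\<^sup>2 / 2" by (simp only: mult_le_cancel_left_pos zero_less_numeral)
  also have "\<dots> \<le> exp (a\<^sup>2 / 2)" by (rule exp_ge_add_one_self)
  finally have "a * inverse (exp (a\<^sup>2 / 2)) \<le> 1" by (simp add: divide_inverse[symmetric])
  then have "\<sigma> * (a * inverse (exp (a\<^sup>2 / 2))) \<le> \<sigma> * 1" using that by (intro mult_left_mono) auto
  then show ?thesis unfolding e va by simp
qed

lemma likelihood_le:
  assumes "i < d"
  shows "likelihood d f g \<sigma> t x (z, y) \<le> exp (- ((x i - f t * y i) - g t * z i)\<^sup>2 / (2 * (\<sigma> t)\<^sup>2))"
    "likelihood d f g \<sigma> t x (z, y) \<le> 1" "0 < likelihood d f g \<sigma> t x (z, y)"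
proof -
  let ?e = "\<lambda>i. exp (- ((x i - f t * y i) - g t * z i)\<^sup>2 / (2 * (\<sigma> t)\<^sup>2))"
  have e: "0 \<le> ?e j \<and> ?e j \<le> 1" for j by simp
  have "(\<Prod>j<d. ?e j) = ?e i * (\<Prod>j\<in>{..<d} - {i}. ?e j)" using assms by (intro prod.remove) auto
  also have "\<dots> \<le> ?e i * 1" by (intro mult_left_mono prod_le_1 e) simp
  finally show "likelihood d f g \<sigma> t x (z, y) \<le> ?e i" unfolding likelihood_eq_prod by simp
  show "likelihood d f g \<sigma> t x (z, y) \<le> 1" unfolding likelihood_eq_prod by (intro prod_le_1 e)
  show "0 < likelihood d f g \<sigma> t x (z, y)" by (simp add: likelihood_def)
qed

section \<open>Integrals against the likelihood\<close>

context Rd_prob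
begin

lemma pair_std_gaussian: "pair_prob_space (std_gaussian d) P"
  by (intro pair_prob_space.intro pair_sigma_finite.intro prob_space_imp_sigma_finite prob_std_gaussian prob_space_axioms)

lemma meas_pair_components:
  assumes "i < d"
  shows "(\<lambda>q. fst q i) \<in> borel_measurable (std_gaussian d \<Otimes>\<^sub>M P)" "(\<lambda>q. snd q i) \<in> borel_measurable (std_gaussian d \<Otimes>\<^sub>M P)"
  by (rule measurable_compose[OF measurable_fst component_meas[OF measurable_ident_sets[OF sets_std_gaussian] assms]])
    (rule measurable_compose[OF measurable_snd meas_component[OF assms]])

lemma meas_likelihood: "(\<lambda>q. likelihood d f g \<sigma> t x q) \<in> borel_measurable (std_gaussian d \<Otimes>\<^sub>M P)"
proof -
  have "(\<lambda>q. \<Prod>i<d. exp (- ((x i - f t * snd q i) - g t * fst q i)\<^sup>2 / (2 * (\<sigma> t)\<^sup>2))) \<in> borel_measurable (std_gaussian d \<Otimes>\<^sub>M P)"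
    by (intro borel_measurable_prod measurable_compose[OF _ borel_measurable_exp] borel_measurable_divide
        borel_measurable_uminus borel_measurable_power borel_measurable_diff borel_measurable_times
        borel_measurable_const meas_pair_components) simp_all
  moreover have "likelihood d f g \<sigma> t x = (\<lambda>q. \<Prod>i<d. exp (- ((x i - f t * snd q i) - g t * fst q i)\<^sup>2 / (2 * (\<sigma> t)\<^sup>2)))"
    by (rule ext) (metis likelihood_eq_prod prod.collapse)
  ultimately show ?thesis by (simp only:)
qed

text \<open>The locale gives no moments of Y. The residual x - f y - g z times the likelihood is
  bounded, the Gaussian \<open>z\<close> is integrable, and together they control x - f y.\<close>

lemma integrable_likelihood:
  assumes \<sigma>: "\<sigma> t > 0" and i: "i < d"
  shows "integrable (std_gaussian d \<Otimes>\<^sub>M P) (\<lambda>(z, y). likelihood d f g \<sigma> t x (z, y))"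
    "integrable (std_gaussian d \<Otimes>\<^sub>M P) (\<lambda>(z, y). likelihood d f g \<sigma> t x (z, y) * z i)"
    "integrable (std_gaussian d \<Otimes>\<^sub>M P) (\<lambda>(z, y). likelihood d f g \<sigma> t x (z, y) * (x i - f t * y i))"
proof -
  note Pprob = prob_space_axioms
  interpret pair_prob_space "std_gaussian d" P by (rule pair_std_gaussian)
  let ?M = "std_gaussian d \<Otimes>\<^sub>M P"
  have Lm: "(\<lambda>(z, y). likelihood d f g \<sigma> t x (z, y)) \<in> borel_measurable ?M"
    using meas_likelihood by (simp add: split_beta')
  note cm = meas_pair_components[OF i]
  show iL: "integrable ?M (\<lambda>(z, y). likelihood d f g \<sigma> t x (z, y))"
    by (rule P.integrable_const_bound[OF _ Lm, of 1]) (auto intro!: AE_I2 simp: likelihood_le(2)[OF i] less_imp_le[OF likelihood_le(3)[OF i]])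
  have zi: "integrable ?M (\<lambda>(z, y). z i)"
  proof -
    have "integrable (std_gaussian d) (\<lambda>z. z i)"
    proof -
      have "integrable std_normal (\<lambda>z. z)"
        using integrable_normal_moment_nz_1[of 1 0] by (subst integrable_density) auto
      then have "integrable (Pi\<^sub>M {..<d} (\<lambda>_. std_normal)) (\<lambda>z. \<Prod>j<d. if j = i then z j else 1)"
      proof (intro product_sigma_finite.product_integrable_prod[OF product_sigma_finite_std_normal, where f = "\<lambda>j z. if j = i then z else 1"] finite_lessThan)
        show "integrable std_normal (\<lambda>z. if j = i then z else 1)" for j
          using \<open>integrable std_normal (\<lambda>z. z)\<close>
          by (cases "j = i") (auto intro!: finite_measure.integrable_const prob_space.finite_measure prob_space_normal_density)
      qed
      then show ?thesis using i unfolding std_gaussian_def by simp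
    qed
    then have "integrable (distr ?M (std_gaussian d) fst) (\<lambda>z. z i)"
      unfolding prob_space.distr_pair_fst[OF Pprob] .
    from integrable_distr[OF measurable_fst this] show ?thesis by (simp add: split_beta')
  qed
  show iz: "integrable ?M (\<lambda>(z, y). likelihood d f g \<sigma> t x (z, y) * z i)"
  proof (rule Bochner_Integration.integrable_bound[OF zi])
    show "(\<lambda>(z, y). likelihood d f g \<sigma> t x (z, y) * z i) \<in> borel_measurable ?M"
      using borel_measurable_times[OF meas_likelihood cm(1)] by (simp add: split_beta')
    show "AE q in ?M. norm (case q of (z, y) \<Rightarrow> likelihood d f g \<sigma> t x (z, y) * z i) \<le> norm (case q of (z, y) \<Rightarrow> z i)"
      using likelihood_le(2,3)[OF i] by (intro AE_I2) (auto simp: abs_mult less_imp_le intro!: mult_left_le_one_le)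
  qed
  have iv: "integrable ?M (\<lambda>(z, y). likelihood d f g \<sigma> t x (z, y) * ((x i - f t * y i) - g t * z i))"
  proof (rule P.integrable_const_bound[of _ "\<sigma> t"])
    show "(\<lambda>(z, y). likelihood d f g \<sigma> t x (z, y) * ((x i - f t * y i) - g t * z i)) \<in> borel_measurable ?M"
    proof -
      have "(\<lambda>q. likelihood d f g \<sigma> t x q * ((x i - f t * snd q i) - g t * fst q i)) \<in> borel_measurable ?M"
        by (intro borel_measurable_times borel_measurable_diff borel_measurable_const cm meas_likelihood)
      then show ?thesis by (simp add: split_beta')
    qed
    have "\<bar>likelihood d f g \<sigma> t x (z, y) * ((x i - f t * y i) - g t * z i)\<bar> \<le> \<sigma> t" for z y
    proof -
      let ?v = "(x i - f t * y i) - g t * z i"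
      have "\<bar>likelihood d f g \<sigma> t x (z, y) * ?v\<bar> = \<bar>?v\<bar> * likelihood d f g \<sigma> t x (z, y)"
        using likelihood_le(3)[OF i, of f g \<sigma> t x z y] by (simp add: abs_mult mult.commute)
      also have "\<dots> \<le> \<bar>?v\<bar> * exp (- ?v\<^sup>2 / (2 * (\<sigma> t)\<^sup>2))" by (intro mult_left_mono likelihood_le(1)[OF i]) simp
      also have "\<dots> \<le> \<sigma> t" by (rule abs_mult_gaussian_le[OF \<sigma>])
      finally show ?thesis .
    qed
    then have "norm (case q of (z, y) \<Rightarrow> likelihood d f g \<sigma> t x (z, y) * ((x i - f t * y i) - g t * z i)) \<le> \<sigma> t" for q
      unfolding real_norm_def by (cases q) (simp only: prod.case)
    then show "AE q in ?M. norm (case q of (z, y) \<Rightarrow> likelihood d f g \<sigma> t x (z, y) * ((x i - f t * y i) - g t * z i)) \<le> \<sigma> t"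
      by (rule AE_I2)
  qed
  have "integrable ?M (\<lambda>q. (case q of (z, y) \<Rightarrow> likelihood d f g \<sigma> t x (z, y) * ((x i - f t * y i) - g t * z i)) +
      g t * (case q of (z, y) \<Rightarrow> likelihood d f g \<sigma> t x (z, y) * z i))"
    by (intro Bochner_Integration.integrable_add integrable_mult_right iv iz)
  then show "integrable ?M (\<lambda>(z, y). likelihood d f g \<sigma> t x (z, y) * (x i - f t * y i))"
    by (rule Bochner_Integration.integrable_cong[THEN iffD1, rotated 2]) (auto simp: algebra_simps)
qed

lemma likelihood_integrals:
  fixes f g \<sigma> :: "real \<Rightarrow> real" and x :: "nat \<Rightarrow> real"
  assumes \<sigma>: "\<sigma> t > 0" "s > 0" "s\<^sup>2 = (g t)\<^sup>2 + (\<sigma> t)\<^sup>2" and i: "i < d"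
  defines "R \<equiv> LINT y|P. gauss_kernel d (f t) s x y * (x i - f t * y i)"
  shows "(LINT q|(std_gaussian d \<Otimes>\<^sub>M P). likelihood d f g \<sigma> t x q) = (\<sigma> t / s) ^ d * (LINT y|P. gauss_kernel d (f t) s x y)"
    "(LINT q|(std_gaussian d \<Otimes>\<^sub>M P). likelihood d f g \<sigma> t x q * fst q i) = (\<sigma> t / s) ^ d * (g t / s\<^sup>2 * R)"
    "(LINT q|(std_gaussian d \<Otimes>\<^sub>M P). likelihood d f g \<sigma> t x q * (x i - f t * snd q i)) = (\<sigma> t / s) ^ d * R"
proof -
  interpret pair_prob_space "std_gaussian d" P by (rule pair_std_gaussian)
  note L = integrable_likelihood[where \<sigma> = \<sigma> and t = t and f = f and g = g and x = x, OF \<sigma>(1) i]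
  note G = gaussian_marginal[where \<sigma> = \<sigma> and t = t and f = f and g = g and x = x, OF \<sigma> i]
  have "(LINT q|(std_gaussian d \<Otimes>\<^sub>M P). likelihood d f g \<sigma> t x q) = (LINT y|P. LINT z|std_gaussian d. likelihood d f g \<sigma> t x (z, y))"
    using integral_snd[OF L(1)] by (simp add: split_beta')
  then show "(LINT q|(std_gaussian d \<Otimes>\<^sub>M P). likelihood d f g \<sigma> t x q) = (\<sigma> t / s) ^ d * (LINT y|P. gauss_kernel d (f t) s x y)"
    unfolding G(1) by simp
  have "(LINT q|(std_gaussian d \<Otimes>\<^sub>M P). likelihood d f g \<sigma> t x q * fst q i) = (LINT y|P. LINT z|std_gaussian d. likelihood d f g \<sigma> t x (z, y) * z i)"
    using integral_snd[OF L(2)] by (simp add: split_beta')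
  also have "\<dots> = (LINT y|P. (\<sigma> t / s) ^ d * (g t / s\<^sup>2 * (gauss_kernel d (f t) s x y * (x i - f t * y i))))"
    unfolding G(2) by (intro Bochner_Integration.integral_cong refl) simp
  finally show "(LINT q|(std_gaussian d \<Otimes>\<^sub>M P). likelihood d f g \<sigma> t x q * fst q i) = (\<sigma> t / s) ^ d * (g t / s\<^sup>2 * R)"
    unfolding R_def by simp
  have "(LINT q|(std_gaussian d \<Otimes>\<^sub>M P). likelihood d f g \<sigma> t x q * (x i - f t * snd q i)) =
      (LINT y|P. LINT z|std_gaussian d. likelihood d f g \<sigma> t x (z, y) * (x i - f t * y i))"
    using integral_snd[OF L(3)] by (simp add: split_beta')
  also have "\<dots> = (LINT y|P. (\<sigma> t / s) ^ d * (gauss_kernel d (f t) s x y * (x i - f t * y i)))"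
  proof -
    have "(LINT z|std_gaussian d. likelihood d f g \<sigma> t x (z, y) * (x i - f t * y i)) =
        (\<sigma> t / s) ^ d * (gauss_kernel d (f t) s x y * (x i - f t * y i))" for y
      unfolding integral_mult_left_zero G(1) by simp
    then show ?thesis by (simp only:)
  qed
  finally show "(LINT q|(std_gaussian d \<Otimes>\<^sub>M P). likelihood d f g \<sigma> t x q * (x i - f t * snd q i)) = (\<sigma> t / s) ^ d * R"
    unfolding R_def by simp
qed

end

text \<open>Given Y = y, the Gaussian X_0 has conditional mean g (x - f y) / s^2. Every contribution
  thus depends on x - f y, and the posterior mean of Y is the only unknown left. Where f vanishes,
  so does f', and just the term A x survives.\<close>

lemma velocity_eq_wmean:
  fixes f g \<sigma> :: "real \<Rightarrow> real" and x :: "nat \<Rightarrow> real"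
  assumes pd: "prob_density d p" and \<sigma>: "\<sigma> t > 0" and i: "i < d"
    and f: "f t = 0 \<Longrightarrow> tderiv f t = 0" "0 \<le> f t"
  defines "P \<equiv> law d p"
  defines "s \<equiv> sqrt ((g t)\<^sup>2 + (\<sigma> t)\<^sup>2)"
  defines "A \<equiv> (g t * tderiv g t + \<sigma> t * tderiv \<sigma> t) / ((g t)\<^sup>2 + (\<sigma> t)\<^sup>2)"
  shows "velocity d p f g \<sigma> t x i = A * x i +
    (if f t = 0 then 0 else (tderiv f t - f t * A) * Rd_prob.wmean P d (f t) s x (\<lambda>y. y i))"
proof -
  interpret Rd_prob P d unfolding P_def by (rule Rd_prob_density[OF pd])
  have s2: "s\<^sup>2 = (g t)\<^sup>2 + (\<sigma> t)\<^sup>2" unfolding s_def by (rule real_sqrt_pow2) simp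
  have S0: "0 < (g t)\<^sup>2 + (\<sigma> t)\<^sup>2" using \<sigma> by (intro add_nonneg_pos) auto
  have s: "s > 0" unfolding s_def using S0 by simp
  let ?M = "std_gaussian d \<Otimes>\<^sub>M P"
  define L where "L = likelihood d f g \<sigma> t x"
  define k where "k = gauss_kernel d (f t) s x"
  define Z where "Z = (LINT y|P. k y)"
  define R where "R = (LINT y|P. k y * (x i - f t * y i))"
  define c0 where "c0 = (\<sigma> t / s) ^ d"
  define Zc where "Zc = (LINT q|?M. L q)"
  \<comment> \<open>Writes f' y as \<rho> x - \<rho> (x - f y), so that only residuals with a known
    integral occur. For f = 0 division by zero gives \<rho> = 0, consistent with f' = 0.\<close>
  define \<rho> where "\<rho> = tderiv f t / f t"
  define a where "a = tderiv \<sigma> t / \<sigma> t - \<rho>"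
  define b where "b = tderiv g t - tderiv \<sigma> t / \<sigma> t * g t"
  have \<rho>f: "\<rho> * f t = tderiv f t" using f(1) by (simp add: \<rho>_def)
  note LI = likelihood_integrals[where \<sigma> = \<sigma> and t = t and f = f and g = g and x = x and s = s, OF \<sigma> s s2 i, folded L_def k_def c0_def, folded R_def Z_def]
  have Z: "Z > 0" unfolding Z_def k_def by (rule kernel_integral_pos)
  have c0: "c0 > 0" unfolding c0_def using \<sigma> s by simp
  have Zc: "Zc = c0 * Z" unfolding Zc_def by (rule LI(1))
  have Zcp: "Zc > 0" unfolding Zc using c0 Z by simp
  have Lm: "L \<in> borel_measurable ?M" unfolding L_def by (rule meas_likelihood)
  have L0: "0 \<le> L q" for q unfolding L_def likelihood_def by simp
  note cm = meas_pair_components[OF i]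
  note IL = integrable_likelihood[where \<sigma> = \<sigma> and t = t and f = f and g = g and x = x, OF \<sigma> i]
  have I1: "integrable ?M L" and I2: "integrable ?M (\<lambda>q. L q * fst q i)" and I3: "integrable ?M (\<lambda>q. L q * (x i - f t * snd q i))"
    using IL unfolding L_def by (simp_all add: split_beta')
  define h where "h q = tderiv \<sigma> t / \<sigma> t * (x i - interpolant d f g t q i) + interpolant_deriv d f g t q i" for q
  have h: "h q = \<rho> * x i + a * (x i - f t * snd q i) + b * fst q i" for q
  proof -
    have "h q = tderiv \<sigma> t / \<sigma> t * (x i - (g t * fst q i + f t * snd q i)) + (tderiv g t * fst q i + \<rho> * f t * snd q i)"
      using i unfolding h_def \<rho>f by (simp add: interpolant_def interpolant_deriv_def lincomb_def)
    also have "\<dots> = \<rho> * x i + a * (x i - f t * snd q i) + b * fst q i"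
      unfolding a_def b_def by (simp add: algebra_simps)
    finally show ?thesis .
  qed
  have hm: "h \<in> borel_measurable ?M"
    unfolding h[abs_def] by (intro borel_measurable_add borel_measurable_times borel_measurable_diff borel_measurable_const cm)
  have "velocity d p f g \<sigma> t x i = (LINT q|density ?M (\<lambda>q. ennreal (L q / Zc)). h q)"
    unfolding velocity_def posterior_def coupling_def h_def L_def Zc_def P_def using i by simp
  also have "\<dots> = (LINT q|?M. (L q / Zc) *\<^sub>R h q)"
  proof (rule integral_density[OF hm])
    show "(\<lambda>q. L q / Zc) \<in> borel_measurable ?M" by (intro borel_measurable_divide Lm borel_measurable_const)
    show "AE q in ?M. 0 \<le> L q / Zc" using L0 Zcp by (intro AE_I2 divide_nonneg_pos)
  qed
  also have "\<dots> = (LINT q|?M. (1 / Zc) * (\<rho> * x i * L q + a * (L q * (x i - f t * snd q i)) + b * (L q * fst q i)))"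
    unfolding h by (intro Bochner_Integration.integral_cong refl) (simp add: distrib_left mult.left_commute mult.commute)
  also have "\<dots> = (1 / Zc) * (\<rho> * x i * Zc + a * (c0 * R) + b * (c0 * (g t / s\<^sup>2 * R)))"
    using I1 I2 I3 by (simp add: LI(2,3) Zc_def[symmetric])
  also have "\<dots> = \<rho> * x i + (a + b * g t / s\<^sup>2) * (R / Z)"
    unfolding Zc using c0 Z by (simp add: field_simps)
  also have "a + b * g t / s\<^sup>2 = A - \<rho>"
  proof -
    have "A = tderiv \<sigma> t / \<sigma> t + b * g t / s\<^sup>2"
    proof -
      define S where "S = (g t)\<^sup>2 + (\<sigma> t)\<^sup>2"
      define \<tau> where "\<tau> = tderiv \<sigma> t / \<sigma> t"
      have "0 < S" using S0 unfolding S_def .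
      then have S: "S \<noteq> 0" by simp
      have \<tau>: "tderiv \<sigma> t = \<tau> * \<sigma> t" using \<sigma> by (simp add: \<tau>_def)
      have "(\<tau> + b * g t / S) * S = \<tau> * S + b * g t" using S by (simp add: distrib_right)
      also have "\<dots> = g t * tderiv g t + \<sigma> t * tderiv \<sigma> t"
        unfolding b_def \<tau>_def[symmetric] unfolding \<tau> S_def by (simp add: power2_eq_square algebra_simps)
      finally have "\<tau> + b * g t / S = (g t * tderiv g t + \<sigma> t * tderiv \<sigma> t) / S" using S by (simp add: eq_divide_eq)
      then show ?thesis unfolding A_def s2 S_def[symmetric] \<tau>_def by simp
    qed
    then show ?thesis by (simp add: a_def)
  qed
  finally have v: "velocity d p f g \<sigma> t x i = \<rho> * x i + (A - \<rho>) * (R / Z)" .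
  show ?thesis
  proof (cases "f t = 0")
    case True
    have "R / Z = x i" unfolding R_def True using Z by (simp add: Z_def)
    then show ?thesis unfolding v using True by (simp add: algebra_simps)
  next
    case False
    then have fp: "f t > 0" using f(2) by simp
    have iy: "integrable P (\<lambda>y. k y * y i)"
      using integrable_kernel_dot(3)[OF fp s, of x "\<lambda>l. if l = i then 1 else 0"] unfolding k_def by (simp add: dot_unit[OF i])
    have ik: "integrable P k" unfolding k_def by (rule integrable_kernel)
    have "R = (LINT y|P. x i * k y - f t * (k y * y i))"
      unfolding R_def by (intro Bochner_Integration.integral_cong refl) (simp add: algebra_simps)
    also have "\<dots> = x i * Z - f t * (LINT y|P. k y * y i)" unfolding Z_def using ik iy by simp
    finally have "R / Z = x i - f t * ((LINT y|P. k y * y i) / Z)" using Z by (simp add: diff_divide_distrib)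
    then have RZ: "R / Z = x i - f t * wmean (f t) s x (\<lambda>y. y i)" unfolding wmean_def k_def Z_def .
    have "\<rho> * x i + (A - \<rho>) * (x i - f t * w) = A * x i + (\<rho> * f t - f t * A) * w" for w
      by (simp add: algebra_simps)
    then show ?thesis unfolding v RZ \<rho>f using False by simp
  qed
qed

text \<open>On unit vectors the quadratic form of the Jacobian is A + c (f / s^2) Var \<langle>w,
  Y\<rangle>. The upper bound on the variance is used for c \<ge> 0, its nonnegativity for c <
  0.\<close>

lemma lambda_max_velocity_le:
  fixes f g \<sigma> :: "real \<Rightarrow> real" and x :: "nat \<Rightarrow> real"
  assumes p: "prob_density d p" and d: "0 < d" and \<sigma>: "\<sigma> t > 0"
    and f: "f t = 0 \<Longrightarrow> tderiv f t = 0" "0 \<le> f t"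
  defines "P \<equiv> law d p"
  defines "s \<equiv> sqrt ((g t)\<^sup>2 + (\<sigma> t)\<^sup>2)"
  defines "A \<equiv> (g t * tderiv g t + \<sigma> t * tderiv \<sigma> t) / ((g t)\<^sup>2 + (\<sigma> t)\<^sup>2)"
  defines "c \<equiv> tderiv f t - f t * A"
  assumes var: "\<And>w. f t > 0 \<Longrightarrow> (\<Sum>i<d. (w i)\<^sup>2) = 1 \<Longrightarrow>
    Rd_prob.wvar P d (f t) s x w \<le> b"
  shows "lambda_max (jacobian_mat d (velocity d p f g \<sigma> t) x) \<le>
    A + (if 0 \<le> c then c * (f t / ((g t)\<^sup>2 + (\<sigma> t)\<^sup>2)) * b else 0)"
proof -
  interpret Rd_prob P d unfolding P_def by (rule Rd_prob_density[OF p])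
  have s2: "s\<^sup>2 = (g t)\<^sup>2 + (\<sigma> t)\<^sup>2" unfolding s_def by (rule real_sqrt_pow2) simp
  have S0: "0 < (g t)\<^sup>2 + (\<sigma> t)\<^sup>2" using \<sigma> by (intro add_nonneg_pos) auto
  have s: "s > 0" unfolding s_def using S0 by simp
  let ?J = "jacobian_mat d (velocity d p f g \<sigma> t) x"
  define cov where "cov i j = wmean (f t) s x (\<lambda>y. y i * y j) - wmean (f t) s x (\<lambda>y. y i) * wmean (f t) s x (\<lambda>y. y j)" for i j
  have v: "velocity d p f g \<sigma> t y i = A * y i + (if f t = 0 then 0 else c * wmean (f t) s y (\<lambda>y. y i))"
    if "i < d" for y i
    using velocity_eq_wmean[where t = t and \<sigma> = \<sigma> and f = f and g = g, OF p \<sigma> that f, of y]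
    unfolding c_def A_def s_def P_def .
  have J: "?J $$ (i, j) = (if i = j then A else 0) + (if f t = 0 then 0 else c * (f t / s\<^sup>2 * cov i j))"
    if ij: "i < d" "j < d" for i j
  proof -
    have d1: "((\<lambda>r. A * (x(j := r)) i) has_real_derivative (if i = j then A else 0)) (at (x j))"
    proof (cases "i = j")
      case True
      then show ?thesis using DERIV_cmult_Id[of A "x j"] by simp
    qed simp
    have d2: "((\<lambda>r. if f t = 0 then 0 else c * wmean (f t) s (x(j := r)) (\<lambda>y. y i)) has_real_derivative
        (if f t = 0 then 0 else c * (f t / s\<^sup>2 * cov i j))) (at (x j))"
    proof (cases "f t = 0")
      case False
      then have fp: "f t > 0" using f(2) by simp
      show ?thesis using False DERIV_cmult[OF wmean_derivative[OF fp s ij], of c x] by (simp add: cov_def)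
    qed simp
    have "((\<lambda>r. velocity d p f g \<sigma> t (x(j := r)) i) has_real_derivative
        (if i = j then A else 0) + (if f t = 0 then 0 else c * (f t / s\<^sup>2 * cov i j))) (at (x j))"
      unfolding v[OF ij(1)] by (rule DERIV_add[OF d1 d2])
    then show ?thesis using ij unfolding jacobian_mat_def partial_def by (simp add: DERIV_imp_deriv)
  qed
  show ?thesis
  proof (rule lambda_max_le[OF _ d])
    show "?J \<in> carrier_mat d d" by (simp add: jacobian_mat_def)
    fix w :: "nat \<Rightarrow> real" assume w: "(\<Sum>i<d. (w i)\<^sup>2) = 1"
    have "(\<Sum>i<d. \<Sum>j<d. w i * w j * ?J $$ (i, j)) =
        (\<Sum>i<d. \<Sum>j<d. (if i = j then A * (w i)\<^sup>2 else 0) + (if f t = 0 then 0 else c * (f t / s\<^sup>2)) * (w i * w j * cov i j))"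
    proof (intro sum.cong refl)
      fix i j assume "i \<in> {..<d}" "j \<in> {..<d}"
      then show "w i * w j * ?J $$ (i, j) = (if i = j then A * (w i)\<^sup>2 else 0) + (if f t = 0 then 0 else c * (f t / s\<^sup>2)) * (w i * w j * cov i j)"
        using J[of i j] by (simp add: power2_eq_square distrib_left)
    qed
    also have "\<dots> = (\<Sum>i<d. A * (w i)\<^sup>2) + (if f t = 0 then 0 else c * (f t / s\<^sup>2)) * (\<Sum>i<d. \<Sum>j<d. w i * w j * cov i j)"
      unfolding sum.distrib sum_distrib_left by (intro arg_cong2[of _ _ _ _ "(+)"] sum.cong refl) simp
    also have "(\<Sum>i<d. A * (w i)\<^sup>2) = A" unfolding sum_distrib_left[symmetric] w by simp
    also have "A + (if f t = 0 then 0 else c * (f t / s\<^sup>2)) * (\<Sum>i<d. \<Sum>j<d. w i * w j * cov i j) \<le>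
        A + (if 0 \<le> c then c * (f t / s\<^sup>2) * b else 0)"
    proof (cases "f t = 0")
      case False
      then have fp: "f t > 0" using f(2) by simp
      define var where "var = (\<Sum>i<d. \<Sum>j<d. w i * w j * cov i j)"
      have veq: "var = wvar (f t) s x w"
        unfolding var_def cov_def by (rule wmean_quadratic_form[OF fp s])
      have v0: "0 \<le> var" unfolding veq by (rule wvar_nonneg[OF fp s])
      have vb: "var \<le> b" unfolding veq by (rule var[OF fp w])
      have fs: "0 \<le> f t / s\<^sup>2" using fp by simp
      have "c * (f t / s\<^sup>2) * var \<le> (if 0 \<le> c then c * (f t / s\<^sup>2) * b else 0)"
      proof (cases "0 \<le> c")
        case True
        then show ?thesis using vb fs by (simp only: if_True) (intro mult_left_mono mult_nonneg_nonneg)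
      next
        case False
        then have "c * (f t / s\<^sup>2) \<le> 0" using fs by (intro mult_nonpos_nonneg) auto
        then show ?thesis using False v0 by (simp only: if_False) (rule mult_nonpos_nonneg)
      qed
      then show ?thesis using False unfolding var_def[symmetric] by (simp only: if_False add_left_mono)
    qed simp
    finally show "(\<Sum>i<d. \<Sum>j<d. w i * w j * ?J $$ (i, j)) \<le>
        A + (if 0 \<le> c then c * (f t / ((g t)\<^sup>2 + (\<sigma> t)\<^sup>2)) * b else 0)" unfolding s2 .
  qed
qed

section \<open>Monotone and absolutely continuous functions of time\<close>

lemma borel_translate_nn_integral:
  fixes \<theta> :: "real \<Rightarrow> ennreal"
  assumes [measurable]: "\<theta> \<in> borel_measurable borel"
  shows "(\<integral>\<^sup>+ t. \<theta> (t + h) \<partial>lborel) = (\<integral>\<^sup>+ t. \<theta> t \<partial>lborel)"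
  using nn_integral_real_affine[of \<theta> 1 h] by (simp add: add.commute)

text \<open>The derivative is dominated by the lower limit of the difference quotients, whose integrals
  telescope; Fatou's lemma then needs no absolute continuity.\<close>

lemma mono_derivative_dominated:
  fixes \<phi> :: "real \<Rightarrow> real"
  assumes ab: "a \<le> b" and mono: "mono_on {a..b} \<phi>"
  shows "\<exists>D. D \<in> borel_measurable borel \<and> (\<integral>\<^sup>+ t. D t \<partial>lborel) \<le> ennreal (\<phi> b - \<phi> a) \<and>
    (\<forall>t\<in>{a<..<b}. \<forall>c. (\<phi> has_real_derivative c) (at t) \<longrightarrow> ennreal c \<le> D t)"
proof -
  \<comment> \<open>Extension by constants, so that difference quotients are nonnegative on the
    whole line.\<close>
  define \<theta> where "\<theta> t = \<phi> (max a (min b t)) - \<phi> a" for t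
  define V where "V = \<phi> b - \<phi> a"
  have th_mono: "\<theta> s \<le> \<theta> t" if "s \<le> t" for s t
  proof -
    have "\<phi> (max a (min b s)) \<le> \<phi> (max a (min b t))"
      by (rule mono_onD[OF mono]) (use ab that in auto)
    then show ?thesis by (simp add: \<theta>_def)
  qed
  then have "mono \<theta>" by (rule monoI)
  then have th_meas[measurable]: "\<theta> \<in> borel_measurable borel" by (rule borel_measurable_mono)
  have th_shift[measurable]: "(\<lambda>t. \<theta> (t + h)) \<in> borel_measurable borel" for h
    by (rule measurable_compose[OF _ th_meas]) simp
  have th0: "\<theta> t = 0" if "t \<le> a" for t using that ab by (simp add: \<theta>_def)
  have thV: "\<theta> t = V" if "b \<le> t" for t using that ab by (simp add: \<theta>_def V_def)
  have th_nonneg: "0 \<le> \<theta> t" for t using th_mono[of "min t a" t] th0[of "min t a"] by simp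
  have th_le: "\<theta> t \<le> V" for t using th_mono[of t "max t b"] thV[of "max t b"] by simp
  have V: "0 \<le> V" using th_nonneg[of b] thV[of b] by simp
  \<comment> \<open>\<theta> equals \<open>V\<close> beyond \<open>b\<close> and has no finite
    integral in general. So \<theta> cut off at b + h is translated and compared with \<theta> cut
    off at \<open>b\<close>, whose integral \<open>I\<close> is finite and cancels; what remains is
    \<open>V\<close> over a length \<open>h\<close>.\<close>
  have shift: "(\<integral>\<^sup>+ t. ennreal (\<theta> (t + h) - \<theta> t) \<partial>lborel) = ennreal (h * V)" if h: "h > 0" for h
  proof -
    define I where "I = (\<integral>\<^sup>+ t. ennreal (\<theta> t) * indicator {..b} t \<partial>lborel)"
    have "I \<le> (\<integral>\<^sup>+ t. ennreal V * indicator {a..b} t \<partial>lborel)"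
      unfolding I_def
    proof (rule nn_integral_mono)
      fix t
      show "ennreal (\<theta> t) * indicator {..b} t \<le> ennreal V * indicator {a..b} t"
        using th0[of t] th_le[of t] by (cases "t < a") (auto simp: indicator_def intro: ennreal_leI)
    qed
    also have "\<dots> = ennreal V * ennreal (b - a)" using ab by (subst nn_integral_cmult) auto
    also have "\<dots> < \<infinity>" by (simp add: ennreal_mult_less_top)
    finally have Ifin: "I \<noteq> \<infinity>" by simp
    have "(\<integral>\<^sup>+ t. ennreal (\<theta> (t + h)) * indicator {..b + h} (t + h) \<partial>lborel) = (\<integral>\<^sup>+ t. ennreal (\<theta> t) * indicator {..b + h} t \<partial>lborel)"
      by (rule borel_translate_nn_integral[of "\<lambda>t. ennreal (\<theta> t) * indicator {..b + h} t"]) measurable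
    also have "\<dots> = (\<integral>\<^sup>+ t. ennreal (\<theta> t) * indicator {..b} t + ennreal V * indicator {b<..b + h} t \<partial>lborel)"
      using h thV by (intro nn_integral_cong) (auto simp: indicator_def)
    also have "\<dots> = I + ennreal V * ennreal h"
    proof -
      have "(\<integral>\<^sup>+ t. ennreal (\<theta> t) * indicator {..b} t + ennreal V * indicator {b<..b + h} t \<partial>lborel) =
          I + (\<integral>\<^sup>+ t. ennreal V * indicator {b<..b + h} t \<partial>lborel)"
        unfolding I_def
        by (intro nn_integral_add borel_measurable_times_ennreal measurable_compose[OF _ measurable_ennreal]
            borel_measurable_indicator borel_measurable_const) (use th_meas in auto)
      also have "(\<integral>\<^sup>+ t. ennreal V * indicator {b<..b + h} t \<partial>lborel) = ennreal V * emeasure lborel {b<..b + h}"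
        by (rule nn_integral_cmult_indicator) simp
      finally show ?thesis using h by simp
    qed
    finally have 1: "(\<integral>\<^sup>+ t. ennreal (\<theta> (t + h)) * indicator {..b + h} (t + h) \<partial>lborel) = I + ennreal (h * V)"
      using h V by (simp add: ennreal_mult[symmetric] mult.commute)
    have "(\<integral>\<^sup>+ t. ennreal (\<theta> (t + h)) * indicator {..b + h} (t + h) \<partial>lborel) =
        (\<integral>\<^sup>+ t. ennreal (\<theta> (t + h) - \<theta> t) + ennreal (\<theta> t) * indicator {..b} t \<partial>lborel)"
    proof (rule nn_integral_cong)
      fix t
      show "ennreal (\<theta> (t + h)) * indicator {..b + h} (t + h) = ennreal (\<theta> (t + h) - \<theta> t) + ennreal (\<theta> t) * indicator {..b} t"
      proof (cases "t \<le> b")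
        case True
        have "ennreal (\<theta> (t + h)) = ennreal (\<theta> (t + h) - \<theta> t) + ennreal (\<theta> t)"
          using th_nonneg[of t] th_mono[of t "t + h"] h by (subst ennreal_plus[symmetric]) auto
        then show ?thesis using True by simp
      next
        case False
        then show ?thesis using thV[of t] thV[of "t + h"] h by simp
      qed
    qed
    also have "\<dots> = (\<integral>\<^sup>+ t. ennreal (\<theta> (t + h) - \<theta> t) \<partial>lborel) + I"
      unfolding I_def
      by (intro nn_integral_add borel_measurable_times_ennreal measurable_compose[OF _ measurable_ennreal] borel_measurable_diff)
         (use th_meas th_shift in auto)
    finally have "I + (\<integral>\<^sup>+ t. ennreal (\<theta> (t + h) - \<theta> t) \<partial>lborel) = I + ennreal (h * V)"
      unfolding 1 by (metis add.commute)
    then show ?thesis using Ifin by (simp add: ennreal_add_left_cancel)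
  qed
  define H where "H n = inverse (real (Suc n))" for n
  have H: "H n > 0" for n by (simp add: H_def)
  define q where "q n t = ennreal ((\<theta> (t + H n) - \<theta> t) / H n)" for n t
  have qm[measurable]: "q n \<in> borel_measurable borel" for n unfolding q_def[abs_def]
    by (intro measurable_compose[OF _ measurable_ennreal] borel_measurable_divide borel_measurable_diff th_meas th_shift) simp
  have qint: "(\<integral>\<^sup>+ t. q n t \<partial>lborel) = ennreal V" for n
  proof -
    have "(\<integral>\<^sup>+ t. q n t \<partial>lborel) = (\<integral>\<^sup>+ t. ennreal (1 / H n) * ennreal (\<theta> (t + H n) - \<theta> t) \<partial>lborel)"
      unfolding q_def using H[of n] th_mono[of _ "_ + H n"]
      by (intro nn_integral_cong) (simp add: ennreal_mult[symmetric])
    also have "\<dots> = ennreal (1 / H n) * ennreal (H n * V)"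
      by (subst nn_integral_cmult) (auto simp: shift[OF H])
    also have "\<dots> = ennreal V" using H[of n] V by (simp add: ennreal_mult[symmetric])
    finally show ?thesis .
  qed
  define D where "D t = liminf (\<lambda>n. q n t)" for t
  have "D \<in> borel_measurable borel" unfolding D_def[abs_def] by (rule borel_measurable_liminf) (rule qm)
  moreover have "(\<integral>\<^sup>+ t. D t \<partial>lborel) \<le> ennreal V"
  proof -
    have "(\<integral>\<^sup>+ t. D t \<partial>lborel) \<le> liminf (\<lambda>n. \<integral>\<^sup>+ t. q n t \<partial>lborel)"
      unfolding D_def by (rule nn_integral_liminf) (use qm in simp)
    also have "\<dots> = ennreal V" unfolding qint by (rule Liminf_const) simp
    finally show ?thesis .
  qed
  moreover have "ennreal c \<le> D t" if t: "t \<in> {a<..<b}" and c: "(\<phi> has_real_derivative c) (at t)" for t c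
  proof -
    have H0: "H \<longlonglongrightarrow> 0" unfolding H_def[abs_def] by (rule LIMSEQ_inverse_real_of_nat)
    have "filterlim H (at 0) sequentially"
    proof (intro filterlim_atI always_eventually allI H0)
      show "H n \<noteq> 0" for n using H[of n] by simp
    qed
    then have "(\<lambda>n. (\<phi> (t + H n) - \<phi> t) / H n) \<longlonglongrightarrow> c"
      using c unfolding DERIV_def by (rule filterlim_compose[rotated])
    moreover have "\<forall>\<^sub>F n in sequentially. H n < b - t"
      using order_tendstoD(2)[OF H0, of "b - t"] t by simp
    then have "\<forall>\<^sub>F n in sequentially. (\<phi> (t + H n) - \<phi> t) / H n = (\<theta> (t + H n) - \<theta> t) / H n"
    proof eventually_elim
      case (elim n)
      then show ?case using t H[of n] by (simp add: \<theta>_def)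
    qed
    ultimately have "(\<lambda>n. (\<theta> (t + H n) - \<theta> t) / H n) \<longlonglongrightarrow> c" by (rule Lim_transform_eventually)
    then have "(\<lambda>n. q n t) \<longlonglongrightarrow> ennreal c" unfolding q_def by (rule tendsto_ennrealI)
    then have "D t = ennreal c" unfolding D_def by (intro lim_imp_Liminf) simp_all
    then show ?thesis by simp
  qed
  ultimately show ?thesis unfolding V_def by (intro exI[of _ D]) blast
qed

text \<open>By Cousin's lemma there is a tagged division whose intervals have almost nonnegative increments
  when the tag is outside \<open>N\<close>, and small total length when it is in \<open>N\<close>.\<close>

lemma abs_continuous_le:
  assumes ac: "abs_continuous01 h" and N: "N \<in> null_sets lborel" and ab: "0 \<le> a" "a \<le> b" "b \<le> 1"
    and deriv: "\<And>x. x \<in> {a..b} - N \<Longrightarrow> \<exists>c\<ge>0. (h has_real_derivative c) (at x within {0..1})"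
  shows "h a \<le> h b"
proof (rule field_le_epsilon)
  fix \<epsilon>' :: real assume "0 < \<epsilon>'"
  define \<epsilon> where "\<epsilon> = \<epsilon>' / 2"
  have e: "\<epsilon> > 0" "\<epsilon> + \<epsilon> = \<epsilon>'" using \<open>0 < \<epsilon>'\<close> by (simp_all add: \<epsilon>_def)
  obtain \<eta> where eta: "\<eta> > 0" "\<And>(n::nat) (l :: nat \<Rightarrow> real) (r :: nat \<Rightarrow> real).
        (\<forall>k<n. 0 \<le> l k \<and> l k \<le> r k \<and> r k \<le> 1) \<Longrightarrow>
        disjoint_family_on (\<lambda>k. {l k<..<r k}) {..<n} \<Longrightarrow>
        (\<Sum>k<n. r k - l k) < \<eta> \<Longrightarrow> (\<Sum>k<n. \<bar>h (r k) - h (l k)\<bar>) < \<epsilon>"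
    using ac[unfolded abs_continuous01_def, rule_format, OF e(1)] by blast
  have Nb: "N \<in> sets borel" using N by (simp add: null_sets_def)
  \<comment> \<open>Intervals tagged in \<open>N\<close> will be kept inside \<open>W\<close>, so
    their total length stays below the \<eta> of absolute continuity.\<close>
  obtain W where W: "open W" "N \<subseteq> W" "emeasure lborel (W - N) < ennreal \<eta>"
    using outer_regular_lborel[OF Nb eta(1)] by blast
  have Wm: "emeasure lborel W < ennreal \<eta>"
  proof -
    have "emeasure lborel W = emeasure lborel (W - N)"
      using emeasure_Diff_null_set[OF N, of W] W(1) by simp
    then show ?thesis using W(3) by simp
  qed
  \<comment> \<open>The slope is at least -\<epsilon> on either side of the tag; the two halves are
    added over an interval that contains it.\<close>
  have "\<exists>\<rho>>0. \<forall>y\<in>{0..1}. \<bar>y - x\<bar> < \<rho> \<longrightarrow> (x \<le> y \<longrightarrow> h y - h x \<ge> - \<epsilon> * (y - x)) \<and> (y \<le> x \<longrightarrow> h x - h y \<ge> - \<epsilon> * (x - y))"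
    if x: "x \<in> {a..b} - N" for x
  proof -
    obtain c where c: "c \<ge> 0" "(h has_real_derivative c) (at x within {0..1})" using deriv[OF x] by blast
    then have "(h has_derivative (\<lambda>y. c * y)) (at x within {0..1})" by (simp add: has_field_derivative_def)
    then obtain \<rho> where r: "\<rho> > 0" "\<And>y. y \<in> {0..1} \<Longrightarrow> norm (y - x) < \<rho> \<Longrightarrow> norm (h y - h x - c * (y - x)) \<le> \<epsilon> * norm (y - x)"
      using e(1) unfolding has_derivative_within_alt by blast
    show ?thesis
    proof (intro exI[of _ \<rho>] conjI ballI impI r(1))
      fix y assume y: "y \<in> {0..1}" "\<bar>y - x\<bar> < \<rho>"
      have bd: "\<bar>h y - h x - c * (y - x)\<bar> \<le> \<epsilon> * \<bar>y - x\<bar>" using r(2)[of y] y by simp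
      show "h y - h x \<ge> - \<epsilon> * (y - x)" if "x \<le> y"
      proof -
        have "0 \<le> c * (y - x)" using c that by simp
        then show ?thesis using bd that by (simp add: abs_le_iff)
      qed
      show "h x - h y \<ge> - \<epsilon> * (x - y)" if "y \<le> x"
      proof -
        have "c * (y - x) \<le> 0" using c that by (intro mult_nonneg_nonpos) auto
        moreover have "h y - h x - c * (y - x) \<le> \<epsilon> * (x - y)" using bd that by (simp add: abs_le_iff)
        ultimately show ?thesis by simp
      qed
    qed
  qed
  then obtain \<rho> where rho: "\<And>x. x \<in> {a..b} - N \<Longrightarrow> \<rho> x > 0"
    "\<And>x y. x \<in> {a..b} - N \<Longrightarrow> y \<in> {0..1} \<Longrightarrow> \<bar>y - x\<bar> < \<rho> x \<Longrightarrow> x \<le> y \<Longrightarrow> h y - h x \<ge> - \<epsilon> * (y - x)"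
    "\<And>x y. x \<in> {a..b} - N \<Longrightarrow> y \<in> {0..1} \<Longrightarrow> \<bar>y - x\<bar> < \<rho> x \<Longrightarrow> y \<le> x \<Longrightarrow> h x - h y \<ge> - \<epsilon> * (x - y)"
    by metis
  define \<gamma> where "\<gamma> x = (if x \<in> N then W else if x \<in> {a..b} then ball x (\<rho> x) else UNIV)" for x
  have "gauge \<gamma>" unfolding gauge_def \<gamma>_def using W rho(1) by auto
  then obtain p where p: "p tagged_division_of {a..b}" "\<gamma> fine p" by (rule fine_division_exists_real)
  have pK: "\<exists>u v. K = {u..v} \<and> u \<le> v \<and> a \<le> u \<and> v \<le> b \<and> u \<le> x \<and> x \<le> v" if xK: "(x, K) \<in> p" for x K
  proof -
    obtain u v where uv: "K = cbox u v" using tagged_division_ofD(4)[OF p(1) xK] by blast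
    have "x \<in> K" "K \<subseteq> {a..b}" using tagged_division_ofD(2,3)[OF p(1) xK] by auto
    then show ?thesis using uv by (intro exI[of _ u] exI[of _ v]) auto
  qed
  have pI: "K = {Inf K..Sup K}" "Inf K \<le> Sup K" "a \<le> Inf K" "Sup K \<le> b" "Inf K \<le> x" "x \<le> Sup K" if "(x, K) \<in> p" for x K
    using pK[OF that] by auto
  have pf: "finite p" using tagged_division_ofD(1)[OF p(1)] .
  define g where "g = (\<lambda>(x :: real, K :: real set). h (Sup K) - h (Inf K))"
  define L where "L = (\<lambda>(x :: real, K :: real set). Sup K - Inf K)"
  define p1 where "p1 = {z \<in> p. fst z \<in> N}"
  define p2 where "p2 = {z \<in> p. fst z \<notin> N}"
  have pp: "p = p1 \<union> p2" "p1 \<inter> p2 = {}" "finite p1" "finite p2" using pf by (auto simp: p1_def p2_def)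
  have sg: "sum g p = h b - h a" unfolding g_def by (rule additive_tagged_division_1[OF ab(2) p(1)])
  have sL: "sum L p = b - a" unfolding L_def by (rule additive_tagged_division_1[OF ab(2) p(1), of "\<lambda>x. x"])
  have L0: "0 \<le> L z" if "z \<in> p" for z using pI(2)[of "fst z" "snd z"] that by (simp add: L_def split_beta)
  \<comment> \<open>Since the total length is at most 1, tags outside \<open>N\<close> lose at most
    \<epsilon>. Tags in \<open>N\<close> lose less than another \<epsilon>, which explains the
    choice of half of \<epsilon>'.\<close>
  have 2: "- \<epsilon> * sum L p2 \<le> sum g p2"
    unfolding sum_distrib_left
  proof (rule sum_mono)
    fix z assume z: "z \<in> p2"
    obtain x K where xK: "z = (x, K)" by (cases z)
    have m: "(x, K) \<in> p" "x \<notin> N" using z by (auto simp: p2_def xK)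
    note I = pI[OF m(1)]
    have x: "x \<in> {a..b} - N" using I m(2) by auto
    have "K \<subseteq> ball x (\<rho> x)" using fineD[OF p(2) m(1)] x by (simp add: \<gamma>_def)
    then have "Inf K \<in> ball x (\<rho> x)" "Sup K \<in> ball x (\<rho> x)"
      using I(1,2) by (metis atLeastAtMost_iff order_refl subsetD)+
    then have d: "\<bar>Inf K - x\<bar> < \<rho> x" "\<bar>Sup K - x\<bar> < \<rho> x" by (simp_all add: dist_real_def abs_minus_commute)
    have "h (Sup K) - h x \<ge> - \<epsilon> * (Sup K - x)" by (rule rho(2)[OF x _ d(2) I(6)]) (use I ab in auto)
    moreover have "h x - h (Inf K) \<ge> - \<epsilon> * (x - Inf K)" by (rule rho(3)[OF x _ d(1) I(5)]) (use I ab in auto)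
    ultimately show "- \<epsilon> * L z \<le> g z" by (simp add: L_def g_def xK algebra_simps)
  qed
  have 1: "\<bar>sum g p1\<bar> < \<epsilon>"
  proof -
    \<comment> \<open>Absolute continuity speaks of families indexed by initial segments, hence the
      enumeration. The intervals of the division may touch, so disjointness is used for their
      interiors.\<close>
    obtain en where en: "bij_betw en {..<card p1} p1"
      using ex_bij_betw_nat_finite[OF pp(3)] by (auto simp: lessThan_atLeast0)
    define l where "l k = Inf (snd (en k))" for k
    define r where "r k = Sup (snd (en k))" for k
    have enp: "en k \<in> p1" if "k < card p1" for k using bij_betwE[OF en] that by auto
    then have enP: "(fst (en k), snd (en k)) \<in> p" "fst (en k) \<in> N" if "k < card p1" for k
      using that by (auto simp: p1_def)
    have lr: "0 \<le> l k \<and> l k \<le> r k \<and> r k \<le> 1" if "k < card p1" for k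
      using pI[OF enP(1)[OF that]] ab unfolding l_def r_def by auto
    have int: "interior (snd (en k)) = {l k<..<r k}" if "k < card p1" for k
      using pI(1)[OF enP(1)[OF that]] unfolding l_def r_def by (metis interior_atLeastAtMost_real)
    have disj: "disjoint_family_on (\<lambda>k. {l k<..<r k}) {..<card p1}"
      unfolding disjoint_family_on_def
    proof (intro ballI impI)
      fix k k' assume k: "k \<in> {..<card p1}" "k' \<in> {..<card p1}" "k \<noteq> k'"
      then have "en k \<noteq> en k'" using en by (auto simp: bij_betw_def inj_on_def)
      then have "interior (snd (en k)) \<inter> interior (snd (en k')) = {}"
        using tagged_division_ofD(5)[OF p(1) enP(1) enP(1)] k by (metis lessThan_iff prod.collapse)
      then show "{l k<..<r k} \<inter> {l k'<..<r k'} = {}" using int k by simp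
    qed
    have "ennreal (\<Sum>k<card p1. r k - l k) = (\<Sum>k<card p1. emeasure lborel {l k<..<r k})"
      using lr by (subst sum_ennreal[symmetric]) auto
    also have "\<dots> = emeasure lborel (\<Union>k<card p1. {l k<..<r k})"
      by (rule sum_emeasure[OF _ disj]) auto
    also have "\<dots> \<le> emeasure lborel W"
    proof (rule emeasure_mono)
      show "(\<Union>k<card p1. {l k<..<r k}) \<subseteq> W"
      proof (intro UN_least)
        fix k assume "k \<in> {..<card p1}"
        then have k: "k < card p1" by simp
        have "snd (en k) \<subseteq> W" using fineD[OF p(2) enP(1)[OF k]] enP(2)[OF k] by (simp add: \<gamma>_def)
        then show "{l k<..<r k} \<subseteq> W" using int[OF k] interior_subset by blast
      qed
    qed (use W(1) in simp)
    also have "\<dots> < ennreal \<eta>" by (rule Wm)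
    finally have "ennreal (\<Sum>k<card p1. r k - l k) < ennreal \<eta>" .
    moreover have "0 \<le> (\<Sum>k<card p1. r k - l k)" using lr by (intro sum_nonneg) auto
    ultimately have "(\<Sum>k<card p1. r k - l k) < \<eta>" by (simp add: ennreal_less_iff)
    from eta(2)[OF _ disj this] have s: "(\<Sum>k<card p1. \<bar>h (r k) - h (l k)\<bar>) < \<epsilon>" using lr by blast
    have "sum g p1 = (\<Sum>k<card p1. g (en k))" by (rule sum.reindex_bij_betw[OF en, symmetric])
    also have "\<bar>\<dots>\<bar> \<le> (\<Sum>k<card p1. \<bar>g (en k)\<bar>)" by (rule sum_abs)
    also have "\<dots> = (\<Sum>k<card p1. \<bar>h (r k) - h (l k)\<bar>)" by (simp add: g_def l_def r_def split_beta)
    finally show ?thesis using s by simp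
  qed
  have "sum L p2 \<le> sum L p" using pp pf L0 by (intro sum_mono2) auto
  also have "\<dots> \<le> 1" using sL ab by simp
  finally have "\<epsilon> * sum L p2 \<le> \<epsilon>" using e(1) by simp
  moreover have "h b - h a = sum g p1 + sum g p2" unfolding sg[symmetric] pp(1) by (rule sum.union_disjoint[OF pp(3,4,2)])
  moreover have "- sum g p1 < \<epsilon>" using 1 unfolding abs_less_iff by (rule conjunct2)
  ultimately have "h a \<le> h b + (\<epsilon> + \<epsilon>)" using 2 unfolding mult_minus_left by linarith
  then show "h a \<le> h b + \<epsilon>'" unfolding e(2) .
qed

section \<open>Integrating the one-sided Lipschitz constant\<close>

text \<open>\<open>m\<close> bounds \<kappa> S = \<alpha> S + f^2 from below, \<open>E\<close> is
  the coefficient of the variance correction, and \<open>M\<close> adds up all coefficients that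
  occur. Where g \<ge> \<gamma>, S is bounded below and A is harmless. Where \<sigma>' \<le> 0, A is
  nonpositive and its singular size is absorbed into the derivative of - S powr (\<beta>/4).\<close>

lemma one_sided_lipschitz_pointwise:
  fixes \<alpha> \<beta> \<gamma> C f g \<sigma> f' g' \<sigma>' :: real
  assumes par: "0 < \<alpha>" "0 < \<beta>" "\<beta> \<le> 1" "0 < \<gamma>" "\<gamma> < 1" "0 \<le> C"
    and f: "0 \<le> f" "f \<le> 1" "0 \<le> f'" and g: "0 \<le> g" "g \<le> 1" "g' \<le> 0" and \<sigma>: "0 < \<sigma>" "\<sigma> \<le> 1"
    and fg: "\<gamma> \<le> g + f"
  defines "S \<equiv> g\<^sup>2 + \<sigma>\<^sup>2"
  defines "A \<equiv> (g * g' + \<sigma> * \<sigma>') / S"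
  defines "c \<equiv> f' - f * A"
  defines "\<kappa> \<equiv> \<alpha> + f\<^sup>2 / S"
  defines "B \<equiv> A + (if 0 \<le> c then c * (f / S) * ((1 + C * \<kappa> powr (- \<beta> / 4)) / \<kappa>) else 0)"
  defines "m \<equiv> min 1 \<alpha> * (\<gamma>\<^sup>2 / 2)"
  defines "E \<equiv> C * m powr (- \<beta> / 4) / m"
  defines "M \<equiv> (\<alpha> + 1) / m + 1 / \<gamma>\<^sup>2 + E * (2 + 2 / \<gamma>\<^sup>2 + 2 / \<beta>)"
  shows "0 \<le> \<sigma>' \<Longrightarrow> \<gamma> \<le> g \<Longrightarrow> B \<le> M * (f' + \<sigma>' - g')"
    "\<sigma>' \<le> 0 \<Longrightarrow> B \<le> M * (f' + - (\<beta> / 2) * S powr (\<beta> / 4 - 1) * (g * g' + \<sigma> * \<sigma>'))"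
proof -
  define N where "N = g * g' + \<sigma> * \<sigma>'"
  define Q where "Q = \<alpha> * S + f\<^sup>2"
  have S: "S > 0" unfolding S_def using \<sigma> by (intro add_nonneg_pos) auto
  have S2: "S \<le> 2"
  proof -
    have "g\<^sup>2 \<le> 1" "\<sigma>\<^sup>2 \<le> 1" using g \<sigma> by (auto intro: power_le_one)
    then show ?thesis by (simp add: S_def)
  qed
  have m: "m > 0" unfolding m_def using par by simp
  \<comment> \<open>From g + f \<ge> \<gamma> and (g + f)^2 \<le> 2 (g^2 + f^2): \<open>g\<close>
    and \<open>f\<close> cannot both be small, so neither can S and f^2.\<close>
  have Qm: "m \<le> Q"
  proof -
    have "\<gamma>\<^sup>2 \<le> (g + f)\<^sup>2" using fg par by (intro power_mono) auto
    also have "\<dots> \<le> 2 * (g\<^sup>2 + f\<^sup>2)" using sum_squares_bound[of g f] by (simp add: power2_sum)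
    finally have "\<gamma>\<^sup>2 \<le> 2 * (g\<^sup>2 + f\<^sup>2)" .
    then have gf: "\<gamma>\<^sup>2 / 2 \<le> g\<^sup>2 + f\<^sup>2" by simp
    have "m \<le> min 1 \<alpha> * (g\<^sup>2 + f\<^sup>2)" unfolding m_def using par gf by (intro mult_left_mono) auto
    also have "\<dots> \<le> min 1 \<alpha> * (S + f\<^sup>2)" unfolding S_def using par by (intro mult_left_mono) auto
    also have "\<dots> = min 1 \<alpha> * S + min 1 \<alpha> * f\<^sup>2" by (rule distrib_left)
    also have "\<dots> \<le> \<alpha> * S + 1 * f\<^sup>2" using S by (intro add_mono mult_right_mono) auto
    finally show ?thesis by (simp add: Q_def)
  qed
  then have Q: "Q > 0" using m by simp
  have \<kappa>Q: "\<kappa> = Q / S" unfolding \<kappa>_def Q_def using S by (simp add: add_divide_distrib)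
  have A: "A * S = N" unfolding A_def N_def using S by simp
  have E: "E \<ge> 0" unfolding E_def using par m by simp
  have kap: "\<kappa> powr (- \<beta> / 4) \<le> m powr (- \<beta> / 4) * S powr (\<beta> / 4)"
  proof -
    have "\<kappa> powr (- \<beta> / 4) = Q powr (- \<beta> / 4) / S powr (- \<beta> / 4)"
      unfolding \<kappa>Q by (rule powr_divide)
    also have "\<dots> = Q powr (- \<beta> / 4) * S powr (\<beta> / 4)"
    proof -
      have "S powr (- \<beta> / 4) = inverse (S powr (\<beta> / 4))"
        unfolding minus_divide_left[symmetric] by (rule powr_minus)
      then show ?thesis by (simp only: divide_inverse inverse_inverse_eq)
    qed
    also have "\<dots> \<le> m powr (- \<beta> / 4) * S powr (\<beta> / 4)"
      using Qm m par by (intro mult_right_mono powr_mono2') auto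
    finally show ?thesis .
  qed
  have Sb: "S powr (\<beta> / 4) \<le> 2"
  proof -
    have "S powr (\<beta> / 4) \<le> 2 powr (\<beta> / 4)" using S S2 par by (intro powr_mono2) auto
    also have "\<dots> \<le> 2 powr 1" using par by (intro powr_mono) auto
    finally show ?thesis by simp
  qed
  \<comment> \<open>The negative part of \<open>A\<close>, the only part that can make
    \<open>c\<close> large; f \<le> 1 gives c \<le> f' + A'.\<close>
  define A' where "A' = max 0 (- A)"
  have cle: "c \<le> f' + A'"
  proof -
    have "f * (- A) \<le> f * A'" using f by (intro mult_left_mono) (auto simp: A'_def)
    moreover have "f * A' \<le> 1 * A'" using f by (intro mult_right_mono) (auto simp: A'_def)
    ultimately show ?thesis by (simp add: c_def)
  qed
  have main: "B \<le> (\<alpha> * max 0 N + f') / m + E * (S powr (\<beta> / 4) * (f' + A'))" if c: "0 \<le> c"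
  proof -
    have k1: "f / S * ((1 + C * \<kappa> powr (- \<beta> / 4)) / \<kappa>) = f / Q * (1 + C * \<kappa> powr (- \<beta> / 4))"
      unfolding \<kappa>Q using S Q by simp
    have "B = A + c * (f / Q) + c * (f / Q) * (C * \<kappa> powr (- \<beta> / 4))"
    proof -
      have "B = A + c * (f / S * ((1 + C * \<kappa> powr (- \<beta> / 4)) / \<kappa>))"
        unfolding B_def using c by (simp only: if_True mult.assoc)
      then show ?thesis unfolding k1 by (simp only: distrib_left mult_1_right mult.assoc add.assoc)
    qed
    \<comment> \<open>The cancellation: after multiplication by Q = \<alpha> S + f^2, the terms f^2
      A from A Q and from c f annihilate each other, and A S = N has no denominator left.\<close>
    also have "A + c * (f / Q) = (\<alpha> * N + f * f') / Q"
    proof -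
      have "(A + c * (f / Q)) * Q = A * Q + c * f" using Q by (simp add: distrib_right)
      also have "\<dots> = \<alpha> * (A * S) + f * f'" by (simp add: Q_def c_def power2_eq_square algebra_simps)
      finally show ?thesis using Q unfolding A by (simp add: eq_divide_eq)
    qed
    also have "(\<alpha> * N + f * f') / Q \<le> (\<alpha> * max 0 N + f') / Q"
    proof -
      have "f * f' \<le> 1 * f'" using f by (intro mult_right_mono)
      moreover have "\<alpha> * N \<le> \<alpha> * max 0 N" using par by (intro mult_left_mono) auto
      ultimately show ?thesis using Q by (intro divide_right_mono) auto
    qed
    also have "\<dots> \<le> (\<alpha> * max 0 N + f') / m" using Qm m par f Q by (intro divide_left_mono) auto
    also have "c * (f / Q) * (C * \<kappa> powr (- \<beta> / 4)) \<le> (f' + A') * (1 / m) * (C * (m powr (- \<beta> / 4) * S powr (\<beta> / 4)))"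
    proof -
      have 1: "f / Q \<le> 1 / m" using f Qm m Q by (intro frac_le) auto
      have 2: "C * \<kappa> powr (- \<beta> / 4) \<le> C * (m powr (- \<beta> / 4) * S powr (\<beta> / 4))"
        using kap par by (intro mult_left_mono) auto
      have 3: "0 \<le> f' + A'" using f by (simp add: A'_def)
      have 4: "0 \<le> f / Q" using f Q by simp
      have 5: "0 \<le> C * \<kappa> powr (- \<beta> / 4)" using par by simp
      have 6: "0 \<le> (f' + A') * (1 / m)" using 3 m by simp
      show ?thesis by (rule mult_mono[OF mult_mono[OF cle 1 3 4] 2 6 5])
    qed
    also have "\<dots> = E * (S powr (\<beta> / 4) * (f' + A'))" by (simp add: E_def)
    finally show ?thesis by simp
  qed
  have M: "1 / m \<le> M" "(\<alpha> + 1) / m \<le> M" "\<alpha> / m \<le> M" "1 / \<gamma>\<^sup>2 \<le> M" "0 \<le> M"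
    and M2: "1 / m + E * 2 \<le> M" "E * (2 / \<gamma>\<^sup>2) \<le> M" "E * (2 / \<beta>) \<le> M"
  proof -
    have M': "M = \<alpha> / m + 1 / m + 1 / \<gamma>\<^sup>2 + E * 2 + E * (2 / \<gamma>\<^sup>2) + E * (2 / \<beta>)"
      unfolding M_def distrib_left add_divide_distrib by simp
    have n: "0 \<le> \<alpha> / m" "0 \<le> 1 / m" "0 \<le> 1 / \<gamma>\<^sup>2" "0 \<le> E * 2" "0 \<le> E * (2 / \<gamma>\<^sup>2)" "0 \<le> E * (2 / \<beta>)"
      using par m E by simp_all
    show "1 / m \<le> M" "\<alpha> / m \<le> M" "1 / \<gamma>\<^sup>2 \<le> M" "0 \<le> M" "1 / m + E * 2 \<le> M" "E * (2 / \<gamma>\<^sup>2) \<le> M" "E * (2 / \<beta>) \<le> M"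
      unfolding M' using n by linarith+
    show "(\<alpha> + 1) / m \<le> M" unfolding M' add_divide_distrib using n by linarith
  qed
  show "B \<le> M * (f' + \<sigma>' - g')" if s': "0 \<le> \<sigma>'" and gg: "\<gamma> \<le> g"
  proof -
    have SG: "\<gamma>\<^sup>2 \<le> S"
    proof -
      have "\<gamma>\<^sup>2 \<le> g\<^sup>2" using gg par by (intro power_mono) auto
      then show ?thesis unfolding S_def by (simp add: add_increasing2)
    qed
    have gp: "0 < \<gamma>\<^sup>2" using par by simp
    have ss: "0 \<le> \<sigma> * \<sigma>'" "\<sigma> * \<sigma>' \<le> \<sigma>'" using s' \<sigma> by (auto intro: mult_left_le_one_le)
    have g1: "g * g' \<le> 0" using g by (intro mult_nonneg_nonpos) auto
    have g2: "- (g * g') \<le> - g'"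
    proof -
      have "g * (- g') \<le> 1 * (- g')" using g by (intro mult_right_mono) auto
      then show ?thesis by simp
    qed
    have Ns: "N \<le> \<sigma>'" using ss g1 by (simp add: N_def)
    have A's: "A' \<le> - g' / \<gamma>\<^sup>2"
    proof -
      have "- A = - N / S" using A S by (simp add: eq_divide_eq)
      also have "\<dots> \<le> - g' / S" using g2 ss S by (intro divide_right_mono) (auto simp: N_def)
      also have "\<dots> \<le> - g' / \<gamma>\<^sup>2" using SG gp S g by (intro divide_left_mono) auto
      finally have "- A \<le> - g' / \<gamma>\<^sup>2" .
      moreover have "0 \<le> - g' / \<gamma>\<^sup>2" using g gp by (intro divide_nonneg_pos) auto
      ultimately show ?thesis by (simp only: A'_def max.bounded_iff)
    qed
    show ?thesis
    proof (cases "0 \<le> c")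
      case True
      have "B \<le> (\<alpha> * max 0 N + f') / m + E * (S powr (\<beta> / 4) * (f' + A'))" by (rule main[OF True])
      also have "\<dots> \<le> (\<alpha> * \<sigma>' + f') / m + E * (2 * (f' + - g' / \<gamma>\<^sup>2))"
      proof (rule add_mono)
        have "max 0 N \<le> \<sigma>'" using Ns s' by simp
        then have "\<alpha> * max 0 N \<le> \<alpha> * \<sigma>'" using par by (intro mult_left_mono) auto
        then show "(\<alpha> * max 0 N + f') / m \<le> (\<alpha> * \<sigma>' + f') / m" using m by (intro divide_right_mono) auto
        have "S powr (\<beta> / 4) * (f' + A') \<le> 2 * (f' + - g' / \<gamma>\<^sup>2)"
          by (rule mult_mono[OF Sb add_left_mono[OF A's]]) (use f in \<open>auto simp: A'_def\<close>)
        then show "E * (S powr (\<beta> / 4) * (f' + A')) \<le> E * (2 * (f' + - g' / \<gamma>\<^sup>2))" using E by (rule mult_left_mono)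
      qed
      also have "\<dots> = f' * (1 / m + E * 2) + \<sigma>' * (\<alpha> / m) + (- g') * (E * (2 / \<gamma>\<^sup>2))"
        by (simp add: add_divide_distrib diff_divide_distrib algebra_simps)
      also have "\<dots> \<le> f' * M + \<sigma>' * M + (- g') * M"
        by (rule add_mono[OF add_mono[OF mult_left_mono[OF M2(1)] mult_left_mono[OF M(3)]] mult_left_mono[OF M2(2)]])
           (use f s' g in simp_all)
      finally show ?thesis by (simp add: algebra_simps)
    next
      case c: False
      have "B = N / S" unfolding B_def using c A S by (simp add: eq_divide_eq)
      also have "\<dots> \<le> \<sigma>' / S" using Ns S by (intro divide_right_mono) auto
      also have "\<dots> \<le> \<sigma>' / \<gamma>\<^sup>2" using SG gp S s' by (intro divide_left_mono) auto
      also have "\<dots> = \<sigma>' * (1 / \<gamma>\<^sup>2)" by simp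
      also have "\<dots> \<le> \<sigma>' * M" using s' M by (intro mult_left_mono) auto
      also have "\<dots> \<le> M * (f' + \<sigma>' - g')"
      proof -
        have "M * \<sigma>' \<le> M * (f' + \<sigma>' - g')" using f g M by (intro mult_left_mono) auto
        then show ?thesis by (simp only: mult.commute)
      qed
      finally show ?thesis .
    qed
  qed
  show "B \<le> M * (f' + - (\<beta> / 2) * S powr (\<beta> / 4 - 1) * (g * g' + \<sigma> * \<sigma>'))" if s': "\<sigma>' \<le> 0"
  proof -
    define D where "D = - (\<beta> / 2) * S powr (\<beta> / 4 - 1) * N"
    have "g * g' \<le> 0" "\<sigma> * \<sigma>' \<le> 0" using g \<sigma> s' by (auto intro: mult_nonneg_nonpos)
    then have N0: "N \<le> 0" by (simp add: N_def)
    have D0: "0 \<le> D"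
    proof -
      have "0 \<le> \<beta> / 2 * S powr (\<beta> / 4 - 1) * (- N)" using N0 par by (intro mult_nonneg_nonneg) auto
      then show ?thesis by (simp add: D_def)
    qed
    have "B \<le> M * (f' + D)"
    proof (cases "0 \<le> c")
      case True
      \<comment> \<open>Here A' = - N / S, so the correction turns the singular 1 / S into the
        integrable power S powr (\<beta>/4 - 1); this is where 2 / \<beta> in \<open>M\<close> comes
        from.\<close>
      have A'N: "S powr (\<beta> / 4) * A' = 2 / \<beta> * D"
      proof -
        have "A = N / S" using A S by (simp add: eq_divide_eq)
        then have "A' = - N / S" using N0 S by (simp add: A'_def max_def divide_nonpos_pos not_le)
        moreover have "S powr (\<beta> / 4 - 1) = S powr (\<beta> / 4) / S" using S by (simp add: powr_diff)
        ultimately show ?thesis using par by (simp add: D_def)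
      qed
      have "B \<le> (\<alpha> * max 0 N + f') / m + E * (S powr (\<beta> / 4) * (f' + A'))" by (rule main[OF True])
      also have "\<dots> = f' * (1 / m) + E * (S powr (\<beta> / 4) * f' + 2 / \<beta> * D)"
        using N0 by (simp add: distrib_left A'N)
      also have "\<dots> \<le> f' * (1 / m) + E * (2 * f' + 2 / \<beta> * D)"
        by (rule add_left_mono[OF mult_left_mono[OF add_right_mono[OF mult_right_mono[OF Sb]]]]) (use f E in simp_all)
      also have "\<dots> = f' * (1 / m + E * 2) + D * (E * (2 / \<beta>))"
        by (simp add: algebra_simps)
      also have "\<dots> \<le> f' * M + D * M"
        by (rule add_mono[OF mult_left_mono[OF M2(1)] mult_left_mono[OF M2(3)]]) (use f D0 in simp_all)
      finally show ?thesis by (simp add: algebra_simps)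
    next
      case c: False
      have "B = N / S" unfolding B_def using c A S by (simp add: eq_divide_eq)
      also have "\<dots> \<le> 0" using N0 S by (intro divide_nonpos_pos) auto
      also have "\<dots> \<le> M * (f' + D)" using M D0 f by simp
      finally show ?thesis .
    qed
    then show ?thesis unfolding D_def N_def .
  qed
qed

section \<open>Regularity, monotonicity and positivity of schedules\<close>

lemma tderiv_within:
  assumes "tdifferentiable h t"
  shows "(h has_real_derivative tderiv h t) (at t within {0..1})"
  using assms unfolding tdifferentiable_def tderiv_def vector_derivative_works
    has_real_derivative_iff_has_vector_derivative .

lemma tderiv_at:
  assumes "tdifferentiable h t" "0 < t" "t < 1"
  shows "(h has_real_derivative tderiv h t) (at t)"
  using tderiv_within[OF assms(1)] at_within_Icc_at[OF assms(2,3)] by simp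

lemma C1_aeD:
  assumes "C1_ae h"
  shows "\<And>t. t \<in> {0..1} \<Longrightarrow> 0 \<le> h t" "\<And>t. t \<in> {0..1} \<Longrightarrow> h t \<le> 1" "abs_continuous01 h"
    "\<exists>N\<in>null_sets lborel. \<forall>t\<in>{0..1} - N. tdifferentiable h t"
proof -
  have r: "h ` {0..1} \<subseteq> {0..1}" using assms unfolding C1_ae_def by (rule conjunct1)
  show "0 \<le> h t" "h t \<le> 1" if "t \<in> {0..1}" for t
  proof -
    have "h t \<in> {0..1}" using r that by blast
    then show "0 \<le> h t" "h t \<le> 1" by simp_all
  qed
  show "abs_continuous01 h" using assms unfolding C1_ae_def by (elim conjE)
  show "\<exists>N\<in>null_sets lborel. \<forall>t\<in>{0..1} - N. tdifferentiable h t"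
    using assms unfolding C1_ae_def by (elim conjE exE) (rule bexI)
qed

text \<open>Values lie in [0,1], so an interior zero is a minimum.\<close>

lemma tderiv_zero_if_zero:
  assumes "C1_ae h" "tdifferentiable h t" "0 < t" "t < 1" "h t = 0"
  shows "tderiv h t = 0"
proof (rule DERIV_local_min[OF tderiv_at[OF assms(2-4)], of "min t (1 - t)"])
  show "0 < min t (1 - t)" using assms by simp
  show "\<forall>y. \<bar>t - y\<bar> < min t (1 - t) \<longrightarrow> h t \<le> h y"
    using C1_aeD(1)[OF assms(1)] assms(5) by (auto simp: abs_less_iff)
qed

lemma interval_not_subset_null:
  fixes a b :: real
  assumes "N \<in> null_sets lborel" "a < b"
  shows "\<exists>x. a < x \<and> x < b \<and> x \<notin> N"
proof (rule ccontr)
  assume "\<not> ?thesis"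
  then have "{a<..<b} \<subseteq> N" by auto
  then have "emeasure lborel {a<..<b} \<le> emeasure lborel N" using assms(1) by (intro emeasure_mono) auto
  then show False using assms by (simp add: null_setsD1 ennreal_eq_0_iff)
qed

text \<open>The sign of \<sigma>' is prescribed only where the derivative exists, so monotonicity
  rests on absolute continuity. For positivity, a zero inside (0,1) would by monotonicity produce a
  zero at a point of differentiability, an interior minimum, against the strict sign there.\<close>

lemma schedule_noise:
  assumes s: "C1_ae \<sigma>" and \<delta>: "0 < \<delta>" "\<delta> < 1"
    and incr: "\<forall>t\<in>{0..<\<delta>}. tdifferentiable \<sigma> t \<longrightarrow> tderiv \<sigma> t > 0"
    and decr: "\<forall>t\<in>{\<delta><..<1}. tdifferentiable \<sigma> t \<longrightarrow> tderiv \<sigma> t < 0"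
  shows "mono_on {0..\<delta>} \<sigma>" "\<And>t t'. \<delta> \<le> t \<Longrightarrow> t \<le> t' \<Longrightarrow> t' \<le> 1 \<Longrightarrow> \<sigma> t' \<le> \<sigma> t"
    "\<And>t. 0 < t \<Longrightarrow> t < 1 \<Longrightarrow> 0 < \<sigma> t"
proof -
  note inc = incr[rule_format] and dec = decr[rule_format]
  obtain N where N: "N \<in> null_sets lborel" "\<And>t. t \<in> {0..1} - N \<Longrightarrow> tdifferentiable \<sigma> t"
    using C1_aeD(4)[OF s] by blast
  \<comment> \<open>No sign is prescribed at \<delta> and at 1, so these two points join the
    exceptional set.\<close>
  have N': "N \<union> {\<delta>, 1} \<in> null_sets lborel" using N(1) by (intro null_sets.Un) (auto intro: finite_imp_null_set_lborel)
  have ac: "abs_continuous01 \<sigma>" by (rule C1_aeD(3)[OF s])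
  show mono: "mono_on {0..\<delta>} \<sigma>"
  proof (rule mono_onI)
    fix a b assume ab: "a \<in> {0..\<delta>}" "b \<in> {0..\<delta>}" "a \<le> b"
    show "\<sigma> a \<le> \<sigma> b"
    proof (rule abs_continuous_le[OF ac N'])
      fix x assume x: "x \<in> {a..b} - (N \<union> {\<delta>, 1})"
      have d: "tdifferentiable \<sigma> x" using x ab \<delta> by (intro N(2)) auto
      have "tderiv \<sigma> x > 0" using x ab by (intro inc d) auto
      then show "\<exists>c\<ge>0. (\<sigma> has_real_derivative c) (at x within {0..1})"
        using tderiv_within[OF d] by (intro exI[of _ "tderiv \<sigma> x"]) simp
    qed (use ab \<delta> in auto)
  qed
  have ac': "abs_continuous01 (\<lambda>t. - \<sigma> t)"
  proof -
    have "\<bar>- \<sigma> a - - \<sigma> b\<bar> = \<bar>\<sigma> a - \<sigma> b\<bar>" for a b by simp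
    then show ?thesis using ac unfolding abs_continuous01_def by (simp only:)
  qed
  show anti: "\<sigma> b \<le> \<sigma> a" if ab: "\<delta> \<le> a" "a \<le> b" "b \<le> 1" for a b
  proof -
    have "- \<sigma> a \<le> - \<sigma> b"
    proof (rule abs_continuous_le[OF ac' N'])
      fix x assume x: "x \<in> {a..b} - (N \<union> {\<delta>, 1})"
      have d: "tdifferentiable \<sigma> x" using x ab \<delta> by (intro N(2)) auto
      have "tderiv \<sigma> x < 0" using x ab by (intro dec d) auto
      then show "\<exists>c\<ge>0. ((\<lambda>t. - \<sigma> t) has_real_derivative c) (at x within {0..1})"
        using DERIV_minus[OF tderiv_within[OF d]] by (intro exI[of _ "- tderiv \<sigma> x"]) simp
    qed (use ab \<delta> in auto)
    then show ?thesis by simp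
  qed
  show "0 < \<sigma> t" if t: "0 < t" "t < 1" for t
  proof (rule ccontr)
    assume "\<not> 0 < \<sigma> t"
    then have z: "\<sigma> t \<le> 0" by simp
    have "\<exists>x. 0 < x \<and> x < 1 \<and> x \<noteq> \<delta> \<and> x \<notin> N \<and> \<sigma> x \<le> 0"
    proof (cases "t \<le> \<delta>")
      case True
      obtain x where x: "0 < x" "x < t" "x \<notin> N" using interval_not_subset_null[OF N(1) t(1)] by blast
      have "\<sigma> x \<le> \<sigma> t" using x t True \<delta> by (intro mono_onD[OF mono]) auto
      then show ?thesis using x t True z by (intro exI[of _ x]) auto
    next
      case False
      obtain x where x: "t < x" "x < 1" "x \<notin> N" using interval_not_subset_null[OF N(1) t(2)] by blast
      have "\<sigma> x \<le> \<sigma> t" using x False by (intro anti) auto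
      then show ?thesis using x t False z by (intro exI[of _ x]) auto
    qed
    then obtain x where x: "0 < x" "x < 1" "x \<noteq> \<delta>" "x \<notin> N" "\<sigma> x \<le> 0" by blast
    have d: "tdifferentiable \<sigma> x" using x by (intro N(2)) auto
    have "\<sigma> x = 0" using C1_aeD(1)[OF s, of x] x by simp
    then have "tderiv \<sigma> x = 0" by (rule tderiv_zero_if_zero[OF s d x(1,2)])
    moreover have "tderiv \<sigma> x \<noteq> 0"
    proof (cases "x < \<delta>")
      case True
      then show ?thesis using inc[OF _ d] x by simp
    next
      case False
      then show ?thesis using dec[OF _ d] x by simp
    qed
    ultimately show False by simp
  qed
qed

theorem corollary2:
  fixes \<alpha> \<beta> K \<gamma> s :: real
  assumes "\<alpha> > 0" "K > 0" "0 < \<beta>" "\<beta> \<le> 1" "0 < \<gamma>" "\<gamma> < 1"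
  shows "\<exists>C>0. \<forall>(d::nat) (p :: (nat \<Rightarrow> real) \<Rightarrow> real) (f :: real \<Rightarrow> real) (g :: real \<Rightarrow> real)
            (\<sigma> :: real \<Rightarrow> real) (\<delta> :: real).
          d \<ge> 1 \<longrightarrow> weakly_log_concave d \<alpha> \<beta> K p \<longrightarrow> admissible_schedule K \<gamma> \<delta> f g \<sigma> \<longrightarrow> \<sigma> \<delta> = s \<longrightarrow>
          (\<forall>z\<in>{0..1}.
             ereal_integral (lebesgue_on {z..1})
               (\<lambda>t. SUP x\<in>Rd d. ereal (lambda_max (jacobian_mat d (velocity d p f g \<sigma> t) x)))
             \<le> ereal C)"
proof -
  obtain C where C': "C \<ge> 0 \<and> (\<forall>d p f s x w. weakly_log_concave d \<alpha> \<beta> K p \<longrightarrow> f > 0 \<longrightarrow> s > 0 \<longrightarrow> (\<Sum>i<d. (w i)\<^sup>2) = 1 \<longrightarrow>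
      Rd_prob.wvar (law d p) d f s x w \<le> (1 + C * (\<alpha> + f\<^sup>2 / s\<^sup>2) powr (- \<beta> / 4)) / (\<alpha> + f\<^sup>2 / s\<^sup>2))"
    using posterior_variance_bound[OF assms(1-4)] by (rule exE)
  note C = C'[THEN conjunct1] and CV = C'[THEN conjunct2, rule_format]
  define m where "m = min 1 \<alpha> * (\<gamma>\<^sup>2 / 2)"
  define E where "E = C * m powr (- \<beta> / 4) / m"
  define M where "M = (\<alpha> + 1) / m + 1 / \<gamma>\<^sup>2 + E * (2 + 2 / \<gamma>\<^sup>2 + 2 / \<beta>)"
  have M0: "0 \<le> M"
  proof -
    have "0 < m" using assms by (simp add: m_def)
    moreover have "0 \<le> E" unfolding E_def using C calculation by simp
    ultimately show ?thesis unfolding M_def using assms by (intro add_nonneg_nonneg mult_nonneg_nonneg divide_nonneg_pos) auto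
  qed
  have main: "ereal_integral (lebesgue_on {z..1})
        (\<lambda>t. SUP x\<in>Rd d. ereal (lambda_max (jacobian_mat d (velocity d p f g \<sigma> t) x))) \<le> ereal (M * 5)"
    if d: "d \<ge> 1" and p: "weakly_log_concave d \<alpha> \<beta> K p" and adm: "admissible_schedule K \<gamma> \<delta> f g \<sigma>" and z: "z \<in> {0..1}"
    for d p f g \<sigma> \<delta> z
  proof -
    have Cf: "C1_ae f" and Cg: "C1_ae g" and Cs: "C1_ae \<sigma>" and mf: "mono_on {0..1} f" and mg: "antimono_on {0..1} g"
      and f01: "f 0 = 0" "f 1 = 1" and g01: "g 0 = 1" "g 1 = 0" and s01: "\<sigma> 0 = 0" "\<sigma> 1 = 0" and \<delta>: "0 < \<delta>" "\<delta> < 1"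
      and incr: "\<forall>t\<in>{0..<\<delta>}. tdifferentiable \<sigma> t \<longrightarrow> tderiv \<sigma> t > 0"
      and decr: "\<forall>t\<in>{\<delta><..<1}. tdifferentiable \<sigma> t \<longrightarrow> tderiv \<sigma> t < 0"
      and gf: "\<And>t. t \<in> {0..1} \<Longrightarrow> \<gamma> \<le> g t + f t" and gg: "\<And>t. t \<in> {0<..<\<delta>} \<Longrightarrow> \<gamma> \<le> g t"
      using adm unfolding admissible_schedule_def by blast+
    have pd: "prob_density d p" using p unfolding weakly_log_concave_def by (rule conjunct1)
    note inc = incr[rule_format] and dec = decr[rule_format]
    note noise = schedule_noise[OF Cs \<delta> incr decr]
    have g_anti: "g t' \<le> g t" if "0 \<le> t" "t \<le> t'" "t' \<le> 1" for t t'
      using mg that by (auto simp: monotone_on_def)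
    \<comment> \<open>\<open>D1\<close> to \<open>D4\<close> dominate the derivatives of
      \<open>f\<close>, of \<sigma> before \<delta>, of \<open>-g\<close>, and of \<phi> after
      \<delta>. Their measurability gives additivity of the integrals; the integrand itself enters
      through monotonicity only.\<close>
    obtain D1 where D1: "D1 \<in> borel_measurable borel" "(\<integral>\<^sup>+ t. D1 t \<partial>lborel) \<le> ennreal (f 1 - f 0)"
      "\<And>t c. t \<in> {0<..<1} \<Longrightarrow> (f has_real_derivative c) (at t) \<Longrightarrow> ennreal c \<le> D1 t"
      using mono_derivative_dominated[OF zero_le_one mf] by blast
    obtain D2 where D2: "D2 \<in> borel_measurable borel" "(\<integral>\<^sup>+ t. D2 t \<partial>lborel) \<le> ennreal (\<sigma> \<delta> - \<sigma> 0)"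
      "\<And>t c. t \<in> {0<..<\<delta>} \<Longrightarrow> (\<sigma> has_real_derivative c) (at t) \<Longrightarrow> ennreal c \<le> D2 t"
      using mono_derivative_dominated[OF less_imp_le[OF \<delta>(1)] noise(1)] by blast
    have "mono_on {0..1} (\<lambda>t. - g t)" by (rule mono_onI) (use g_anti in auto)
    from mono_derivative_dominated[OF zero_le_one this]
    obtain D3 where D3: "D3 \<in> borel_measurable borel" "(\<integral>\<^sup>+ t. D3 t \<partial>lborel) \<le> ennreal (- g 1 - - g 0)"
      "\<And>t c. t \<in> {0<..<1} \<Longrightarrow> ((\<lambda>t. - g t) has_real_derivative c) (at t) \<Longrightarrow> ennreal c \<le> D3 t"
      by blast
    define \<phi> where "\<phi> t = - (((g t)\<^sup>2 + (\<sigma> t)\<^sup>2) powr (\<beta> / 4))" for t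
    have "mono_on {\<delta>..1} \<phi>"
    proof (rule mono_onI)
      fix a b assume ab: "a \<in> {\<delta>..1}" "b \<in> {\<delta>..1}" "a \<le> b"
      have "(g b)\<^sup>2 \<le> (g a)\<^sup>2" "(\<sigma> b)\<^sup>2 \<le> (\<sigma> a)\<^sup>2"
        using ab \<delta> g_anti[of a b] noise(2)[of a b] C1_aeD(1)[OF Cg, of b] C1_aeD(1)[OF Cs, of b]
        by (auto intro!: power_mono)
      then have "((g b)\<^sup>2 + (\<sigma> b)\<^sup>2) powr (\<beta> / 4) \<le> ((g a)\<^sup>2 + (\<sigma> a)\<^sup>2) powr (\<beta> / 4)"
        using assms by (intro powr_mono2) auto
      then show "\<phi> a \<le> \<phi> b" by (simp add: \<phi>_def)
    qed
    from mono_derivative_dominated[OF less_imp_le[OF \<delta>(2)] this]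
    obtain D4 where D4: "D4 \<in> borel_measurable borel" "(\<integral>\<^sup>+ t. D4 t \<partial>lborel) \<le> ennreal (\<phi> 1 - \<phi> \<delta>)"
      "\<And>t c. t \<in> {\<delta><..<1} \<Longrightarrow> (\<phi> has_real_derivative c) (at t) \<Longrightarrow> ennreal c \<le> D4 t"
      by blast
    define H where "H t = (SUP x\<in>Rd d. ereal (lambda_max (jacobian_mat d (velocity d p f g \<sigma> t) x)))" for t
    have bound: "e2ennreal (H t) \<le> ennreal M * (D1 t + D2 t + D3 t + D4 t)"
      if t: "0 < t" "t < 1" "t \<noteq> \<delta>" and df: "tdifferentiable f t" and dg: "tdifferentiable g t" and ds: "tdifferentiable \<sigma> t" for t
    proof -
      have t01: "t \<in> {0..1}" using t by simp
      have \<sigma>t: "0 < \<sigma> t" "\<sigma> t \<le> 1" using noise(3)[OF t(1,2)] C1_aeD(2)[OF Cs t01] by simp_all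
      note rf = C1_aeD(1,2)[OF Cf t01] and rg = C1_aeD(1,2)[OF Cg t01]
      have f'0: "0 \<le> tderiv f t"
        by (rule mono_on_imp_deriv_nonneg[OF mf tderiv_at[OF df t(1,2)]]) (use t in simp)
      have "0 \<le> - tderiv g t"
        by (rule mono_on_imp_deriv_nonneg[OF \<open>mono_on {0..1} (\<lambda>t. - g t)\<close> DERIV_minus[OF tderiv_at[OF dg t(1,2)]]]) (use t in simp)
      then have g'0: "tderiv g t \<le> 0" by simp
      define S where "S = (g t)\<^sup>2 + (\<sigma> t)\<^sup>2"
      have S: "S > 0" unfolding S_def using \<sigma>t by (intro add_nonneg_pos) auto
      have sS: "(sqrt S)\<^sup>2 = S" using S by simp
      define A where "A = (g t * tderiv g t + \<sigma> t * tderiv \<sigma> t) / S"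
      define B where "B = A + (if 0 \<le> tderiv f t - f t * A then (tderiv f t - f t * A) * (f t / S) *
          ((1 + C * (\<alpha> + (f t)\<^sup>2 / S) powr (- \<beta> / 4)) / (\<alpha> + (f t)\<^sup>2 / S)) else 0)"
      have "H t \<le> ereal B"
        unfolding H_def
      proof (rule SUP_least)
        fix x assume "x \<in> Rd d"
        have "lambda_max (jacobian_mat d (velocity d p f g \<sigma> t) x) \<le> B"
          unfolding B_def A_def S_def
        proof (rule lambda_max_velocity_le[where f = f and \<sigma> = \<sigma> and t = t and g = g, OF pd _ \<sigma>t(1) tderiv_zero_if_zero[OF Cf df t(1,2)] rf(1)])
          fix w :: "nat \<Rightarrow> real" assume "f t > 0" "(\<Sum>i<d. (w i)\<^sup>2) = 1"
          then show "Rd_prob.wvar (law d p) d (f t) (sqrt ((g t)\<^sup>2 + (\<sigma> t)\<^sup>2)) x w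
              \<le> (1 + C * (\<alpha> + (f t)\<^sup>2 / ((g t)\<^sup>2 + (\<sigma> t)\<^sup>2)) powr (- \<beta> / 4)) / (\<alpha> + (f t)\<^sup>2 / ((g t)\<^sup>2 + (\<sigma> t)\<^sup>2))"
            using CV[OF p, of "f t" "sqrt S" w x] S unfolding sS unfolding S_def by simp
        qed (use d in simp)
        then show "ereal (lambda_max (jacobian_mat d (velocity d p f g \<sigma> t) x)) \<le> ereal B" by simp
      qed
      \<comment> \<open>Negative values become 0 on both sides, so \<open>B\<close> may well be
        negative.\<close>
      then have HB: "e2ennreal (H t) \<le> ennreal B"
        using e2ennreal_mono[of "H t" "ereal B"] by simp
      have PW: "0 \<le> tderiv \<sigma> t \<Longrightarrow> \<gamma> \<le> g t \<Longrightarrow> B \<le> M * (tderiv f t + tderiv \<sigma> t - tderiv g t)"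
        "tderiv \<sigma> t \<le> 0 \<Longrightarrow> B \<le> M * (tderiv f t + - (\<beta> / 2) * S powr (\<beta> / 4 - 1) * (g t * tderiv g t + \<sigma> t * tderiv \<sigma> t))"
        using one_sided_lipschitz_pointwise[OF assms(1,3,4,5,6) C rf f'0 rg g'0 \<sigma>t gf[OF t01], of "tderiv \<sigma> t"]
        unfolding B_def A_def S_def M_def E_def m_def by blast+
      have E1: "ennreal (tderiv f t) \<le> D1 t" using D1(3)[OF _ tderiv_at[OF df t(1,2)]] t by simp
      show ?thesis
      proof (cases "t < \<delta>")
        case True
        have s'0: "0 < tderiv \<sigma> t" using inc[OF _ ds] t True by simp
        have E2: "ennreal (tderiv \<sigma> t) \<le> D2 t" using D2(3)[OF _ tderiv_at[OF ds t(1,2)]] t True by simp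
        have E3: "ennreal (- tderiv g t) \<le> D3 t" using D3(3)[OF _ DERIV_minus[OF tderiv_at[OF dg t(1,2)]]] t by simp
        have "B \<le> M * (tderiv f t + tderiv \<sigma> t + - tderiv g t)" using PW(1) s'0 gg[of t] t True by simp
        then have "ennreal B \<le> ennreal (M * (tderiv f t + tderiv \<sigma> t + - tderiv g t))" by (rule ennreal_leI)
        also have "\<dots> = ennreal M * (ennreal (tderiv f t) + ennreal (tderiv \<sigma> t) + ennreal (- tderiv g t))"
        proof -
          have "ennreal (tderiv f t + tderiv \<sigma> t + - tderiv g t) = ennreal (tderiv f t) + ennreal (tderiv \<sigma> t) + ennreal (- tderiv g t)"
            using f'0 g'0 s'0 by (subst ennreal_plus, simp, simp, subst ennreal_plus) simp_all
          then show ?thesis using M0 f'0 g'0 s'0 by (subst ennreal_mult) simp_all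
        qed
        also have "\<dots> \<le> ennreal M * (D1 t + D2 t + D3 t)"
          by (rule mult_left_mono[OF add_mono[OF add_mono[OF E1 E2] E3]]) simp
        also have "\<dots> \<le> ennreal M * (D1 t + D2 t + D3 t + D4 t)" by (intro mult_left_mono) simp_all
        finally show ?thesis using HB by (rule order_trans[rotated])
      next
        case False
        then have td: "\<delta> < t" using t by simp
        have s'0: "tderiv \<sigma> t < 0" using dec[OF _ ds] t td by simp
        define D where "D = - (\<beta> / 2) * S powr (\<beta> / 4 - 1) * (g t * tderiv g t + \<sigma> t * tderiv \<sigma> t)"
        have D0: "0 \<le> D"
        proof -
          have "g t * tderiv g t \<le> 0" using rg g'0 by (intro mult_nonneg_nonpos) auto
          moreover have "\<sigma> t * tderiv \<sigma> t \<le> 0" using \<sigma>t s'0 by (intro mult_nonneg_nonpos) auto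
          ultimately have "0 \<le> - (g t * tderiv g t + \<sigma> t * tderiv \<sigma> t)" by simp
          then have "0 \<le> \<beta> / 2 * S powr (\<beta> / 4 - 1) * - (g t * tderiv g t + \<sigma> t * tderiv \<sigma> t)"
            using assms by (intro mult_nonneg_nonneg) auto
          then show ?thesis unfolding D_def mult_minus_left mult_minus_right .
        qed
        have "(\<phi> has_real_derivative D) (at t)"
        proof -
          have d1: "((\<lambda>t. (g t)\<^sup>2 + (\<sigma> t)\<^sup>2) has_real_derivative 2 * (g t * tderiv g t + \<sigma> t * tderiv \<sigma> t)) (at t)"
            using DERIV_add[OF DERIV_power[OF tderiv_at[OF dg t(1,2)], of 2] DERIV_power[OF tderiv_at[OF ds t(1,2)], of 2]]
            by (simp add: algebra_simps)
          have d2: "((\<lambda>z. z powr (\<beta> / 4)) has_real_derivative \<beta> / 4 * S powr (\<beta> / 4 - 1)) (at ((g t)\<^sup>2 + (\<sigma> t)\<^sup>2))"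
            unfolding S_def[symmetric] by (rule has_real_derivative_powr[OF S])
          have alg: "- (\<beta> / 4 * X * (2 * Y)) = - (\<beta> / 2) * X * Y" for X Y by simp
          show ?thesis
            using DERIV_minus[OF DERIV_chain2[OF d2 d1]] unfolding alg \<phi>_def[abs_def] D_def .
        qed
        then have E4: "ennreal D \<le> D4 t" using D4(3) t td by simp
        have "B \<le> M * (tderiv f t + D)" using PW(2) s'0 unfolding D_def by simp
        then have "ennreal B \<le> ennreal (M * (tderiv f t + D))" by (rule ennreal_leI)
        also have "\<dots> = ennreal M * (ennreal (tderiv f t) + ennreal D)"
          using M0 f'0 D0 by (simp add: ennreal_mult ennreal_plus)
        also have "\<dots> \<le> ennreal M * (D1 t + D4 t)" by (rule mult_left_mono[OF add_mono[OF E1 E4]]) simp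
        also have "\<dots> \<le> ennreal M * (D1 t + D2 t + D3 t + D4 t)"
          by (intro mult_left_mono add_right_mono) (simp_all add: add_increasing2)
        finally show ?thesis using HB by (rule order_trans[rotated])
      qed
    qed
    obtain Nf where Nf: "Nf \<in> null_sets lborel" "\<And>t. t \<in> {0..1} - Nf \<Longrightarrow> tdifferentiable f t" using C1_aeD(4)[OF Cf] by blast
    obtain Ng where Ng: "Ng \<in> null_sets lborel" "\<And>t. t \<in> {0..1} - Ng \<Longrightarrow> tdifferentiable g t" using C1_aeD(4)[OF Cg] by blast
    obtain Ns where Ns: "Ns \<in> null_sets lborel" "\<And>t. t \<in> {0..1} - Ns \<Longrightarrow> tdifferentiable \<sigma> t" using C1_aeD(4)[OF Cs] by blast
    \<comment> \<open>The bound needs all three derivatives and an interior time; at \<delta>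
      neither sign regime for \<sigma>' applies.\<close>
    have "Nf \<union> Ng \<union> Ns \<union> {0, 1, \<delta>} \<in> null_sets lborel"
      using Nf(1) Ng(1) Ns(1) by (intro null_sets.Un) (auto intro: finite_imp_null_set_lborel)
    then have "AE t in lborel. t \<notin> Nf \<union> Ng \<union> Ns \<union> {0, 1, \<delta>}" by (rule AE_not_in)
    then have ae: "AE t in lborel. e2ennreal (H t) * indicator {z..1} t \<le> ennreal M * (D1 t + D2 t + D3 t + D4 t)"
    proof eventually_elim
      case (elim t)
      show ?case
      proof (cases "t \<in> {z..1}")
        case True
        then have "0 < t" "t < 1" "t \<noteq> \<delta>" using z elim by auto
        then show ?thesis using bound[of t] Nf(2)[of t] Ng(2)[of t] Ns(2)[of t] elim True by simp
      qed simp
    qed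
    have "(\<integral>\<^sup>+ t. e2ennreal (H t) \<partial>lebesgue_on {z..1}) = (\<integral>\<^sup>+ t. e2ennreal (H t) * indicator {z..1} t \<partial>lebesgue)"
      by (rule nn_integral_restrict_space) simp
    also have "\<dots> \<le> (\<integral>\<^sup>+ t. ennreal M * (D1 t + D2 t + D3 t + D4 t) \<partial>lebesgue)"
      by (rule nn_integral_mono_AE[OF AE_completion[OF ae]])
    also have "\<dots> = (\<integral>\<^sup>+ t. ennreal M * (D1 t + D2 t + D3 t + D4 t) \<partial>lborel)"
      by (rule nn_integral_completion)
    also have "\<dots> = ennreal M * ((\<integral>\<^sup>+ t. D1 t \<partial>lborel) + (\<integral>\<^sup>+ t. D2 t \<partial>lborel) + (\<integral>\<^sup>+ t. D3 t \<partial>lborel) + (\<integral>\<^sup>+ t. D4 t \<partial>lborel))"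
      using D1(1) D2(1) D3(1) D4(1) by (simp add: nn_integral_cmult nn_integral_add)
    \<comment> \<open>Total increments: 1 for \<open>f\<close> and for \<open>-g\<close>, at most 1
      for \<sigma>, and at most (1 + 1) powr (\<beta>/4) \<le> 2 for \<phi>. Their sum is the factor
      5.\<close>
    also have "\<dots> \<le> ennreal M * (ennreal 1 + ennreal 1 + ennreal 1 + ennreal 2)"
    proof (intro mult_left_mono add_mono)
      show "(\<integral>\<^sup>+ t. D1 t \<partial>lborel) \<le> ennreal 1" using D1(2) unfolding f01 by simp
      show "(\<integral>\<^sup>+ t. D3 t \<partial>lborel) \<le> ennreal 1" using D3(2) unfolding g01 by simp
      have "\<sigma> \<delta> \<le> 1" "g \<delta> \<le> 1" "0 \<le> \<sigma> \<delta>" "0 \<le> g \<delta>" using C1_aeD(1,2)[OF Cs, of \<delta>] C1_aeD(1,2)[OF Cg, of \<delta>] \<delta> by simp_all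
      then show "(\<integral>\<^sup>+ t. D2 t \<partial>lborel) \<le> ennreal 1"
        using D2(2) unfolding s01 by (intro order_trans[OF D2(2)] ennreal_leI) (simp add: s01)
      have "(g \<delta>)\<^sup>2 + (\<sigma> \<delta>)\<^sup>2 \<le> 1 + 1"
        using \<open>\<sigma> \<delta> \<le> 1\<close> \<open>g \<delta> \<le> 1\<close> \<open>0 \<le> \<sigma> \<delta>\<close> \<open>0 \<le> g \<delta>\<close> by (intro add_mono power_le_one)
      then have "((g \<delta>)\<^sup>2 + (\<sigma> \<delta>)\<^sup>2) powr (\<beta> / 4) \<le> (1 + 1) powr (\<beta> / 4)"
        using assms by (intro powr_mono2) auto
      also have "\<dots> \<le> (1 + 1) powr 1" using assms by (intro powr_mono) auto
      finally have "\<phi> 1 - \<phi> \<delta> \<le> 2" by (simp add: \<phi>_def g01 s01)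
      then show "(\<integral>\<^sup>+ t. D4 t \<partial>lborel) \<le> ennreal 2" by (intro order_trans[OF D4(2)] ennreal_leI)
    qed simp
    also have "\<dots> = ennreal (M * 5)"
      using M0 by (simp add: ennreal_mult ennreal_plus[symmetric] del: ennreal_plus)
    finally have le: "(\<integral>\<^sup>+ t. e2ennreal (H t) \<partial>lebesgue_on {z..1}) \<le> ennreal (M * 5)" .
    have "ereal_integral (lebesgue_on {z..1}) H \<le> enn2ereal (\<integral>\<^sup>+ t. e2ennreal (H t) \<partial>lebesgue_on {z..1})"
      unfolding ereal_integral_def by (rule ereal_diff_le_self) simp
    also have "\<dots> \<le> enn2ereal (ennreal (M * 5))" using le by (simp only: less_eq_ennreal.rep_eq)
    also have "\<dots> = ereal (M * 5)" using M0 by (simp add: enn2ereal_ennreal)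
    finally show ?thesis unfolding H_def .
  qed
  show ?thesis
  \<comment> \<open>Only 0 \<le> M has been shown; the added 1 makes the constant strictly
    positive.\<close>
  proof (intro exI[of _ "M * 5 + 1"] conjI allI impI ballI)
    show "0 < M * 5 + 1" using M0 by simp
    fix d p f g \<sigma> \<delta> z
    assume "1 \<le> d" "weakly_log_concave d \<alpha> \<beta> K p" "admissible_schedule K \<gamma> \<delta> f g \<sigma>" "z \<in> {0..1::real}"
    from main[OF this] show "ereal_integral (lebesgue_on {z..1})
        (\<lambda>t. SUP x\<in>Rd d. ereal (lambda_max (jacobian_mat d (velocity d p f g \<sigma> t) x))) \<le> ereal (M * 5 + 1)"
      by (rule order_trans) simp
  qed
qed

end
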